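(* Let $1<\beta<2$ and let $\gamma=\inf\{\beta'\in S:\beta'\ge\beta\}$. Then for Lebesgue almost every $\lambda\in(0,1/\gamma)$, the Hausdorff dimension of the SRB-measure of $T_{\beta,\lambda}$ equals $1+\frac{\log\beta}{\log(1/\lambda)}$.
   Context: For $0<\lambda<1$ and $1<\beta<2$, let $Q=[0,1)\times[0,1)$ and define $T_{\beta,\lambda}\colon Q\to Q$ by $T_{\beta,\lambda}(x,y)=(\lambda x,\beta y)$ if $y<1/\beta$ and $T_{\beta,\lambda}(x,y)=(\lambda x+1-\lambda,\beta y-1)$ if $y\ge 1/\beta$. Let $\nu$ be two-dimensional Lebesgue measure on $Q$ and $\nu_n=\frac1n\sum_{k=0}^{n-1}\nu\circ T_{\beta,\lambda}^{-k}$; the SRB-measure of $T_{\beta,\lambda}$ is the (unique) weak limit of $\nu_n$ as $n\to\infty$ (equivalently the invariant measure whose conditional measures along unstable manifolds are equivalent to Lebesgue measure). $\beta$-shifts: for $\beta>1$ let $f_\beta(x)=\beta x\bmod 1$ on $[0,1]$, $d(x,\beta)=(\lfloor\beta f_\beta^{k-1}(x)\rfloor)_{k\ge1}$, and $S_\beta^+$ the closure in the product topology of $\{d(x,\beta):x\in[0,1)\}$. Let $S_\beta$ be the set of bi-infinite sequences $(\ldots,a_{-1},a_0,a_1,\ldots)$ with $(a_n,a_{n+1},\ldots)\in S_\beta^+$ for all $n\in\mathbb Z$, and $S_\beta^-$ the set of $(b_1,b_2,\ldots)$ such that $(\ldots,b_2,b_1,0,0,\ldots)\in S_\beta$ (with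 $b_1$ at position $0$ and zeros at positive positions). Define $S=\{\beta>1: S_\beta^+=S_\beta^-\}$. *)

theory Defs
  imports "HOL-Analysis.Analysis"
begin

definition Qsq :: "(real \<times> real) set" where
  "Qsq = {0..<1} \<times> {0..<1}"

definition Tmap :: "real \<Rightarrow> real \<Rightarrow> real \<times> real \<Rightarrow> real \<times> real" where
  "Tmap \<beta> lam p = (if snd p < 1 / \<beta> then (lam * fst p, \<beta> * snd p)
                    else (lam * fst p + 1 - lam, \<beta> * snd p - 1))"

text \<open>Integral of f against nu_n = (1/n) sum_{k<n} nu o T^{-k}, nu = Lebesgue measure on Q.\<close>
definition nu_avg_integral ::
  "real \<Rightarrow> real \<Rightarrow> nat \<Rightarrow> (real \<times> real \<Rightarrow> real) \<Rightarrow> real" where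
  "nu_avg_integral \<beta> lam n f =
     (1 / real n) * (\<Sum>k<n. set_lebesgue_integral lborel Qsq (\<lambda>p. f ((Tmap \<beta> lam ^^ k) p)))"

definition is_SRB :: "real \<Rightarrow> real \<Rightarrow> (real \<times> real) measure \<Rightarrow> bool" where
  "is_SRB \<beta> lam \<mu> \<longleftrightarrow>
     sets \<mu> = sets borel \<and> finite_measure \<mu> \<and> emeasure \<mu> (- Qsq) = 0 \<and>
     (\<forall>f :: real \<times> real \<Rightarrow> real. continuous_on Qsq f \<and> bounded (f ` Qsq) \<longrightarrow>
        (\<lambda>n. nu_avg_integral \<beta> lam n f) \<longlonglongrightarrow> set_lebesgue_integral \<mu> Qsq f)"

definition hausdorff_content :: "real \<Rightarrow> real \<Rightarrow> 'a::metric_space set \<Rightarrow> ennreal" where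
  "hausdorff_content s \<delta> A =
     (INF U \<in> {U :: nat \<Rightarrow> 'a set. A \<subseteq> (\<Union>i. U i) \<and>
                 (\<forall>i. bounded (U i) \<and> diameter (U i) \<le> \<delta>)}.
        (\<Sum>i. ennreal (diameter (U i) powr s)))"

definition hausdorff_measure :: "real \<Rightarrow> 'a::metric_space set \<Rightarrow> ennreal" where
  "hausdorff_measure s A = (SUP \<delta> \<in> {0<..}. hausdorff_content s \<delta> A)"

definition hausdorff_dim :: "'a::metric_space set \<Rightarrow> real" where
  "hausdorff_dim A = Inf {s. 0 < s \<and> hausdorff_measure s A = 0}"

definition measure_hausdorff_dim :: "'a::metric_space measure \<Rightarrow> real" where
  "measure_hausdorff_dim \<mu> =
     Inf (hausdorff_dim ` {A. A \<in> sets borel \<and> emeasure \<mu> (space \<mu> - A) = 0})"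

definition f_beta :: "real \<Rightarrow> real \<Rightarrow> real" where
  "f_beta \<beta> x = frac (\<beta> * x)"

text \<open>Greedy digits, 0-indexed: digit k here is the paper's digit k+1.\<close>
definition digits :: "real \<Rightarrow> real \<Rightarrow> nat \<Rightarrow> nat" where
  "digits x \<beta> k = nat \<lfloor>\<beta> * (f_beta \<beta> ^^ k) x\<rfloor>"

definition S_plus :: "real \<Rightarrow> (nat \<Rightarrow> nat) set" where
  "S_plus \<beta> = closure {digits x \<beta> | x. 0 \<le> x \<and> x < 1}"

definition S_bi :: "real \<Rightarrow> (int \<Rightarrow> nat) set" where
  "S_bi \<beta> = {a. \<forall>n::int. (\<lambda>k::nat. a (n + int k)) \<in> S_plus \<beta>}"

text \<open>b 0 = b_1 sits at position 0, b j at position -j, zeros at positive positions.\<close>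
definition S_minus :: "real \<Rightarrow> (nat \<Rightarrow> nat) set" where
  "S_minus \<beta> = {b. (\<lambda>i::int. if i \<le> 0 then b (nat (- i)) else 0) \<in> S_bi \<beta>}"

definition S_set :: "real set" where
  "S_set = {\<beta>. 1 < \<beta> \<and> S_plus \<beta> = S_minus \<beta>}"

end

theory Submission
  imports Defs "HOL-Probability.Probability"
begin

text \<open>
  Write \<open>f\<close> for the beta map, so that the \<open>n\<close>-th iterate of the baker map is
  \<open>(x, y) \<mapsto> (lam ^ n * x + X\<^sub>n y, f\<^sup>n y)\<close>. Two facts hold for every \<open>lam < 1\<close>: the preimage
  \<open>f\<^sup>-\<^sup>k J\<close> has Lebesgue measure at most a constant times that of \<open>J\<close>, and \<open>X\<^sub>n\<close> takes at most a
  constant times \<open>\<beta> ^ n\<close> values; the latter gives the upper bound for the dimension by covering the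
  attractor with squares.

  If \<open>lam < 1 / \<gamma>'\<close> with \<open>\<gamma>' \<in> S\<close> and \<open>\<gamma>' \<ge> \<beta>\<close>, then there are no overlaps: a reversed word of the
  \<open>\<beta>\<close>-shift lies in \<open>S\<^sub>\<gamma>\<^sub>'\<^sup>- = S\<^sub>\<gamma>\<^sub>'\<^sup>+\<close>, so the sum of \<open>s\<^sub>i * \<gamma>' ^ -(i + 1)\<close> over it is at most 1, and hence
  the sum of \<open>s\<^sub>i * lam ^ (i + 1)\<close> is at most \<open>lam * \<gamma>' < 1\<close>. Words that differ among the last \<open>n\<close> digits
  are therefore mapped to \<open>x\<close>-coordinates at distance at least \<open>c * lam ^ n\<close>. A box of size \<open>lam ^ n\<close>
  thus sees a single \<open>n\<close>-cylinder and has measure at most a constant times \<open>lam ^ n * \<beta> ^ -n\<close>, and the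
  mass distribution principle gives the lower bound.

  For existence, a renewal identity along the orbit of 1 shows that the averages of \<open>q \<circ> f\<^sup>k\<close> converge to
  the integral of \<open>q\<close> against the Parry measure. The SRB measure is the law of \<open>(x, y\<^sub>0)\<close>, where
  \<open>(y\<^sub>0, y\<^sub>1, \<dots>)\<close> is a random backward orbit of the Parry measure (a projective limit) and \<open>x\<close> is read
  off from the digits of \<open>y\<^sub>1, y\<^sub>2, \<dots>\<close>.
\<close>

section \<open>Iterates of the beta map and the baker map\<close>

text \<open>The x-coordinate gives recent digits the largest weight, so it reads orbit words
  backwards; this is where reversal, and with it the condition defining \<open>S_set\<close>,
  enters. The exponent comes from \<open>lam powr d = lam / \<beta>\<close>: a box of side
  \<open>lam ^ n\<close> should carry mass about \<open>(lam / \<beta>) ^ n\<close>.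

  Two obstacles shape the rest. \<open>Tmap\<close> is discontinuous and \<open>is_SRB\<close>
  speaks only of limits against continuous functions, so a bound on an SRB measure is proved for the
  Lebesgue measure of preimages of open sets, uniformly in large \<open>k\<close>, and then passed
  to the limit. And the test functions are continuous only on the half-open square, so mass might
  escape to the missing edges x = 1 and y = 1; long runs of the digit 1 and images close to 1 must
  be shown to be rare.

  The branches of \<open>bmap\<close> are not all full, so counts and measures are followed on all
  intervals [0, c): one step turns [0, c) into [0, \<beta> * c), or into [0, 1) and [0, \<beta> * c
  - 1). Iterating from c = 1 produces the orbit of 1, hence the renewal identity and Parry's
  density.\<close>

definition bmap :: "real \<Rightarrow> real \<Rightarrow> real" where
  "bmap \<beta> y = (if y < 1 / \<beta> then \<beta> * y else \<beta> * y - 1)"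

definition bdig :: "real \<Rightarrow> real \<Rightarrow> nat" where
  "bdig \<beta> y = (if y < 1 / \<beta> then 0 else 1)"

text \<open>The x-coordinate of the \<open>n\<close>-th image of (0, y) under \<open>Tmap\<close>.
  The latest digit, at time \<open>n - 1\<close>, has the largest weight: the word is read
  backwards.\<close>

definition xcoord :: "real \<Rightarrow> real \<Rightarrow> nat \<Rightarrow> real \<Rightarrow> real" where
  "xcoord \<beta> lam n y = (1 - lam) * (\<Sum>i<n. lam ^ i * real (bdig \<beta> ((bmap \<beta> ^^ (n - 1 - i)) y)))"

text \<open>The endpoint \<open>c\<close> is a parameter because the branches of \<open>bmap\<close>
  send such intervals to intervals of the same kind, which closes a recursion in
  \<open>k\<close>.\<close>

definition orbit_integral :: "real \<Rightarrow> (real \<Rightarrow> real) \<Rightarrow> nat \<Rightarrow> real \<Rightarrow> real" where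
  "orbit_integral \<beta> q k c = (\<integral>y. indicator {0..<c} y * q ((bmap \<beta> ^^ k) y) \<partial>lborel)"

lemma bmap_measurable [measurable]: "bmap \<beta> \<in> borel_measurable borel"
  unfolding bmap_def[abs_def] by measurable

lemma bmap_funpow_measurable [measurable]: "(bmap \<beta> ^^ k) \<in> borel_measurable borel"
  by (induction k) (auto simp: o_def)

lemma bdig_measurable [measurable]: "bdig \<beta> \<in> measurable borel (count_space UNIV)"
  unfolding bdig_def[abs_def] by measurable

lemma xcoord_measurable [measurable]: "xcoord \<beta> lam n \<in> borel_measurable borel"
  unfolding xcoord_def[abs_def] by measurable

lemma xcoord_0 [simp]: "xcoord \<beta> lam 0 y = 0"
  by (simp add: xcoord_def)

lemma xcoord_Suc:
  "xcoord \<beta> lam (Suc n) y = lam * xcoord \<beta> lam n y + (1 - lam) * real (bdig \<beta> ((bmap \<beta> ^^ n) y))"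
proof -
  have "(\<Sum>i<Suc n. lam ^ i * real (bdig \<beta> ((bmap \<beta> ^^ (Suc n - 1 - i)) y))) =
      real (bdig \<beta> ((bmap \<beta> ^^ n) y)) + lam * (\<Sum>i<n. lam ^ i * real (bdig \<beta> ((bmap \<beta> ^^ (n - 1 - i)) y)))"
    by (subst sum.lessThan_Suc_shift) (simp add: sum_distrib_left mult.assoc)
  then show ?thesis by (simp add: xcoord_def algebra_simps)
qed

text \<open>Splits off the oldest digit, whereas \<open>xcoord_Suc\<close> splits off the latest.
  Counting codes by the first branch taken uses this form.\<close>

lemma xcoord_Suc_right:
  "xcoord \<beta> lam (Suc n) y = xcoord \<beta> lam n (bmap \<beta> y) + (1 - lam) * lam ^ n * real (bdig \<beta> y)"
proof (induction n)
  case 0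
  then show ?case by (simp add: xcoord_Suc)
next
  case (Suc n)
  show ?case
    by (subst xcoord_Suc, subst Suc, subst xcoord_Suc)
       (simp add: funpow_Suc_right algebra_simps del: funpow.simps)
qed

lemma Tmap_funpow:
  "(Tmap \<beta> lam ^^ n) (x, y) = (lam ^ n * x + xcoord \<beta> lam n y, (bmap \<beta> ^^ n) y)"
proof (induction n)
  case 0
  then show ?case by simp
next
  case (Suc n)
  then show ?case
    by (simp add: Tmap_def xcoord_Suc bmap_def[of \<beta> "(bmap \<beta> ^^ n) y"] bdig_def algebra_simps)
qed

text \<open>A recursion shared by measures of preimages and by numbers of codes divided by
  \<beta>^k. The part proportional to \<open>c\<close> reproduces itself, since 1 + (\<beta> * c -
  1) = \<beta> * c. The remaining part doubles only when 1 / \<beta> < c, and then the surplus copy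
  is absorbed into the coefficient of \<open>c\<close>.\<close>

lemma expansion_growth:
  fixes g :: "nat \<Rightarrow> real \<Rightarrow> real"
  assumes \<beta>: "1 < \<beta>" "\<beta> < 2" and B: "0 \<le> B"
    and g0: "\<And>c. 0 \<le> c \<Longrightarrow> c \<le> 1 \<Longrightarrow> g 0 c \<le> B"
    and g1: "\<And>k c. 0 \<le> c \<Longrightarrow> c \<le> 1 / \<beta> \<Longrightarrow> g (Suc k) c \<le> g k (\<beta> * c) / \<beta>"
    and g2: "\<And>k c. 1 / \<beta> < c \<Longrightarrow> c \<le> 1 \<Longrightarrow> g (Suc k) c \<le> (g k 1 + g k (\<beta> * c - 1)) / \<beta>"
    and c: "0 \<le> c" "c \<le> 1"
  shows "g k c \<le> B * (c * (\<Sum>i<k. (1 / \<beta>) ^ i) + (1 / \<beta>) ^ k)"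
  using c
proof (induction k arbitrary: c)
  case 0
  then show ?case using g0[of c] by simp
next
  case (Suc k)
  let ?U = "\<Sum>i<k. (1 / \<beta>) ^ i" and ?e = "(1 / \<beta>) ^ k"
  have e: "0 < ?e" using \<beta> by simp
  show ?case
  proof (cases "c \<le> 1 / \<beta>")
    case True
    have "g (Suc k) c \<le> g k (\<beta> * c) / \<beta>" using g1 True Suc.prems by blast
    also have "g k (\<beta> * c) \<le> B * ((\<beta> * c) * ?U + ?e)"
      using Suc True \<beta> by (intro Suc.IH) (auto simp: field_simps)
    also have "B * ((\<beta> * c) * ?U + ?e) / \<beta> = B * (c * ?U + ?e / \<beta>)"
      using \<beta> by (simp add: field_simps)
    also have "\<dots> \<le> B * (c * (?U + ?e) + ?e / \<beta>)"
      using B e Suc.prems by (intro mult_left_mono add_mono) auto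
    finally show ?thesis using \<beta> by (simp add: divide_right_mono)
  next
    case False
    have c1: "1 \<le> \<beta> * c" "\<beta> * c - 1 \<le> 1"
      using False \<beta> Suc.prems mult_mono[of \<beta> 2 c 1] by (auto simp: field_simps)
    have "g (Suc k) c \<le> (g k 1 + g k (\<beta> * c - 1)) / \<beta>" using g2 False Suc.prems by auto
    also have "\<dots> \<le> (B * (1 * ?U + ?e) + B * ((\<beta> * c - 1) * ?U + ?e)) / \<beta>"
      using Suc.IH[of 1] Suc.IH[of "\<beta> * c - 1"] c1 \<beta> by (intro divide_right_mono add_mono) auto
    also have "\<dots> = B * (c * ?U + (1 / \<beta>) * ?e + ?e / \<beta>)"
      using \<beta> by (simp add: field_simps)
    also have "\<dots> \<le> B * (c * ?U + c * ?e + ?e / \<beta>)"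
      using False e B Suc.prems by (intro mult_left_mono add_mono mult_right_mono) auto
    finally show ?thesis using \<beta> by (simp add: algebra_simps)
  qed
qed

lemma expansion_growth_bound:
  fixes g :: "nat \<Rightarrow> real \<Rightarrow> real"
  assumes \<beta>: "1 < \<beta>" "\<beta> < 2" and B: "0 \<le> B"
    and "\<And>c. 0 \<le> c \<Longrightarrow> c \<le> 1 \<Longrightarrow> g 0 c \<le> B"
    and "\<And>k c. 0 \<le> c \<Longrightarrow> c \<le> 1 / \<beta> \<Longrightarrow> g (Suc k) c \<le> g k (\<beta> * c) / \<beta>"
    and "\<And>k c. 1 / \<beta> < c \<Longrightarrow> c \<le> 1 \<Longrightarrow> g (Suc k) c \<le> (g k 1 + g k (\<beta> * c - 1)) / \<beta>"
  shows "g k 1 \<le> B * (\<beta> / (\<beta> - 1) + 1)"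
proof -
  have "(\<Sum>i<k. (1 / \<beta>) ^ i) \<le> (\<Sum>i. (1 / \<beta>) ^ i)"
    using \<beta> by (intro sum_le_suminf summable_geometric) auto
  also have "\<dots> = \<beta> / (\<beta> - 1)"
    using \<beta> by (subst suminf_geometric) (auto simp: field_simps)
  finally have "(\<Sum>i<k. (1 / \<beta>) ^ i) \<le> \<beta> / (\<beta> - 1)" .
  moreover have "(1 / \<beta>) ^ k \<le> 1" using \<beta> by (intro power_le_one) auto
  moreover have "g k 1 \<le> B * (1 * (\<Sum>i<k. (1 / \<beta>) ^ i) + (1 / \<beta>) ^ k)"
    using assms by (intro expansion_growth) auto
  ultimately show ?thesis
    using B by (smt (verit, ccfv_threshold) mult_left_mono)
qed

locale beta_expansion =
  fixes \<beta> :: real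
  assumes beta_gt_1: "1 < \<beta>" and beta_lt_2: "\<beta> < 2"
begin

abbreviation f where "f \<equiv> bmap \<beta>"

text \<open>The constant of \<open>expansion_growth_bound\<close> for \<open>B = 1\<close>: the full
  geometric series of 1 / \<beta>, plus 1.\<close>

definition growth_const :: real where "growth_const = \<beta> / (\<beta> - 1) + 1"

lemma growth_const_gt_1: "1 < growth_const" unfolding growth_const_def using beta_gt_1 by simp

lemma f_range: "y \<in> {0..<1} \<Longrightarrow> f y \<in> {0..<1}"
  using beta_gt_1 beta_lt_2 mult_strict_mono[of \<beta> 2 y 1]
  by (auto simp: bmap_def field_simps)

lemma f_funpow_range: "y \<in> {0..<1} \<Longrightarrow> (f ^^ k) y \<in> {0..<1}"
  by (induction k) (simp_all add: f_range del: atLeastLessThan_iff)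

lemma orbit_integrable:
  fixes M :: real
  assumes [measurable]: "q \<in> borel_measurable borel" and "\<And>y. \<bar>q y\<bar> \<le> M"
  shows "integrable lborel (\<lambda>y. indicator {a..<c} y * q ((f ^^ k) y))"
proof -
  have "set_integrable lborel {a..<c} (\<lambda>y. q ((f ^^ k) y))"
    unfolding set_integrable_def
    by (rule integrableI_bounded_set_indicator[where B=M]) (auto simp: assms emeasure_lborel_Icc_eq intro!: le_less_trans[OF emeasure_mono[of "{a..<c}" "{a..c}"]])
  then show ?thesis by (simp add: set_integrable_def)
qed

lemma orbit_integral_low:
  assumes "q \<in> borel_measurable borel" "\<And>y. \<bar>q y\<bar> \<le> M" "c \<le> 1 / \<beta>"
  shows "orbit_integral \<beta> q (Suc k) c = orbit_integral \<beta> q k (\<beta> * c) / \<beta>"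
proof -
  have "orbit_integral \<beta> q k (\<beta> * c) =
      \<beta> * (\<integral>y. indicator {0..<\<beta> * c} (0 + \<beta> * y) * q ((f ^^ k) (0 + \<beta> * y)) \<partial>lborel)"
    unfolding orbit_integral_def
    using beta_gt_1 by (subst lborel_integral_real_affine[of \<beta> _ 0]) auto
  also have "(\<lambda>y. indicator {0..<\<beta> * c} (0 + \<beta> * y) * q ((f ^^ k) (0 + \<beta> * y))) =
      (\<lambda>y. indicator {0..<c} y * q ((f ^^ Suc k) y))"
    using beta_gt_1 assms(3)
    by (auto simp: fun_eq_iff indicator_def funpow_Suc_right bmap_def zero_le_mult_iff simp del: funpow.simps)
  finally show ?thesis using beta_gt_1 by (simp add: orbit_integral_def)
qed

lemma orbit_integral_high:
  assumes q: "q \<in> borel_measurable borel" "\<And>y. \<bar>q y\<bar> \<le> M" and c: "1 / \<beta> \<le> c"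
  shows "orbit_integral \<beta> q (Suc k) c =
    (orbit_integral \<beta> q k 1 + orbit_integral \<beta> q k (\<beta> * c - 1)) / \<beta>"
proof -
  have "orbit_integral \<beta> q k (\<beta> * c - 1) =
      \<beta> * (\<integral>y. indicator {0..<\<beta> * c - 1} (-1 + \<beta> * y) * q ((f ^^ k) (-1 + \<beta> * y)) \<partial>lborel)"
    unfolding orbit_integral_def
    using beta_gt_1 by (subst lborel_integral_real_affine[of \<beta> _ "-1"]) auto
  also have "(\<lambda>y. indicator {0..<\<beta> * c - 1} (-1 + \<beta> * y) * q ((f ^^ k) (-1 + \<beta> * y))) =
      (\<lambda>y. indicator {1 / \<beta>..<c} y * q ((f ^^ Suc k) y))"
    using beta_gt_1
    by (auto simp: fun_eq_iff indicator_def funpow_Suc_right bmap_def field_simps simp del: funpow.simps)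
  finally have 1: "(\<integral>y. indicator {1 / \<beta>..<c} y * q ((f ^^ Suc k) y) \<partial>lborel) = orbit_integral \<beta> q k (\<beta> * c - 1) / \<beta>"
    using beta_gt_1 by simp
  have b0: "0 \<le> x" if "1 / \<beta> \<le> x" for x
    using that beta_gt_1 by (meson dual_order.trans less_eq_real_def zero_less_divide_1_iff zero_less_one less_trans)
  have "orbit_integral \<beta> q (Suc k) c = (\<integral>y. indicator {0..<1 / \<beta>} y * q ((f ^^ Suc k) y) + indicator {1 / \<beta>..<c} y * q ((f ^^ Suc k) y) \<partial>lborel)"
    unfolding orbit_integral_def using b0 c
    by (intro Bochner_Integration.integral_cong refl) (auto simp: indicator_def dest: b0)
  also have "\<dots> = orbit_integral \<beta> q (Suc k) (1 / \<beta>) + orbit_integral \<beta> q k (\<beta> * c - 1) / \<beta>"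
    unfolding orbit_integral_def 1[unfolded orbit_integral_def, symmetric]
    by (rule Bochner_Integration.integral_add) (rule orbit_integrable[OF q])+
  also have "orbit_integral \<beta> q (Suc k) (1 / \<beta>) = orbit_integral \<beta> q k 1 / \<beta>"
    using orbit_integral_low[OF q, of "1 / \<beta>"] beta_gt_1 by simp
  finally show ?thesis by (simp add: add_divide_distrib)
qed

lemma orbit_integral_bound:
  assumes q: "q \<in> borel_measurable borel" "\<And>y. \<bar>q y\<bar> \<le> M" and c: "0 \<le> c" "c \<le> 1"
  shows "\<bar>orbit_integral \<beta> q k c\<bar> \<le> M"
proof -
  have M: "0 \<le> M" using q(2)[of 0] by linarith
  have "\<bar>orbit_integral \<beta> q k c\<bar> \<le> (\<integral>y. indicator {0..<c} y * M \<partial>lborel)"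
    unfolding orbit_integral_def
    using orbit_integrable[of "\<lambda>_. M" "\<bar>M\<bar>" 0 c 0]
    by (intro integral_abs_bound_integral orbit_integrable[OF q]) (auto simp: indicator_def q)
  also have "\<dots> = c * M" using c by simp
  also have "\<dots> \<le> M" using c M by (simp add: mult_left_le_one_le)
  finally show ?thesis .
qed

text \<open>The recursion holds with equality for \<open>orbit_integral\<close> of an indicator,
  with initial values at most the measure of \<open>J\<close>. Uniformity in \<open>k\<close> is the
  point: it survives averaging and weak limits.\<close>

lemma preimage_measure_le:
  assumes [measurable]: "J \<in> sets borel" and J: "J \<subseteq> {0..<1}"
  shows "measure lborel ({0..<1} \<inter> (f ^^ k) -` J) \<le> growth_const * measure lborel J"
proof -
  let ?q = "indicator J :: real \<Rightarrow> real"
  have q: "?q \<in> borel_measurable borel" "\<And>y. \<bar>?q y\<bar> \<le> 1" by (auto simp: indicator_def)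
  have fin: "emeasure lborel J < \<infinity>"
    by (rule le_less_trans[OF emeasure_mono[OF J]]) auto
  have "orbit_integral \<beta> ?q k 1 \<le> measure lborel J * (\<beta> / (\<beta> - 1) + 1)"
  proof (rule expansion_growth_bound[OF beta_gt_1 beta_lt_2])
    fix c :: real assume "0 \<le> c" "c \<le> 1"
    have "orbit_integral \<beta> ?q 0 c \<le> (\<integral>y. indicator J y \<partial>lborel)"
      unfolding orbit_integral_def
      using orbit_integrable[OF q, of 0 c 0] fin
      by (intro integral_mono integrable_real_indicator) (auto simp: indicator_def)
    then show "orbit_integral \<beta> ?q 0 c \<le> measure lborel J" by simp
  qed (auto simp: orbit_integral_low[OF q] orbit_integral_high[OF q])
  moreover have "orbit_integral \<beta> ?q k 1 = (\<integral>y. indicator ({0..<1} \<inter> (f ^^ k) -` J) y \<partial>lborel)"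
    unfolding orbit_integral_def by (intro Bochner_Integration.integral_cong) (auto simp: indicator_def)
  ultimately show ?thesis by (simp add: growth_const_def mult.commute)
qed

end

section \<open>Admissible sequences and separation of codes\<close>

lemma digits_Suc: "digits x \<gamma> (Suc k) = digits (f_beta \<gamma> x) \<gamma> k"
  by (simp add: digits_def funpow_Suc_right del: funpow.simps)

lemma f_beta_range: "f_beta \<gamma> x \<in> {0..<1}"
  by (simp add: f_beta_def frac_lt_1)

text \<open>The greedy remainder left after each digit is nonnegative, so no partial sum overshoots
  \<open>x\<close>.\<close>

lemma digits_partial_sum:
  assumes "1 < \<gamma>" "0 \<le> x" "x < 1"
  shows "(\<Sum>i<n. real (digits x \<gamma> i) / \<gamma> ^ Suc i) \<le> x"
  using assms(2,3)
proof (induction n arbitrary: x)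
  case 0
  then show ?case by simp
next
  case (Suc n)
  have d0: "real (digits x \<gamma> 0) = \<gamma> * x - f_beta \<gamma> x"
    using Suc.prems assms(1) by (simp add: digits_def f_beta_def frac_def)
  have "(\<Sum>i<n. real (digits (f_beta \<gamma> x) \<gamma> i) / \<gamma> ^ Suc i) \<le> f_beta \<gamma> x"
    using f_beta_range[of \<gamma> x] by (intro Suc.IH) auto
  then have "(\<Sum>i<n. real (digits (f_beta \<gamma> x) \<gamma> i) / \<gamma> ^ Suc i) / \<gamma> \<le> f_beta \<gamma> x / \<gamma>"
    using assms(1) by (intro divide_right_mono) auto
  moreover have "(\<Sum>i<Suc n. real (digits x \<gamma> i) / \<gamma> ^ Suc i) =
      real (digits x \<gamma> 0) / \<gamma> + (\<Sum>i<n. real (digits (f_beta \<gamma> x) \<gamma> i) / \<gamma> ^ Suc i) / \<gamma>"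
    by (subst sum.lessThan_Suc_shift) (simp add: digits_Suc sum_divide_distrib mult.commute)
  moreover have "real (digits x \<gamma> 0) / \<gamma> + f_beta \<gamma> x / \<gamma> = x"
    using assms(1) by (simp add: d0 flip: add_divide_distrib)
  ultimately show ?case by linarith
qed

text \<open>With discrete factors, fixing finitely many coordinates is an open condition, so the
  closure consists of the sequences all of whose prefixes occur in \<open>A\<close>;
  \<open>closure_seqI\<close> is the other direction.\<close>

lemma closure_seqE:
  fixes A :: "(nat \<Rightarrow> nat) set"
  assumes "s \<in> closure A"
  obtains t where "t \<in> A" "\<forall>i<n. t i = s i"
proof -
  have "open {t :: nat \<Rightarrow> nat. \<forall>i<n. t i = s i}"
  proof -
    have "open ((\<lambda>t::nat \<Rightarrow> nat. t i) -` {s i})" for i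
      by (intro open_vimage continuous_on_product_coordinates)
         (rule discrete_topology_class.open_discrete)
    then have "open (\<Inter>i<n. (\<lambda>t::nat \<Rightarrow> nat. t i) -` {s i})" by blast
    also have "(\<Inter>i<n. (\<lambda>t::nat \<Rightarrow> nat. t i) -` {s i}) = {t. \<forall>i<n. t i = s i}" by auto
    finally show ?thesis .
  qed
  then have "{t :: nat \<Rightarrow> nat. \<forall>i<n. t i = s i} \<inter> A \<noteq> {}"
    using assms open_Int_closure_eq_empty by auto
  then show ?thesis using that by auto
qed

lemma closure_seqI:
  fixes A :: "(nat \<Rightarrow> nat) set"
  assumes "\<And>n. \<exists>t\<in>A. \<forall>i<n. t i = s i"
  shows "s \<in> closure A"
proof -
  obtain t where t: "\<And>n. t n \<in> A" "\<And>n i. i < n \<Longrightarrow> t n i = s i" using assms by metis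
  have "t \<longlonglongrightarrow> s"
    unfolding limitin_canonical_iff[symmetric] euclidean_product_topology[symmetric] limitin_componentwise
  proof (simp add: limitin_canonical_iff, intro allI)
    fix i
    show "(\<lambda>n. t n i) \<longlonglongrightarrow> s i"
      by (rule tendsto_eventually) (use t(2) in \<open>auto simp: eventually_sequentially intro!: exI[of _ "Suc i"]\<close>)
  qed
  moreover have "\<forall>\<^sub>F n in sequentially. t n \<in> closure A"
    using t(1) closure_subset[of A] by (intro always_eventually) blast
  ultimately show ?thesis
    using Lim_in_closed_set[OF closed_closure _ trivial_limit_sequentially] by blast
qed

lemma S_plus_partial_sum:
  assumes "1 < \<gamma>" "s \<in> S_plus \<gamma>"
  shows "(\<Sum>i<n. real (s i) / \<gamma> ^ Suc i) \<le> 1"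
proof -
  obtain t where t: "t \<in> {digits x \<gamma> | x. 0 \<le> x \<and> x < 1}" "\<forall>i<n. t i = s i"
    using assms(2) unfolding S_plus_def by (rule closure_seqE)
  then obtain x where "t = digits x \<gamma>" "0 \<le> x" "x < 1" by auto
  then show ?thesis using digits_partial_sum[of \<gamma> x n] assms t by simp
qed

text \<open>Multiplication by \<gamma> turns the value of a tail into its leading digit plus the
  value of the next tail. As the latter lies in [0, 1), \<open>f_beta\<close> moves along the tails
  and the floor returns the digit. This replaces the lexicographic admissibility condition.\<close>

lemma greedy_digits:
  fixes w :: "nat \<Rightarrow> nat"
  assumes \<gamma>: "1 < \<gamma>" and fin: "\<And>k. k \<ge> n \<Longrightarrow> w k = 0"
    and tail: "\<And>i. (\<Sum>k<n. real (w (i + k)) / \<gamma> ^ Suc k) < 1"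
  shows "digits (\<Sum>k<n. real (w k) / \<gamma> ^ Suc k) \<gamma> = w"
proof -
  let ?v = "\<lambda>i. \<Sum>k<n. real (w (i + k)) / \<gamma> ^ Suc k"
  have v0: "0 \<le> ?v i" for i using \<gamma> by (intro sum_nonneg) auto
  have step: "\<gamma> * ?v i = real (w i) + ?v (Suc i)" for i
  proof -
    have "\<gamma> * ?v i = (\<Sum>k<n. real (w (i + k)) / \<gamma> ^ k)"
      using \<gamma> by (simp add: sum_distrib_left)
    \<comment> \<open>The additional term belongs to the digit at \<open>i + n\<close>, which is
      0.\<close>
    also have "\<dots> = (\<Sum>k<Suc n. real (w (i + k)) / \<gamma> ^ k)"
      using fin[of "i + n"] by simp
    also have "\<dots> = real (w i) + ?v (Suc i)"
      by (subst sum.lessThan_Suc_shift) simp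
    finally show ?thesis .
  qed
  have orb: "(f_beta \<gamma> ^^ k) (?v 0) = ?v k" for k
  proof (induction k)
    case (Suc k)
    have "frac (\<gamma> * ?v k) = ?v (Suc k)"
      using v0[of "Suc k"] tail[of "Suc k"] unfolding step
      by (subst frac_unique_iff) auto
    then show ?case using Suc by (simp add: f_beta_def)
  qed simp
  show ?thesis
  proof
    fix k
    have "\<lfloor>real (w k) + ?v (Suc k)\<rfloor> = int (w k)"
      using v0[of "Suc k"] tail[of "Suc k"] by (intro floor_unique) auto
    then show "digits (\<Sum>k<n. real (w k) / \<gamma> ^ Suc k) \<gamma> k = w k"
      using orb[of k] step[of k] by (simp add: digits_def)
  qed
qed

lemma greedy_in_S_plus:
  fixes w :: "nat \<Rightarrow> nat"
  assumes \<gamma>: "1 < \<gamma>" and fin: "\<And>k. k \<ge> n \<Longrightarrow> w k = 0"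
    and tail: "\<And>i. (\<Sum>k<n. real (w (i + k)) / \<gamma> ^ Suc k) < 1"
  shows "w \<in> S_plus \<gamma>"
proof -
  let ?x = "\<Sum>k<n. real (w k) / \<gamma> ^ Suc k"
  have "digits ?x \<gamma> = w" by (rule greedy_digits[OF assms])
  moreover have "0 \<le> ?x" using \<gamma> by (intro sum_nonneg) auto
  moreover have "?x < 1" using tail[of 0] by (simp only: add_0)
  ultimately have "w \<in> {digits x \<gamma> | x. 0 \<le> x \<and> x < 1}" by (intro CollectI exI[of _ ?x]) metis
  then show ?thesis unfolding S_plus_def by (rule subsetD[OF closure_subset])
qed

lemma S_plus_2: "S_plus 2 = {s. \<forall>i. s i \<le> 1}"
proof (intro equalityI subsetI CollectI allI)
  fix s i assume "s \<in> S_plus 2"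
  then obtain t where t: "t \<in> {digits x 2 | x. 0 \<le> x \<and> x < 1}" "\<forall>j<Suc i. t j = s j"
    unfolding S_plus_def by (rule closure_seqE)
  then obtain x where x: "t = digits x 2" "0 \<le> x" "x < 1" by auto
  have "(f_beta 2 ^^ i) x \<in> {0..<1}"
    by (cases i) (use x f_beta_range in auto)
  then have "\<lfloor>2 * (f_beta 2 ^^ i) x\<rfloor> \<le> 1" by (simp add: floor_le_iff)
  from nat_mono[OF this] have "t i \<le> nat 1" unfolding x(1) digits_def .
  then show "s i \<le> 1" using t by simp
next
  fix s :: "nat \<Rightarrow> nat" assume s: "s \<in> {s. \<forall>i. s i \<le> 1}"
  have geo: "(\<Sum>k<n. 1 / 2 ^ Suc k) < (1::real)" for n :: nat
  proof -
    have "(\<Sum>k<n. 1 / 2 ^ Suc k) = 1 - (1/2::real) ^ n"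
      by (induction n) (simp_all add: power_one_over)
    then show ?thesis by simp
  qed
  have "\<exists>t\<in>{digits x 2 | x. 0 \<le> x \<and> x < 1}. \<forall>i<n. t i = s i" for n
  proof -
    \<comment> \<open>Truncation keeps all tail values below 1; an infinite tail of ones has value
      exactly 1 and is not greedy.\<close>
    let ?w = "\<lambda>i. if i < n then s i else 0"
    have tail: "(\<Sum>k<n. real (?w (i + k)) / 2 ^ Suc k) < 1" for i
      by (rule le_less_trans[OF sum_mono geo[of n]])
         (use s in \<open>auto simp: divide_right_mono\<close>)
    have "digits (\<Sum>k<n. real (?w k) / 2 ^ Suc k) 2 = ?w"
      by (rule greedy_digits) (use tail in auto)
    moreover have "0 \<le> (\<Sum>k<n. real (?w k) / 2 ^ Suc k)" by (intro sum_nonneg) auto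
    moreover have "(\<Sum>k<n. real (?w k) / 2 ^ Suc k) < 1" using tail[of 0] by (simp only: add_0)
    ultimately have "?w \<in> {digits x 2 | x. 0 \<le> x \<and> x < 1}"
      by (intro CollectI exI[of _ "\<Sum>k<n. real (?w k) / 2 ^ Suc k"]) metis
    then show ?thesis by (rule bexI[rotated]) simp
  qed
  then show "s \<in> S_plus 2" unfolding S_plus_def by (intro closure_seqI)
qed

text \<open>The full shift on two symbols is invariant under reversal. This provides a member of
  \<open>S_set\<close> above every \<beta> < 2, so the infimum in the theorem is over a nonempty
  set.\<close>

lemma two_in_S_set: "2 \<in> S_set"
proof -
  have "S_minus 2 = {s. \<forall>i. s i \<le> 1}"
  proof (intro equalityI subsetI CollectI allI)
    fix b i assume "b \<in> S_minus 2"
    then have "\<forall>n::int. \<forall>k::nat. (if n + int k \<le> 0 then b (nat (- (n + int k))) else 0) \<le> 1"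
      by (simp add: S_minus_def S_bi_def S_plus_2)
    from this[rule_format, of "- int i" 0] show "b i \<le> 1" by simp
  qed (simp add: S_minus_def S_bi_def S_plus_2)
  then show ?thesis by (simp add: S_set_def S_plus_2)
qed

section \<open>Reversed words of the \<beta>-shift and the gap between codes\<close>

context beta_expansion
begin

lemma bdig_expansion: "\<beta> * y = real (bdig \<beta> y) + f y"
  by (simp add: bdig_def bmap_def)

lemma expansion_partial_sum:
  "y = (\<Sum>k<n. real (bdig \<beta> ((f ^^ k) y)) / \<beta> ^ Suc k) + (f ^^ n) y / \<beta> ^ n"
proof (induction n)
  case (Suc n)
  have "(f ^^ n) y / \<beta> ^ n = real (bdig \<beta> ((f ^^ n) y)) / \<beta> ^ Suc n + (f ^^ Suc n) y / \<beta> ^ Suc n"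
    using beta_gt_1 bdig_expansion[of "(f ^^ n) y"] by (simp add: field_simps)
  then show ?case using Suc by simp
qed simp

text \<open>Raising the base lowers the value, so tails of a \<beta>-word stay below 1 in base
  \<gamma>; by \<open>greedy_in_S_plus\<close> finite \<beta>-words are then admissible for
  \<gamma>.\<close>

lemma expansion_sum_less:
  assumes "y \<in> {0..<1}" "\<beta> \<le> \<gamma>"
  shows "(\<Sum>k<n. real (bdig \<beta> ((f ^^ k) y)) / \<gamma> ^ Suc k) < 1"
proof -
  have "(\<Sum>k<n. real (bdig \<beta> ((f ^^ k) y)) / \<gamma> ^ Suc k) \<le> (\<Sum>k<n. real (bdig \<beta> ((f ^^ k) y)) / \<beta> ^ Suc k)"
    using beta_gt_1 assms(2) by (intro sum_mono divide_left_mono power_mono) auto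
  also have "\<dots> \<le> y"
  proof -
    have "0 \<le> (f ^^ n) y / \<beta> ^ n" using f_funpow_range[OF assms(1), of n] beta_gt_1 by simp
    then show ?thesis using expansion_partial_sum[of y n] by linarith
  qed
  finally show ?thesis using assms by simp
qed

text \<open>Place the first \<open>n\<close> digits of \<open>y\<close>, in natural order, at
  positions -(n - 1) to 0 of a bi-infinite sequence that is 0 elsewhere. All its right tails are
  admissible for \<gamma>, so the reversed word belongs to \<open>S_minus\<close>, which equals
  \<open>S_plus\<close> by the choice of \<gamma>, and values of words in \<open>S_plus\<close> are
  at most 1.\<close>

lemma reversed_word_value:
  assumes y: "y \<in> {0..<1}" and \<gamma>: "\<gamma> \<in> S_set" "\<beta> \<le> \<gamma>"
  shows "(\<Sum>i<n. real (bdig \<beta> ((f ^^ (n - 1 - i)) y)) / \<gamma> ^ Suc i) \<le> 1"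
proof -
  define b where "b = (\<lambda>i. if i < n then bdig \<beta> ((f ^^ (n - 1 - i)) y) else 0)"
  have \<gamma>1: "1 < \<gamma>" using \<gamma> by (auto simp: S_set_def)
  let ?e = "\<lambda>i::int. if i \<le> 0 then b (nat (- i)) else 0"
  have "(\<lambda>k::nat. ?e (m + int k)) \<in> S_plus \<gamma>" for m
  \<comment> \<open>From position \<open>m\<close> up to position 0 there are \<open>1 - m\<close>
    places (none if this is negative); all later entries vanish.\<close>
  proof (rule greedy_in_S_plus[OF \<gamma>1, where n = "nat (1 - m)"])
    fix k assume "nat (1 - m) \<le> k"
    then show "?e (m + int k) = 0" by auto
  next
    fix i
    let ?N = "nat (1 - m)"
    show "(\<Sum>k<?N. real (?e (m + int (i + k))) / \<gamma> ^ Suc k) < 1"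
    proof (cases "- (m + int i) < int n")
      case True
      \<comment> \<open>The time of the digit that stands at position \<open>m + int i\<close>, if
        this position is not positive.\<close>
      define j where "j = n - 1 - nat (- (m + int i))"
      show ?thesis
      proof (cases "m + int i \<le> 0")
        case True
        have "(\<Sum>k<?N. real (?e (m + int (i + k))) / \<gamma> ^ Suc k) \<le>
            (\<Sum>k<?N. real (bdig \<beta> ((f ^^ k) ((f ^^ j) y))) / \<gamma> ^ Suc k)"
        proof (intro sum_mono divide_right_mono)
          fix k
          show "real (?e (m + int (i + k))) \<le> real (bdig \<beta> ((f ^^ k) ((f ^^ j) y)))"
          proof (cases "m + int (i + k) \<le> 0")
            case c: True
            have "n - 1 - nat (- (m + int (i + k))) = k + j" "nat (- (m + int (i + k))) < n"
              using c True \<open>- (m + int i) < int n\<close> by (auto simp: j_def)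
            then show ?thesis using c by (simp add: b_def funpow_add)
          qed auto
        qed (use \<gamma>1 in auto)
        also have "\<dots> < 1" by (rule expansion_sum_less[OF f_funpow_range[OF y] \<gamma>(2)])
        finally show ?thesis .
      next
        case False
        then show ?thesis by simp
      qed
    next
      case False
      \<comment> \<open>leading zeros: the tail value is a negative power of \<open>\<gamma>\<close> times the value of a whole word\<close>
      define t where "t = nat (- (m + int i) - int n + 1)"
      have low: "?e (m + int (i + k)) = 0" if "k < t" for k
        using that by (auto simp: b_def t_def)
      have "(\<Sum>k<?N. real (?e (m + int (i + k))) / \<gamma> ^ Suc k) =
          (\<Sum>k\<in>{t..<?N}. real (?e (m + int (i + k))) / \<gamma> ^ Suc k)"
      proof (rule sum.mono_neutral_right, goal_cases)
        case 3
        have "k < t" if "k \<in> {..<?N} - {t..<?N}" for k using that by auto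
        then show ?case by (intro ballI, subst low) auto
      qed auto
      \<comment> \<open>Nonnegative terms are added so that exactly \<open>?N\<close> of them remain
        after the shift by \<open>t\<close>.\<close>
      also have "\<dots> \<le> (\<Sum>k\<in>{t..<?N + t}. real (?e (m + int (i + k))) / \<gamma> ^ Suc k)"
        using \<gamma>1 by (intro sum_mono2) auto
      also have "\<dots> = (\<Sum>k<?N. real (?e (m + int (i + (k + t)))) / \<gamma> ^ Suc (k + t))"
        using sum.shift_bounds_nat_ivl[of "\<lambda>k. real (?e (m + int (i + k))) / \<gamma> ^ Suc k" 0 t ?N]
        by (simp only: add_0 atLeast0LessThan)
      also have "\<dots> \<le> (\<Sum>k<?N. real (bdig \<beta> ((f ^^ k) y)) / \<gamma> ^ Suc k)"
      proof (rule sum_mono)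
        fix k
        have 1: "real (?e (m + int (i + (k + t)))) \<le> real (bdig \<beta> ((f ^^ k) y))"
        proof (cases "m + int (i + (k + t)) \<le> 0 \<and> k < n")
          case c: True
          have "n - 1 - nat (- (m + int (i + (k + t)))) = k"
            using c False by (auto simp: t_def)
          then show ?thesis using c by (auto simp: b_def)
        next
          case c: False
          then have "?e (m + int (i + (k + t))) = 0"
            using False by (auto simp: t_def b_def)
          then show ?thesis by simp
        qed
        have "\<gamma> ^ Suc k \<le> \<gamma> ^ Suc (k + t)" using \<gamma>1 by (intro power_increasing) auto
        then show "real (?e (m + int (i + (k + t)))) / \<gamma> ^ Suc (k + t) \<le> real (bdig \<beta> ((f ^^ k) y)) / \<gamma> ^ Suc k"
          using 1 \<gamma>1 by (intro frac_le) auto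
      qed
      also have "\<dots> < 1" by (rule expansion_sum_less[OF y \<gamma>(2)])
      finally show ?thesis .
    qed
  qed
  then have "b \<in> S_minus \<gamma>" by (simp add: S_minus_def S_bi_def)
  then have "b \<in> S_plus \<gamma>" using \<gamma> by (simp add: S_set_def)
  from S_plus_partial_sum[OF \<gamma>1 this, of n] show ?thesis by (simp add: b_def)
qed

text \<open>At the latest digit in which the words differ, at some depth j \<le> i, the word with
  digit 1 gains lam^j, while all older digits of the other word recover at most lam^j * (lam *
  \<gamma>). The factor 1 - lam is the normalisation in \<open>xcoord\<close>.\<close>

lemma xcoord_separation:
  assumes y: "y \<in> {0..<1}" "y' \<in> {0..<1}" and \<gamma>: "\<gamma> \<in> S_set" "\<beta> \<le> \<gamma>"
    and lam: "0 < lam" "lam < 1 / \<gamma>"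
    and i: "i < n" "i < m" "bdig \<beta> ((f ^^ (m - 1 - i)) y) \<noteq> bdig \<beta> ((f ^^ (m - 1 - i)) y')"
  shows "(1 - lam) * (1 - lam * \<gamma>) * lam ^ n \<le> \<bar>xcoord \<beta> lam m y - xcoord \<beta> lam m y'\<bar>"
proof -
  have \<gamma>1: "1 < \<gamma>" using \<gamma> by (auto simp: S_set_def)
  have "1 / \<gamma> < 1" using \<gamma>1 by simp
  then have lam1: "lam < 1" "lam * \<gamma> < 1"
    using lam \<gamma>1 by (linarith, simp add: pos_less_divide_eq)
  define a where "a = (\<lambda>y j. bdig \<beta> ((f ^^ (m - 1 - j)) y))"
  define j where "j = (LEAST j. a y j \<noteq> a y' j)"
  have ai: "a y i \<noteq> a y' i" using i by (simp add: a_def)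
  have j: "a y j \<noteq> a y' j" "j \<le> i" "\<And>l. l < j \<Longrightarrow> a y l = a y' l"
    unfolding j_def
    using LeastI[of "\<lambda>j. a y j \<noteq> a y' j", OF ai] Least_le[of "\<lambda>j. a y j \<noteq> a y' j", OF ai]
      not_less_Least[of _ "\<lambda>j. a y j \<noteq> a y' j"] by - blast+
  have aux: "(1 - lam) * (1 - lam * \<gamma>) * lam ^ n \<le> xcoord \<beta> lam m u - xcoord \<beta> lam m v"
    if u: "v \<in> {0..<1}" and e: "\<And>l. l < j \<Longrightarrow> a u l = a v l" and d: "a u j = 1" "a v j = 0" for u v
  proof -
    have split: "(\<Sum>l<m. lam ^ l * real (a z l)) = (\<Sum>l<j. lam ^ l * real (a z l)) + lam ^ j * real (a z j)
        + (\<Sum>l<m - Suc j. lam ^ (l + Suc j) * real (a z (l + Suc j)))" for z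
    proof -
      have "{..<m} = {..<Suc j} \<union> {Suc j..<m}" using j i by auto
      then have "(\<Sum>l<m. lam ^ l * real (a z l)) = (\<Sum>l<Suc j. lam ^ l * real (a z l)) + (\<Sum>l\<in>{Suc j..<m}. lam ^ l * real (a z l))"
        by (simp add: sum.union_disjoint ivl_disj_int)
      also have "(\<Sum>l\<in>{Suc j..<m}. lam ^ l * real (a z l)) = (\<Sum>l<m - Suc j. lam ^ (l + Suc j) * real (a z (l + Suc j)))"
        using sum.shift_bounds_nat_ivl[of "\<lambda>l. lam ^ l * real (a z l)" 0 "Suc j" "m - Suc j"] j i
        by (simp add: atLeast0LessThan)
      finally show ?thesis by simp
    qed
    have 1: "0 \<le> (\<Sum>l<m - Suc j. lam ^ (l + Suc j) * real (a u (l + Suc j)))"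
      using lam by (intro sum_nonneg) auto
    \<comment> \<open>The inequality (lam * \<gamma>)^(l + 1) \<le> lam * \<gamma> trades the
      weights for powers of 1 / \<gamma>. The digits of \<open>v\<close> older than depth
      \<open>j\<close> form its reversed word of length \<open>m - Suc j\<close>, so
      \<open>reversed_word_value\<close> applies.\<close>
    have "(\<Sum>l<m - Suc j. lam ^ (l + Suc j) * real (a v (l + Suc j))) \<le>
        (\<Sum>l<m - Suc j. lam ^ j * (lam * \<gamma>) * (real (bdig \<beta> ((f ^^ (m - Suc j - 1 - l)) v)) / \<gamma> ^ Suc l))"
    proof (rule sum_mono)
      fix l
      have pw: "lam ^ (l + Suc j) = lam ^ j * lam ^ Suc l" by (simp add: power_add)
      have "lam ^ Suc l * \<gamma> ^ Suc l = (lam * \<gamma>) ^ Suc l" by (simp add: power_mult_distrib)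
      also have "\<dots> \<le> (lam * \<gamma>) ^ 1" using lam1 lam \<gamma>1 by (intro power_decreasing) auto
      finally have "lam ^ Suc l \<le> (lam * \<gamma>) / \<gamma> ^ Suc l" using \<gamma>1 by (simp add: field_simps)
      then have "lam ^ j * lam ^ Suc l * real (a v (l + Suc j)) \<le> lam ^ j * ((lam * \<gamma>) / \<gamma> ^ Suc l) * real (a v (l + Suc j))"
        using lam by (intro mult_right_mono mult_left_mono) auto
      moreover have "a v (l + Suc j) = bdig \<beta> ((f ^^ (m - Suc j - 1 - l)) v)"
        by (simp add: a_def algebra_simps)
      ultimately show "lam ^ (l + Suc j) * real (a v (l + Suc j)) \<le> lam ^ j * (lam * \<gamma>) * (real (bdig \<beta> ((f ^^ (m - Suc j - 1 - l)) v)) / \<gamma> ^ Suc l)"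
        by (simp only: pw mult_ac times_divide_eq_right times_divide_eq_left)
    qed
    also have "\<dots> = lam ^ j * (lam * \<gamma>) * (\<Sum>l<m - Suc j. real (bdig \<beta> ((f ^^ (m - Suc j - 1 - l)) v)) / \<gamma> ^ Suc l)"
      by (simp add: sum_distrib_left)
    also have "\<dots> \<le> lam ^ j * (lam * \<gamma>) * 1"
      using reversed_word_value[OF u \<gamma>, of "m - Suc j"] lam \<gamma>1 by (intro mult_left_mono) auto
    finally have "lam ^ j * (1 - lam * \<gamma>) \<le> (\<Sum>l<m. lam ^ l * real (a u l)) - (\<Sum>l<m. lam ^ l * real (a v l))"
      using 1 d e unfolding split[of u] split[of v] by (simp add: algebra_simps)
    then have "(1 - lam) * (lam ^ j * (1 - lam * \<gamma>)) \<le> xcoord \<beta> lam m u - xcoord \<beta> lam m v"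
      using lam1 by (simp add: xcoord_def a_def mult_left_mono flip: right_diff_distrib)
    moreover have "lam ^ n \<le> lam ^ j" using j i lam lam1 by (intro power_decreasing) auto
    then have "(1 - lam) * (1 - lam * \<gamma>) * lam ^ n \<le> (1 - lam) * (1 - lam * \<gamma>) * lam ^ j"
      using lam1 by (intro mult_left_mono) auto
    ultimately show ?thesis by (simp add: mult.commute mult.left_commute)
  qed
  have "(a y j = 1 \<and> a y' j = 0) \<or> (a y' j = 1 \<and> a y j = 0)"
    using j(1) by (auto simp: a_def bdig_def split: if_splits)
  then show ?thesis
    using aux[of y' y] aux[of y y'] y j(3) by fastforce
qed

end

section \<open>Averages and the Parry measure\<close>

definition cesaro :: "(nat \<Rightarrow> real) \<Rightarrow> nat \<Rightarrow> real" where
  "cesaro a n = (1 / real n) * (\<Sum>k<n. a k)"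

lemma cesaro_add: "cesaro (\<lambda>k. a k + b k) n = cesaro a n + cesaro b n"
  by (simp add: cesaro_def sum.distrib algebra_simps)

lemma cesaro_const: "0 < n \<Longrightarrow> cesaro (\<lambda>k. c) n = c"
  by (simp add: cesaro_def)

lemma cesaro_mono: "(\<And>k. k < n \<Longrightarrow> a k \<le> b k) \<Longrightarrow> cesaro a n \<le> cesaro b n"
  unfolding cesaro_def by (intro mult_left_mono sum_mono) auto

lemma over_n_tendsto_0: "(\<lambda>n. K / real n) \<longlonglongrightarrow> 0"
  by (rule lim_const_over_n)

lemma cesaro_tendsto:
  assumes "a \<longlonglongrightarrow> L"
  shows "cesaro a \<longlonglongrightarrow> L"
proof (rule LIMSEQ_I)
  fix e :: real assume e: "0 < e"
  obtain N where N: "\<And>k. k \<ge> N \<Longrightarrow> \<bar>a k - L\<bar> < e / 2"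
    using LIMSEQ_D[OF assms, of "e/2"] e by auto
  define K where "K = (\<Sum>k<N. \<bar>a k - L\<bar>)"
  have "(\<lambda>n. K / real n) \<longlonglongrightarrow> 0" by (rule over_n_tendsto_0)
  then obtain M where M: "\<And>n. n \<ge> M \<Longrightarrow> \<bar>K / real n\<bar> < e / 2"
    using LIMSEQ_D[of "\<lambda>n. K / real n" 0 "e/2"] e by auto
  show "\<exists>n0. \<forall>n\<ge>n0. norm (cesaro a n - L) < e"
  proof (intro exI allI impI)
    fix n assume n: "n \<ge> max 1 (max N M)"
    have "cesaro a n - L = (\<Sum>k<n. a k - L) / real n"
      using n by (simp add: cesaro_def sum_subtractf field_simps)
    also have "\<bar>\<dots>\<bar> \<le> (\<Sum>k<n. \<bar>a k - L\<bar>) / real n"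
      by (simp add: divide_right_mono)
    also have "(\<Sum>k<n. \<bar>a k - L\<bar>) \<le> (\<Sum>k<n. (if k < N then \<bar>a k - L\<bar> else 0) + e / 2)"
      using N e by (intro sum_mono) (auto simp: not_less intro: less_imp_le)
    also have "\<dots> = K + real n * (e / 2)"
    proof -
      have "{..<n} \<inter> {k. k < N} = {..<N}" using n by auto
      then show ?thesis by (simp add: sum.distrib K_def sum.If_cases)
    qed
    also have "(K + real n * (e / 2)) / real n = K / real n + e / 2" using n by (simp add: field_simps)
    also have "\<dots> < e"
    proof -
      have "\<bar>K / real n\<bar> < e / 2" using M n by simp
      then show ?thesis by linarith
    qed
    finally show "norm (cesaro a n - L) < e" by (simp add: divide_right_mono)
  qed
qed

text \<open>Each shift by one lets one term enter the sum and one leave it, at a cost of at most 2 *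
  B.\<close>

lemma cesaro_shift:
  assumes B: "\<And>k. \<bar>a k\<bar> \<le> B"
  shows "\<bar>cesaro (\<lambda>k. a (k + m)) n - cesaro a n\<bar> \<le> 2 * real m * B / real n"
proof -
  have "\<bar>(\<Sum>k<n. a (k + m)) - (\<Sum>k<n. a k)\<bar> \<le> 2 * real m * B"
  proof (induction m)
    case (Suc m)
    have "(\<Sum>k<n. a (k + Suc m)) = (\<Sum>k<n. a (k + m)) - a m + a (n + m)"
      by (induction n) (auto simp: algebra_simps)
    then show ?case using Suc B[of m] B[of "n + m"] by (simp add: algebra_simps)
  qed simp
  moreover have "cesaro (\<lambda>k. a (k + m)) n - cesaro a n = ((\<Sum>k<n. a (k + m)) - (\<Sum>k<n. a k)) / real n"
    by (simp add: cesaro_def diff_divide_distrib)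
  ultimately show ?thesis by (simp add: divide_right_mono)
qed

lemma cesaro_shift_tendsto:
  assumes B: "\<And>k. \<bar>a k\<bar> \<le> B"
  shows "cesaro (\<lambda>k. a (k + m)) \<longlonglongrightarrow> L \<longleftrightarrow> cesaro a \<longlonglongrightarrow> L"
proof -
  have 1: "(\<lambda>n. cesaro (\<lambda>k. a (k + m)) n - cesaro a n) \<longlonglongrightarrow> 0"
    by (rule tendsto_rabs_zero_cancel, rule tendsto_sandwich[OF _ _ tendsto_const over_n_tendsto_0[of "2 * real m * B"]])
       (use cesaro_shift[of a B m, OF B] in auto)
  show ?thesis
  proof
    assume "cesaro (\<lambda>k. a (k + m)) \<longlonglongrightarrow> L"
    from tendsto_diff[OF this 1] show "cesaro a \<longlonglongrightarrow> L" by simp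
  next
    assume "cesaro a \<longlonglongrightarrow> L"
    from tendsto_add[OF this 1] show "cesaro (\<lambda>k. a (k + m)) \<longlonglongrightarrow> L" by simp
  qed
qed

lemma sum_convolution:
  fixes v m :: "nat \<Rightarrow> real"
  shows "(\<Sum>k<n. \<Sum>j\<le>k. v j * m (k - j)) = (\<Sum>i<n. m i * (\<Sum>j<n - i. v j))"
proof (induction n)
  case (Suc n)
  have "(\<Sum>i<Suc n. m i * (\<Sum>j<Suc n - i. v j)) = (\<Sum>i<Suc n. m i * (\<Sum>j<n - i. v j) + m i * v (n - i))"
    by (intro sum.cong refl) (auto simp: Suc_diff_le algebra_simps)
  also have "\<dots> = (\<Sum>i<n. m i * (\<Sum>j<n - i. v j)) + (\<Sum>i\<le>n. m i * v (n - i))"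
    by (simp add: sum.distrib lessThan_Suc_atMost[symmetric])
  also have "(\<Sum>i\<le>n. m i * v (n - i)) = (\<Sum>j\<le>n. v j * m (n - j))"
    by (rule sum.reindex_bij_witness[of _ "\<lambda>j. n - j" "\<lambda>j. n - j"]) auto
  finally show ?case using Suc by simp
qed simp

text \<open>In the average of the convolution each \<open>m i\<close> meets an initial segment of
  \<open>v\<close> of length \<open>n - i\<close>. Geometric decay makes the missing tails summable
  over \<open>i\<close>, so the total error is bounded before the division by
  \<open>n\<close>.\<close>

lemma cesaro_convolution:
  assumes v: "\<And>j. \<bar>v j\<bar> \<le> M * r ^ j" and r: "0 \<le> r" "r < 1" and B: "\<And>k. \<bar>m k\<bar> \<le> B"
  shows "(\<lambda>n. cesaro (\<lambda>k. \<Sum>j\<le>k. v j * m (k - j)) n - (\<Sum>j. v j) * cesaro m n) \<longlonglongrightarrow> 0"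
proof -
  have sm: "summable (\<lambda>j. M * r ^ j)" using r by (intro summable_mult summable_geometric) auto
  have sv: "summable v" by (rule summable_comparison_test'[OF sm]) (use v in auto)
  have M: "0 \<le> M" using v[of 0] by simp
  have B0: "0 \<le> B" using B[of 0] by linarith
  have tail: "\<bar>(\<Sum>j<l. v j) - (\<Sum>j. v j)\<bar> \<le> M / (1 - r) * r ^ l" for l
  proof -
    have "(\<Sum>j. v j) - (\<Sum>j<l. v j) = (\<Sum>j. v (j + l))" using suminf_split_initial_segment[OF sv, of l] by simp
    also have "\<bar>\<dots>\<bar> \<le> (\<Sum>j. M * r ^ l * r ^ j)"
    proof (rule order_trans[OF summable_rabs])
      have s2: "summable (\<lambda>j. M * r ^ l * r ^ j)" using r by (intro summable_mult summable_geometric) auto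
      have le: "\<bar>v (j + l)\<bar> \<le> M * r ^ l * r ^ j" for j using v[of "j + l"] by (simp add: power_add mult_ac)
      show s3: "summable (\<lambda>j. \<bar>v (j + l)\<bar>)" by (rule summable_comparison_test'[OF s2]) (use le in auto)
      show "(\<Sum>j. \<bar>v (j + l)\<bar>) \<le> (\<Sum>j. M * r ^ l * r ^ j)" by (rule suminf_le[OF le s3 s2])
    qed
    also have "\<dots> = M / (1 - r) * r ^ l"
      using r by (subst suminf_mult) (auto simp: suminf_geometric)
    finally show ?thesis by (simp add: abs_minus_commute)
  qed
  \<comment> \<open>One factor 1 / (1 - r) comes from the tail of \<open>v\<close>, the other from
    summing these tails over \<open>i\<close>.\<close>
  define K where "K = B * (M / (1 - r) * (1 / (1 - r)))"
  have bound: "\<bar>cesaro (\<lambda>k. \<Sum>j\<le>k. v j * m (k - j)) n - (\<Sum>j. v j) * cesaro m n\<bar> \<le> K / real n" for n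
  proof -
    have "cesaro (\<lambda>k. \<Sum>j\<le>k. v j * m (k - j)) n - (\<Sum>j. v j) * cesaro m n =
        (\<Sum>i<n. m i * ((\<Sum>j<n - i. v j) - (\<Sum>j. v j))) / real n"
    proof -
      have "(\<Sum>i<n. m i * ((\<Sum>j<n - i. v j) - (\<Sum>j. v j))) = (\<Sum>i<n. m i * (\<Sum>j<n - i. v j)) - (\<Sum>j. v j) * (\<Sum>i<n. m i)"
        by (simp add: right_diff_distrib sum_subtractf sum_distrib_left[of "suminf v"] mult.commute)
      then show ?thesis unfolding cesaro_def sum_convolution by (simp add: diff_divide_distrib)
    qed
    moreover have "\<bar>\<Sum>i<n. m i * ((\<Sum>j<n - i. v j) - (\<Sum>j. v j))\<bar> \<le> (\<Sum>i<n. B * (M / (1 - r) * r ^ (n - i)))"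
      using B tail B0 by (intro order_trans[OF sum_abs] sum_mono) (auto simp: abs_mult intro!: mult_mono simp del: times_divide_eq_left)
    moreover have "(\<Sum>i<n. B * (M / (1 - r) * r ^ (n - i))) = B * (M / (1 - r) * (\<Sum>i<n. r ^ (n - i)))"
      by (simp add: sum_distrib_left)
    moreover have "\<dots> \<le> K"
      unfolding K_def
    proof (intro mult_left_mono)
      have "(\<Sum>i<n. r ^ (n - i)) = (\<Sum>i<n. r ^ Suc i)"
        by (rule sum.reindex_bij_witness[of _ "\<lambda>i. n - Suc i" "\<lambda>i. n - Suc i"]) (auto simp: Suc_diff_Suc)
      also have "\<dots> \<le> (\<Sum>i<n. r ^ i)" using r by (intro sum_mono power_decreasing) auto
      also have "\<dots> \<le> (\<Sum>i. r ^ i)" using r by (intro sum_le_suminf summable_geometric) auto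
      finally show "(\<Sum>i<n. r ^ (n - i)) \<le> 1 / (1 - r)" using r by (simp add: suminf_geometric)
    qed (use M B0 r in auto)
    ultimately show ?thesis by (simp add: divide_right_mono)
  qed
  show ?thesis
    by (rule tendsto_rabs_zero_cancel, rule tendsto_sandwich[OF _ _ tendsto_const over_n_tendsto_0[of K]])
       (use bound in auto)
qed

section \<open>Renewal along the orbit of 1 and the Parry measure\<close>

context beta_expansion
begin

text \<open>The orbit of 1 under the left-continuous version of the map: at 1 / \<beta> the lower
  branch is taken, with image 1. It follows right endpoints of half-open intervals [0, c), not
  points of [0, 1).\<close>

fun one_orbit :: "nat \<Rightarrow> real" where
  "one_orbit 0 = 1"
| "one_orbit (Suc j) = (if one_orbit j \<le> 1 / \<beta> then \<beta> * one_orbit j else \<beta> * one_orbit j - 1)"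

definition one_digit :: "nat \<Rightarrow> real" where
  "one_digit j = (if one_orbit j \<le> 1 / \<beta> then 0 else 1)"

lemma one_orbit_Suc: "one_orbit (Suc j) = \<beta> * one_orbit j - one_digit j"
  by (simp add: one_digit_def)

lemma one_orbit_range: "0 \<le> one_orbit j \<and> one_orbit j \<le> 1"
proof (induction j)
  case (Suc j)
  then have "\<beta> * one_orbit j \<le> 2 * 1" using beta_lt_2 beta_gt_1 by (intro mult_mono) auto
  then show ?case using Suc beta_gt_1 by (auto simp: field_simps)
qed simp

declare one_orbit.simps(2) [simp del]

lemma orbit_integral_one_orbit:
  assumes q: "q \<in> borel_measurable borel" "\<And>y. \<bar>q y\<bar> \<le> M"
  shows "orbit_integral \<beta> q (Suc k) (one_orbit j) =
    (orbit_integral \<beta> q k (one_orbit (Suc j)) + one_digit j * orbit_integral \<beta> q k 1) / \<beta>"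
  using orbit_integral_low[OF q, of "one_orbit j" k] orbit_integral_high[OF q, of "one_orbit j" k]
  by (auto simp: one_orbit.simps(2) one_digit_def)

lemma orbit_integral_unroll:
  assumes q: "q \<in> borel_measurable borel" "\<And>y. \<bar>q y\<bar> \<le> M"
  shows "orbit_integral \<beta> q k (one_orbit i) = (1 / \<beta>) ^ k * orbit_integral \<beta> q 0 (one_orbit (i + k))
    + (\<Sum>j<k. (1 / \<beta>) ^ Suc j * one_digit (i + j) * orbit_integral \<beta> q (k - Suc j) 1)"
proof (induction k arbitrary: i)
  case (Suc k)
  show ?case
    unfolding orbit_integral_one_orbit[OF q] Suc.IH[of "Suc i"]
    by (subst sum.lessThan_Suc_shift) (simp add: add_divide_distrib sum_divide_distrib)
qed simp

text \<open>Let t_j be \<open>one_orbit j\<close>, d_j its digit and m_k the integral over [0, 1) at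
  time k. By t_(j+1) = \<beta> * t_j - d_j, the weighted sum for k + 1 is that for k, plus m_(k+1),
  minus digit terms. The unrolled form of m_(k+1) contains exactly these digit terms, so only
  integrals at time 0 remain.\<close>

lemma renewal_identity:
  assumes q: "q \<in> borel_measurable borel" "\<And>y. \<bar>q y\<bar> \<le> M"
  shows "(\<Sum>j\<le>k. (1 / \<beta>) ^ j * one_orbit j * orbit_integral \<beta> q (k - j) 1) =
    (\<Sum>j\<le>k. (1 / \<beta>) ^ j * orbit_integral \<beta> q 0 (one_orbit j))"
proof (induction k)
  case (Suc k)
  let ?m = "\<lambda>k. orbit_integral \<beta> q k 1"
  have "(\<Sum>j\<le>Suc k. (1 / \<beta>) ^ j * one_orbit j * ?m (Suc k - j)) =
      ?m (Suc k) + (\<Sum>j\<le>k. (1 / \<beta>) ^ Suc j * one_orbit (Suc j) * ?m (k - j))"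
    by (subst sum.atMost_Suc_shift) simp
  also have "(\<Sum>j\<le>k. (1 / \<beta>) ^ Suc j * one_orbit (Suc j) * ?m (k - j)) =
      (\<Sum>j\<le>k. (1 / \<beta>) ^ j * one_orbit j * ?m (k - j)) - (\<Sum>j\<le>k. (1 / \<beta>) ^ Suc j * one_digit j * ?m (k - j))"
    unfolding sum_subtractf[symmetric] one_orbit_Suc using beta_gt_1
    by (intro sum.cong refl) (simp add: algebra_simps)
  also have "?m (Suc k) = (1 / \<beta>) ^ Suc k * orbit_integral \<beta> q 0 (one_orbit (Suc k))
      + (\<Sum>j\<le>k. (1 / \<beta>) ^ Suc j * one_digit j * ?m (k - j))"
    using orbit_integral_unroll[OF q, of "Suc k" 0] by (simp add: lessThan_Suc_atMost)
  finally show ?case using Suc by simp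
qed simp

definition parry_mass :: real where
  "parry_mass = (\<Sum>j. (1 / \<beta>) ^ j * one_orbit j)"

lemma summable_beta: "summable (\<lambda>j. M * (1 / \<beta>) ^ j)"
  using beta_gt_1 by (intro summable_mult summable_geometric) auto

lemma parry_mass_pos: "0 < parry_mass"
proof -
  have "summable (\<lambda>j. (1 / \<beta>) ^ j * one_orbit j)"
    by (rule summable_comparison_test'[OF summable_beta[of 1]])
       (use one_orbit_range beta_gt_1 in \<open>auto simp: abs_mult intro!: mult_left_le\<close>)
  then have "(\<Sum>j\<in>{0}. (1 / \<beta>) ^ j * one_orbit j) \<le> parry_mass"
    unfolding parry_mass_def using one_orbit_range beta_gt_1 by (intro sum_le_suminf) auto
  then show ?thesis by simp
qed

text \<open>The right side of \<open>renewal_identity\<close> converges. Its left side is a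
  convolution with a geometrically decaying kernel of sum \<open>parry_mass\<close>, which acts on
  averages as multiplication by that positive number. Working with averages avoids a mixing
  argument.\<close>

lemma cesaro_orbit_integral:
  assumes q: "q \<in> borel_measurable borel" "\<And>y. \<bar>q y\<bar> \<le> M"
  shows "cesaro (\<lambda>k. orbit_integral \<beta> q k 1) \<longlonglongrightarrow>
     (\<Sum>j. (1 / \<beta>) ^ j * orbit_integral \<beta> q 0 (one_orbit j)) / parry_mass"
proof -
  let ?m = "\<lambda>k. orbit_integral \<beta> q k 1"
  let ?L = "\<Sum>j. (1 / \<beta>) ^ j * orbit_integral \<beta> q 0 (one_orbit j)"
  have b: "\<bar>orbit_integral \<beta> q 0 (one_orbit j)\<bar> \<le> M" for j
    using orbit_integral_bound[OF q] one_orbit_range by blast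
  have "summable (\<lambda>j. (1 / \<beta>) ^ j * orbit_integral \<beta> q 0 (one_orbit j))"
    by (rule summable_comparison_test'[OF summable_beta[of M]])
       (use b beta_gt_1 in \<open>auto simp: abs_mult divide_right_mono power_divide\<close>)
  then have "(\<lambda>k. \<Sum>j\<le>k. (1 / \<beta>) ^ j * orbit_integral \<beta> q 0 (one_orbit j)) \<longlonglongrightarrow> ?L"
    by (rule summable_LIMSEQ')
  then have 1: "cesaro (\<lambda>k. \<Sum>j\<le>k. (1 / \<beta>) ^ j * one_orbit j * ?m (k - j)) \<longlonglongrightarrow> ?L"
    unfolding renewal_identity[OF q] by (rule cesaro_tendsto)
  have 2: "(\<lambda>n. cesaro (\<lambda>k. \<Sum>j\<le>k. ((1 / \<beta>) ^ j * one_orbit j) * ?m (k - j)) n - parry_mass * cesaro ?m n) \<longlonglongrightarrow> 0"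
    unfolding parry_mass_def
  proof (rule cesaro_convolution[where M=1 and r="1/\<beta>" and B=M])
    show "\<bar>(1 / \<beta>) ^ j * one_orbit j\<bar> \<le> 1 * (1 / \<beta>) ^ j" for j
      using one_orbit_range[of j] beta_gt_1 by (simp add: abs_mult mult_left_le divide_right_mono)
  qed (use beta_gt_1 orbit_integral_bound[OF q] in auto)
  have "(\<lambda>n. parry_mass * cesaro ?m n) \<longlonglongrightarrow> ?L" using tendsto_diff[OF 1 2] by simp
  from tendsto_divide[OF this tendsto_const[of parry_mass]] show ?thesis using parry_mass_pos by simp
qed

text \<open>Parry's formula for the invariant density: with this density the limit in
  \<open>cesaro_orbit_integral\<close> becomes an integral.\<close>

definition parry_density :: "real \<Rightarrow> real" where
  "parry_density y = (\<Sum>j. (1 / \<beta>) ^ j * indicator {0..<one_orbit j} y) / parry_mass"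

definition parry :: "real measure" where
  "parry = density lborel (\<lambda>y. ennreal (parry_density y))"

lemma parry_density_measurable [measurable]: "parry_density \<in> borel_measurable borel"
  unfolding parry_density_def[abs_def] by measurable

lemma parry_density_nonneg: "0 \<le> parry_density y"
  unfolding parry_density_def using beta_gt_1 parry_mass_pos
  by (intro divide_nonneg_pos suminf_nonneg summable_comparison_test'[OF summable_beta[of 1]])
     (auto simp: indicator_def)

lemma sets_parry [measurable_cong, simp]: "sets parry = sets borel" and space_parry [simp]: "space parry = UNIV"
  by (simp_all add: parry_def)

lemma integral_parry_density:
  assumes [measurable]: "q \<in> borel_measurable borel" and qM: "\<And>y. \<bar>q y\<bar> \<le> M"
  shows "integrable lborel (\<lambda>y. parry_density y * q y)"
    and "(\<integral>y. parry_density y * q y \<partial>lborel) = (\<Sum>j. (1 / \<beta>) ^ j * orbit_integral \<beta> q 0 (one_orbit j)) / parry_mass"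
proof -
  let ?g = "\<lambda>j y. (1 / \<beta>) ^ j * (indicator {0..<one_orbit j} y * q y)"
  have int: "integrable lborel (\<lambda>y. indicator {0..<one_orbit j} y * q y)" for j
    using orbit_integrable[OF assms, of 0 "one_orbit j" 0] by simp
  have ig: "integrable lborel (?g j)" for j using int by (intro integrable_mult_right) auto
  have b: "norm (?g j y) \<le> M * (1 / \<beta>) ^ j" for j y
    using qM[of y] beta_gt_1 order_trans[OF abs_ge_zero qM[of y]]
    by (auto simp: abs_mult indicator_def power_divide divide_right_mono)
  have sum1: "summable (\<lambda>j. norm (?g j y))" for y
    by (rule summable_comparison_test'[OF summable_beta[of M]]) (use b in auto)
  have sum2: "summable (\<lambda>j. \<integral>y. norm (?g j y) \<partial>lborel)"
  proof (rule summable_comparison_test'[OF summable_beta[of M]])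
    fix j
    have "(\<integral>y. norm (?g j y) \<partial>lborel) = (1 / \<beta>) ^ j * orbit_integral \<beta> (\<lambda>y. \<bar>q y\<bar>) 0 (one_orbit j)"
      unfolding orbit_integral_def using beta_gt_1 by (simp add: abs_mult)
    moreover have "\<bar>orbit_integral \<beta> (\<lambda>y. \<bar>q y\<bar>) 0 (one_orbit j)\<bar> \<le> M"
      by (rule orbit_integral_bound) (use qM one_orbit_range in auto)
    ultimately show "norm (\<integral>y. norm (?g j y) \<partial>lborel) \<le> M * (1 / \<beta>) ^ j"
      using beta_gt_1 by (simp add: abs_mult power_divide divide_right_mono)
  qed
  have eq: "parry_density y * q y = (\<Sum>j. ?g j y) / parry_mass" for y
  proof -
    have "summable (\<lambda>j. (1 / \<beta>) ^ j * indicator {0..<one_orbit j} y)"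
      by (rule summable_comparison_test'[OF summable_beta[of 1]]) (use beta_gt_1 in \<open>auto simp: indicator_def\<close>)
    from suminf_mult2[OF this, of "q y"] show ?thesis by (simp add: parry_density_def mult.assoc)
  qed
  have "integrable lborel (\<lambda>y. \<Sum>j. ?g j y)"
    by (rule integrable_suminf[OF ig]) (use sum1 sum2 in auto)
  then show "integrable lborel (\<lambda>y. parry_density y * q y)" unfolding eq by (rule integrable_divide)
  have "(\<integral>y. (\<Sum>j. ?g j y) \<partial>lborel) = (\<Sum>j. \<integral>y. ?g j y \<partial>lborel)"
    by (rule integral_suminf[OF ig]) (use sum1 sum2 in auto)
  also have "\<dots> = (\<Sum>j. (1 / \<beta>) ^ j * orbit_integral \<beta> q 0 (one_orbit j))"
    by (simp add: orbit_integral_def)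
  finally show "(\<integral>y. parry_density y * q y \<partial>lborel) = (\<Sum>j. (1 / \<beta>) ^ j * orbit_integral \<beta> q 0 (one_orbit j)) / parry_mass"
    unfolding eq by simp
qed

lemma cesaro_parry:
  assumes q: "q \<in> borel_measurable borel" "\<And>y. \<bar>q y\<bar> \<le> M"
  shows "cesaro (\<lambda>k. orbit_integral \<beta> q k 1) \<longlonglongrightarrow> (\<integral>y. q y \<partial>parry)"
proof -
  have "(\<integral>y. q y \<partial>parry) = (\<integral>y. parry_density y * q y \<partial>lborel)"
    unfolding parry_def using q parry_density_nonneg by (subst integral_density) auto
  then show ?thesis using cesaro_orbit_integral[OF q] integral_parry_density(2)[OF q] by simp
qed

text \<open>The total mass is the limit of the averages for the constant 1, whose orbit integrals
  all equal 1.\<close>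

lemma prob_space_parry: "prob_space parry"
proof
  have q: "(\<lambda>_. 1 :: real) \<in> borel_measurable borel" "\<And>y::real. \<bar>1::real\<bar> \<le> 1" by auto
  have "orbit_integral \<beta> (\<lambda>_. 1) k 1 = 1" for k
    by (simp add: orbit_integral_def)
  then have "cesaro (\<lambda>k. orbit_integral \<beta> (\<lambda>_. 1) k 1) \<longlonglongrightarrow> 1"
    using cesaro_tendsto[OF tendsto_const[of 1]] by simp
  then have "(\<Sum>j. (1 / \<beta>) ^ j * orbit_integral \<beta> (\<lambda>_. 1) 0 (one_orbit j)) / parry_mass = 1"
    using cesaro_orbit_integral[OF q] LIMSEQ_unique by blast
  then have "(\<integral>y. parry_density y \<partial>lborel) = 1" using integral_parry_density(2)[OF q] by simp
  moreover have "integrable lborel parry_density" using integral_parry_density(1)[OF q] by simp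
  ultimately have "(\<integral>\<^sup>+ y. ennreal (parry_density y) \<partial>lborel) = 1"
    using parry_density_nonneg by (subst nn_integral_eq_integral) auto
  then show "emeasure parry (space parry) = 1"
    by (simp add: parry_def emeasure_density)
qed

text \<open>Composing the test function with \<open>f\<close> shifts its orbit integrals by one
  step, and a shift does not change the limit of averages. No computation with the density is
  involved.\<close>

lemma parry_invariant: "distr parry borel f = parry"
proof -
  interpret prob_space parry by (rule prob_space_parry)
  interpret D: prob_space "distr parry borel f" by (rule prob_space_distr) simp
  show ?thesis
  proof (rule measure_eqI)
    fix A assume "A \<in> sets (distr parry borel f)"
    then have A [measurable]: "A \<in> sets borel" by simp
    let ?q = "indicator A :: real \<Rightarrow> real"
    have q: "?q \<in> borel_measurable borel" "\<And>y. \<bar>?q y\<bar> \<le> 1" by (auto simp: indicator_def)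
    have qf: "(\<lambda>y. ?q (f y)) \<in> borel_measurable borel" "\<And>y. \<bar>?q (f y)\<bar> \<le> 1" by (auto simp: indicator_def)
    have "orbit_integral \<beta> (\<lambda>y. ?q (f y)) k 1 = orbit_integral \<beta> ?q (k + 1) 1" for k
      by (simp add: orbit_integral_def)
    then have "cesaro (\<lambda>k. orbit_integral \<beta> ?q (k + 1) 1) \<longlonglongrightarrow> (\<integral>y. ?q (f y) \<partial>parry)"
      using cesaro_parry[OF qf] by simp
    then have "cesaro (\<lambda>k. orbit_integral \<beta> ?q k 1) \<longlonglongrightarrow> (\<integral>y. ?q (f y) \<partial>parry)"
      by (subst (asm) cesaro_shift_tendsto[where B=1]) (use orbit_integral_bound[OF q] in auto)
    then have "(\<integral>y. ?q (f y) \<partial>parry) = (\<integral>y. ?q y \<partial>parry)"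
      using cesaro_parry[OF q] LIMSEQ_unique by blast
    moreover have "(\<integral>y. ?q (f y) \<partial>parry) = (\<integral>y. ?q y \<partial>distr parry borel f)"
      by (subst integral_distr) auto
    ultimately have "measure (distr parry borel f) A = measure parry A" by simp
    then show "emeasure (distr parry borel f) A = emeasure parry A"
      by (simp add: D.emeasure_eq_measure emeasure_eq_measure)
  qed simp
qed

lemma parry_invariant_funpow: "distr parry borel (f ^^ k) = parry"
proof (induction k)
  case 0
  then show ?case by (intro measure_eqI) (auto simp: emeasure_distr)
next
  case (Suc k)
  have "distr parry borel (f ^^ Suc k) = distr (distr parry borel (f ^^ k)) borel f"
    by (subst distr_distr) (auto simp: o_def)
  then show ?case unfolding Suc parry_invariant .
qed

lemma AE_parry: "AE y in parry. y \<in> {0..<1}"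
proof -
  have "parry_density y = 0" if "y \<notin> {0..<1}" for y
  proof -
    have "indicator {0..<one_orbit j} y = (0::real)" for j
      using that one_orbit_range[of j] by (auto simp: indicator_def)
    then show ?thesis by (simp add: parry_density_def)
  qed
  then show ?thesis
    unfolding parry_def by (subst AE_density) (auto intro!: AE_I2 simp del: atLeastLessThan_iff, fastforce)
qed

text \<open>The bound on preimages holds at every time, hence for averages and for their
  limit.\<close>

lemma parry_le:
  assumes A [measurable]: "A \<in> sets borel" and A1: "A \<subseteq> {0..<1}"
  shows "measure parry A \<le> growth_const * measure lborel A"
proof -
  let ?q = "indicator A :: real \<Rightarrow> real"
  have q: "?q \<in> borel_measurable borel" "\<And>y. \<bar>?q y\<bar> \<le> 1" by (auto simp: indicator_def)
  have "orbit_integral \<beta> ?q k 1 = measure lborel ({0..<1} \<inter> (f ^^ k) -` A)" for k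
  proof -
    have "orbit_integral \<beta> ?q k 1 = (\<integral>y. indicator ({0..<1} \<inter> (f ^^ k) -` A) y \<partial>lborel)"
      unfolding orbit_integral_def by (intro Bochner_Integration.integral_cong) (auto simp: indicator_def)
    then show ?thesis by simp
  qed
  then have "orbit_integral \<beta> ?q k 1 \<le> growth_const * measure lborel A" for k
    using preimage_measure_le[OF A A1] by simp
  then have "cesaro (\<lambda>k. orbit_integral \<beta> ?q k 1) n \<le> growth_const * measure lborel A" if "n \<ge> 1" for n
    using cesaro_mono[of n "\<lambda>k. orbit_integral \<beta> ?q k 1" "\<lambda>_. growth_const * measure lborel A"] that by (simp add: cesaro_const)
  then have "(\<integral>y. ?q y \<partial>parry) \<le> growth_const * measure lborel A"
    by (intro LIMSEQ_le_const2[OF cesaro_parry[OF q]]) auto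
  then show ?thesis by simp
qed

end

section \<open>Hausdorff measure\<close>

lemma hausdorff_content_le:
  assumes "A \<subseteq> (\<Union>i. U i)" "\<And>i. bounded (U i)" "\<And>i. diameter (U i) \<le> \<delta>"
  shows "hausdorff_content s \<delta> A \<le> (\<Sum>i. ennreal (diameter (U i) powr s))"
  unfolding hausdorff_content_def using assms by (intro INF_lower) auto

lemma hausdorff_measure_eq_0_iff:
  "hausdorff_measure s A = 0 \<longleftrightarrow> (\<forall>\<delta>>0. hausdorff_content s \<delta> A = 0)"
  unfolding hausdorff_measure_def bot_ennreal[symmetric] SUP_bot_conv by blast

lemma hausdorff_content_0_cover:
  assumes "hausdorff_content s \<delta> A = 0" "0 < e"
  shows "\<exists>U. A \<subseteq> (\<Union>i::nat. U i) \<and> (\<forall>i. bounded (U i) \<and> diameter (U i) \<le> \<delta>) \<and>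
    (\<Sum>i. ennreal (diameter (U i) powr s)) < e"
proof -
  have "hausdorff_content s \<delta> A < e" using assms by simp
  then show ?thesis unfolding hausdorff_content_def INF_less_iff by blast
qed

lemma hausdorff_measure_mono_0:
  assumes "hausdorff_measure s B = 0" "A \<subseteq> B"
  shows "hausdorff_measure s A = 0"
proof -
  have "hausdorff_content s \<delta> A \<le> hausdorff_content s \<delta> B" for \<delta>
    unfolding hausdorff_content_def using assms(2) by (intro INF_superset_mono) blast+
  then have "hausdorff_content s \<delta> A = 0" if "hausdorff_content s \<delta> B = 0" for \<delta>
    using that[symmetric] by (metis le_zero_eq)
  then show ?thesis using assms(1) unfolding hausdorff_measure_eq_0_iff by blast
qed

lemma hausdorff_measure_0I:
  assumes "\<And>\<delta> e. 0 < \<delta> \<Longrightarrow> 0 < e \<Longrightarrow> \<exists>U. A \<subseteq> (\<Union>i::nat. U i) \<and> (\<forall>i. bounded (U i) \<and> diameter (U i) \<le> \<delta>) \<and>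
      (\<Sum>i. ennreal (diameter (U i) powr s)) \<le> ennreal e"
  shows "hausdorff_measure s A = 0"
  unfolding hausdorff_measure_eq_0_iff
proof (intro allI impI)
  fix \<delta> :: real assume \<delta>: "0 < \<delta>"
  have "hausdorff_content s \<delta> A \<le> 0 + ennreal e" if e: "0 < e" for e
  proof -
    obtain U where "A \<subseteq> (\<Union>i::nat. U i) \<and> (\<forall>i. bounded (U i) \<and> diameter (U i) \<le> \<delta>) \<and>
        (\<Sum>i. ennreal (diameter (U i) powr s)) \<le> ennreal e" using assms[OF \<delta> e] by blast
    then have U: "A \<subseteq> (\<Union>i::nat. U i)" "\<And>i. bounded (U i)" "\<And>i. diameter (U i) \<le> \<delta>"
      "(\<Sum>i. ennreal (diameter (U i) powr s)) \<le> ennreal e" by blast+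
    show ?thesis unfolding add_0 by (rule order_trans[OF hausdorff_content_le[OF U(1-3)] U(4)])
  qed
  then have "hausdorff_content s \<delta> A \<le> 0" by - (rule ennreal_le_epsilon, blast)
  then show "hausdorff_content s \<delta> A = 0" by simp
qed

lemma hausdorff_measure_0I_finite:
  fixes A :: "'a::metric_space set"
  assumes s: "0 < s"
    and cover: "\<And>\<delta> e. 0 < \<delta> \<Longrightarrow> 0 < e \<Longrightarrow> \<exists>F. finite F \<and> A \<subseteq> \<Union>F \<and>
      (\<forall>V\<in>F. bounded V \<and> diameter V \<le> \<delta>) \<and> (\<Sum>V\<in>F. diameter V powr s) \<le> e"
  shows "hausdorff_measure s A = 0"
proof (rule hausdorff_measure_0I)
  fix \<delta> e :: real assume d: "0 < \<delta>" "0 < e"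
  obtain F where "finite F \<and> A \<subseteq> \<Union>F \<and> (\<forall>V\<in>F. bounded V \<and> diameter V \<le> \<delta>) \<and>
      (\<Sum>V\<in>F. diameter V powr s) \<le> e"
    using cover[OF d] by (elim exE)
  then have F: "finite F" "A \<subseteq> \<Union>F" "\<And>V. V \<in> F \<Longrightarrow> bounded V" "\<And>V. V \<in> F \<Longrightarrow> diameter V \<le> \<delta>"
    "(\<Sum>V\<in>F. diameter V powr s) \<le> e"
    by blast+
  obtain h where h: "bij_betw h {..<card F} F"
    using ex_bij_betw_nat_finite[OF F(1)] unfolding atLeast0LessThan by (elim exE)
  \<comment> \<open>Padding with the empty set is free: its diameter is 0 and
    \<open>0 powr s = 0\<close>.\<close>
  define U where "U = (\<lambda>i. if i < card F then h i else {})"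
  have hF: "h i \<in> F" if "i < card F" for i
    using bij_betwE[OF h] that by blast
  have "\<Union>F \<subseteq> (\<Union>i. U i)"
  proof
    fix x assume "x \<in> \<Union>F"
    then obtain V where V: "V \<in> F" "x \<in> V" by auto
    from V(1) have "V \<in> h ` {..<card F}" by (simp only: bij_betw_imp_surj_on[OF h])
    with V(2) obtain i where "i < card F" "x \<in> h i" by auto
    then show "x \<in> (\<Union>i. U i)" by (intro UN_I[of i]) (simp_all add: U_def)
  qed
  then have 1: "A \<subseteq> (\<Union>i. U i)" using F(2) by (rule subset_trans[rotated])
  have "(\<Sum>i. ennreal (diameter (U i) powr s)) = (\<Sum>i<card F. ennreal (diameter (U i) powr s))"
    by (rule suminf_finite) (simp_all add: U_def)
  also have "\<dots> = (\<Sum>i<card F. ennreal (diameter (h i) powr s))"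
    by (intro sum.cong refl) (simp add: U_def)
  also have "\<dots> = ennreal (\<Sum>i<card F. diameter (h i) powr s)"
    by (rule sum_ennreal) simp
  also have "(\<Sum>i<card F. diameter (h i) powr s) = (\<Sum>V\<in>F. diameter V powr s)"
    by (rule sum.reindex_bij_betw[OF h])
  finally have 2: "(\<Sum>i. ennreal (diameter (U i) powr s)) \<le> ennreal e"
    using F(5) by (simp only: ennreal_leI)
  have 3: "bounded (U i) \<and> diameter (U i) \<le> \<delta>" for i
    using F(3,4)[OF hF[of i]] d by (simp add: U_def)
  show "\<exists>U. A \<subseteq> (\<Union>i::nat. U i) \<and> (\<forall>i. bounded (U i) \<and> diameter (U i) \<le> \<delta>) \<and>
      (\<Sum>i. ennreal (diameter (U i) powr s)) \<le> ennreal e"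
    by (rule exI[of _ U]) (intro conjI allI 1 2 3[THEN conjunct1] 3[THEN conjunct2])
qed

lemma hausdorff_measure_UN_0:
  fixes A :: "nat \<Rightarrow> 'a::metric_space set"
  assumes "\<And>n. hausdorff_measure s (A n) = 0"
  shows "hausdorff_measure s (\<Union>n. A n) = 0"
proof (rule hausdorff_measure_0I)
  fix \<delta> e :: real assume d: "0 < \<delta>" "0 < e"
  have "\<forall>n. \<exists>U. A n \<subseteq> (\<Union>i::nat. U i) \<and> (\<forall>i. bounded (U i) \<and> diameter (U i) \<le> \<delta>) \<and>
      (\<Sum>i. ennreal (diameter (U i) powr s)) < ennreal (e * (1/2) ^ Suc n)"
  proof
    fix n
    have "hausdorff_content s \<delta> (A n) = 0" using assms[of n] d(1) hausdorff_measure_eq_0_iff by blast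
    moreover have "0 < ennreal (e * (1/2) ^ Suc n)" using d by simp
    ultimately show "\<exists>U. A n \<subseteq> (\<Union>i::nat. U i) \<and> (\<forall>i. bounded (U i) \<and> diameter (U i) \<le> \<delta>) \<and>
        (\<Sum>i. ennreal (diameter (U i) powr s)) < ennreal (e * (1/2) ^ Suc n)"
      by (rule hausdorff_content_0_cover)
  qed
  from choice[OF this] obtain U where "\<forall>n. A n \<subseteq> (\<Union>i::nat. U n i) \<and> (\<forall>i. bounded (U n i) \<and> diameter (U n i) \<le> \<delta>) \<and>
      (\<Sum>i. ennreal (diameter (U n i) powr s)) < ennreal (e * (1/2) ^ Suc n)"
    by (elim exE)
  then have U: "\<And>n. A n \<subseteq> (\<Union>i::nat. U n i)" "\<And>n i. bounded (U n i)" "\<And>n i. diameter (U n i) \<le> \<delta>"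
      "\<And>n. (\<Sum>i. ennreal (diameter (U n i) powr s)) < ennreal (e * (1/2) ^ Suc n)" by simp_all
  define V where "V = (\<lambda>k. case prod_decode k of (n, i) \<Rightarrow> U n i)"
  have 1: "(\<Union>n. A n) \<subseteq> (\<Union>k. V k)"
  proof
    fix x assume "x \<in> (\<Union>n. A n)"
    then obtain n where "x \<in> A n" by auto
    then obtain i where "x \<in> U n i" using U(1)[of n] by auto
    then show "x \<in> (\<Union>k. V k)" by (intro UN_I[of "prod_encode (n, i)"]) (simp_all add: V_def)
  qed
  have 2: "bounded (V k)" "diameter (V k) \<le> \<delta>" for k
    using U(2,3) by (cases "prod_decode k", simp add: V_def)+
  let ?g = "\<lambda>p. ennreal (diameter (case_prod U p) powr s)"
  have "(\<lambda>n. e * (1/2) ^ Suc n) sums (e * 1)" by (rule sums_mult[OF power_half_series])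
  then have sm: "(\<lambda>n. e * (1/2) ^ Suc n) sums e" by (simp only: mult_1_right)
  have "(\<Sum>k. ennreal (diameter (V k) powr s)) = (\<Sum>k. ?g (prod_decode k))"
    unfolding V_def by (simp only: case_prod_beta)
  also have "\<dots> = (\<Sum>n. \<Sum>i. ?g (n, i))"
    by (rule suminf_ennreal_2dimen[unfolded o_def]) (rule refl)
  also have "\<dots> = (\<Sum>n. \<Sum>i. ennreal (diameter (U n i) powr s))"
    by (simp only: prod.case)
  also have "\<dots> \<le> (\<Sum>n. ennreal (e * (1/2) ^ Suc n))"
    by (rule suminf_le[OF less_imp_le[OF U(4)]]) (rule summableI)+
  also have "\<dots> = ennreal e"
    using d(2) by (intro suminf_ennreal_eq[OF _ sm]) simp
  finally show "\<exists>U. (\<Union>n. A n) \<subseteq> (\<Union>i::nat. U i) \<and> (\<forall>i. bounded (U i) \<and> diameter (U i) \<le> \<delta>) \<and>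
      (\<Sum>i. ennreal (diameter (U i) powr s)) \<le> ennreal e"
    by (intro exI[of _ V] conjI allI 1 2)
qed

section \<open>Coverings of the plane by squares\<close>

lemma diameter_square:
  fixes a b :: real assumes r: "0 \<le> r"
  shows "diameter ({a..a + r} \<times> {b..b + r}) \<le> 2 * r"
proof (rule diameter_le)
  fix p q assume pq: "p \<in> {a..a + r} \<times> {b..b + r}" "q \<in> {a..a + r} \<times> {b..b + r}"
  have "norm (p - q) \<le> norm (fst (p - q)) + norm (snd (p - q))"
    using norm_Pair_le[of "fst (p - q)" "snd (p - q)"] by (simp only: prod.collapse)
  also have "\<dots> \<le> r + r" using pq by (intro add_mono) auto
  finally show "norm (p - q) \<le> 2 * r" by simp
qed (use r in auto)

lemma bounded_square: "bounded ({a..a + r} \<times> {b..b + r :: real})" for a :: real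
  by (intro bounded_Times) auto

lemma interval_cover:
  fixes x a r :: real
  assumes "0 < r" "a \<le> x" "x < a + real N * r"
  shows "\<exists>i<N. x \<in> {a + real i * r..a + real i * r + r}"
proof (intro exI conjI)
  let ?i = "nat \<lfloor>(x - a) / r\<rfloor>"
  have z: "0 \<le> (x - a) / r" using assms by simp
  have "(x - a) / r < real N" using assms by (simp add: field_simps)
  then show "?i < N" using z by linarith
  have "real ?i \<le> (x - a) / r" "(x - a) / r \<le> real ?i + 1" using z by linarith+
  then have "real ?i * r \<le> x - a" "x - a \<le> (real ?i + 1) * r"
    using assms(1) by (simp_all only: pos_le_divide_eq pos_divide_le_eq)
  then show "x \<in> {a + real ?i * r..a + real ?i * r + r}" by (simp add: algebra_simps)
qed

text \<open>Serves to make the set of exponents in \<open>hausdorff_dim\<close> nonempty for every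
  plane set, so that its infimum is meaningful. With exponent 3, a grid of N^2 squares of side 1 / N
  costs at most 8 / N.\<close>

lemma hausdorff_measure_square_0:
  fixes a b :: real
  shows "hausdorff_measure 3 ({a..<a + 1} \<times> {b..<b + 1}) = 0"
proof (rule hausdorff_measure_0I_finite)
  fix \<delta> e :: real assume d: "0 < \<delta>" "0 < e"
  obtain N :: nat where N: "max (2 / \<delta>) (8 / e) < real N" using reals_Archimedean2 by blast
  have N0: "0 < real N" using N d by (smt (verit) divide_pos_pos)
  define r where "r = 1 / real N"
  have r: "0 < r" "real N * r = 1" "2 * r \<le> \<delta>" "8 * r \<le> e" using N N0 d by (auto simp: r_def field_simps)
  define Q where "Q = (\<lambda>(i, j). {a + real i * r..a + real i * r + r} \<times> {b + real j * r..b + real j * r + r})"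
  have dQ: "diameter (Q p) \<le> 2 * r" "bounded (Q p)" for p
    using diameter_square[of r] bounded_square r by (auto simp: Q_def split: prod.splits)
  define F where "F = Q ` ({..<N} \<times> {..<N})"
  have 1: "finite F" by (simp add: F_def)
  have 2: "{a..<a + 1} \<times> {b..<b + 1} \<subseteq> \<Union>F"
  proof clarify
    fix x y assume "x \<in> {a..<a + 1}" "y \<in> {b..<b + 1}"
    then obtain i j where "i < N" "j < N" "x \<in> {a + real i * r..a + real i * r + r}" "y \<in> {b + real j * r..b + real j * r + r}"
      using interval_cover[of r a x N] interval_cover[of r b y N] r by auto
    then have "(x, y) \<in> Q (i, j)" "Q (i, j) \<in> F" by (auto simp: Q_def F_def)
    then show "(x, y) \<in> \<Union>F" by blast
  qed
  have 3: "\<forall>V\<in>F. bounded V \<and> diameter V \<le> \<delta>"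
    using dQ r by (auto simp: F_def intro: order_trans)
  have 4: "(\<Sum>V\<in>F. diameter V powr 3) \<le> e"
  proof -
    have "(\<Sum>V\<in>F. diameter V powr 3) \<le> of_nat (card F) * ((2 * r) powr 3)"
      using dQ(1) diameter_ge_0[OF dQ(2)] by (intro sum_bounded_above powr_mono2) (auto simp: F_def simp del: split_paired_All)
    also have "\<dots> \<le> (real N * real N) * ((2 * r) powr 3)"
    proof (intro mult_right_mono)
      have "card F \<le> card ({..<N} \<times> {..<N})" unfolding F_def by (intro card_image_le) auto
      also have "\<dots> = N * N" by simp
      finally show "real (card F) \<le> real N * real N" by (metis of_nat_le_iff of_nat_mult)
    qed auto
    also have "\<dots> = 8 * r * (real N * r) * (real N * r)"
    proof -
      have "(2 * r) powr 3 = (2 * r) ^ 3" using r by simp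
      show ?thesis unfolding \<open>(2 * r) powr 3 = (2 * r) ^ 3\<close> by algebra
    qed
    also have "\<dots> \<le> e" using r by simp
    finally show ?thesis .
  qed
  show "\<exists>F. finite F \<and> {a..<a + 1} \<times> {b..<b + 1} \<subseteq> \<Union>F \<and>
      (\<forall>V\<in>F. bounded V \<and> diameter V \<le> \<delta>) \<and> (\<Sum>V\<in>F. diameter V powr 3) \<le> e"
    by (intro exI[of _ F] conjI 1 2 3 4)
qed simp

lemma hausdorff_measure_3_plane: "hausdorff_measure 3 (A :: (real \<times> real) set) = 0"
proof -
  define B where "B = (\<lambda>k. case from_nat k of (i::int, j::int) \<Rightarrow> {of_int i..<of_int i + 1 :: real} \<times> {of_int j..<of_int j + 1 :: real})"
  have "hausdorff_measure 3 (\<Union>k. B k) = 0"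
  proof (rule hausdorff_measure_UN_0)
    show "hausdorff_measure 3 (B k) = 0" for k
      by (cases "from_nat k :: int \<times> int") (simp only: B_def prod.case hausdorff_measure_square_0)
  qed
  moreover have "A \<subseteq> (\<Union>k. B k)"
  proof clarify
    fix x y :: real
    have "(x, y) \<in> B (to_nat (\<lfloor>x\<rfloor>, \<lfloor>y\<rfloor>))"
      unfolding B_def from_nat_to_nat prod.case using floor_correct[of x] floor_correct[of y] by simp
    then show "(x, y) \<in> (\<Union>k. B k)" by blast
  qed
  ultimately show ?thesis using hausdorff_measure_mono_0 by blast
qed

lemma hausdorff_dim_le:
  assumes "\<And>s. d < s \<Longrightarrow> hausdorff_measure s A = 0" "0 \<le> d"
  shows "hausdorff_dim A \<le> d"
  unfolding hausdorff_dim_def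
proof (rule field_le_epsilon)
  fix e :: real assume "0 < e"
  then have "hausdorff_measure (d + e) A = 0" "0 < d + e" using assms by simp_all
  then have "d + e \<in> {s. 0 < s \<and> hausdorff_measure s A = 0}" by blast
  moreover have "bdd_below {s. 0 < s \<and> hausdorff_measure s A = 0}"
    by (rule bdd_belowI[of _ 0]) simp
  ultimately show "Inf {s. 0 < s \<and> hausdorff_measure s A = 0} \<le> d + e" by (rule cInf_lower)
qed

text \<open>Covering sets may fail to be measurable, so the mass bound is asked of a Borel superset
  \<open>V\<close> of \<open>U\<close>.\<close>

lemma mass_distribution_principle:
  fixes \<mu> :: "(real \<times> real) measure"
  assumes sets: "sets \<mu> = sets borel" and A: "A \<in> sets borel" "emeasure \<mu> A > 0"
    and frostman: "\<And>U. bounded U \<Longrightarrow> diameter U \<le> \<delta> \<Longrightarrow>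
        \<exists>V. U \<subseteq> V \<and> V \<in> sets borel \<and> emeasure \<mu> V \<le> ennreal (K * diameter U powr d)"
    and \<delta>: "0 < \<delta>" "\<delta> \<le> 1" and K: "0 \<le> K" and d: "0 \<le> d"
  shows "d \<le> hausdorff_dim A"
  unfolding hausdorff_dim_def
proof (rule cInf_greatest)
  show "{s. 0 < s \<and> hausdorff_measure s A = 0} \<noteq> {}"
  proof -
    have "(3::real) \<in> {s. 0 < s \<and> hausdorff_measure s A = 0}"
      using hausdorff_measure_3_plane[of A] by simp
    then show ?thesis by blast
  qed
next
  fix s assume s: "s \<in> {s. 0 < s \<and> hausdorff_measure s A = 0}"
  show "d \<le> s"
  proof (rule ccontr)
    assume "\<not> d \<le> s"
    have c0: "hausdorff_content s \<delta> A = 0" using s \<delta> hausdorff_measure_eq_0_iff by blast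
    have "emeasure \<mu> A \<le> 0 + ennreal e" if e: "0 < e" for e
    proof -
      \<comment> \<open>Dividing by \<open>K + 1\<close> also covers the case K = 0.\<close>
      have "0 < ennreal (e / (K + 1))" using e K by simp
      then obtain U where "A \<subseteq> (\<Union>i::nat. U i) \<and> (\<forall>i. bounded (U i) \<and> diameter (U i) \<le> \<delta>) \<and>
        (\<Sum>i. ennreal (diameter (U i) powr s)) < ennreal (e / (K + 1))"
        by (rule hausdorff_content_0_cover[OF c0, THEN exE])
      then have U: "A \<subseteq> (\<Union>i::nat. U i)" "\<And>i. bounded (U i)" "\<And>i. diameter (U i) \<le> \<delta>"
        "(\<Sum>i. ennreal (diameter (U i) powr s)) < ennreal (e / (K + 1))" by simp_all
      have "\<forall>i. \<exists>V. U i \<subseteq> V \<and> V \<in> sets borel \<and> emeasure \<mu> V \<le> ennreal (K * diameter (U i) powr d)"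
        using frostman[OF U(2,3)] by (rule allI)
      from choice[OF this] obtain V where "\<forall>i. U i \<subseteq> V i \<and> V i \<in> sets borel \<and> emeasure \<mu> (V i) \<le> ennreal (K * diameter (U i) powr d)"
        by (elim exE)
      then have V: "\<And>i. U i \<subseteq> V i" "\<And>i. V i \<in> sets borel"
        "\<And>i. emeasure \<mu> (V i) \<le> ennreal (K * diameter (U i) powr d)"
        by simp_all
      have AV: "A \<subseteq> (\<Union>i. V i)"
      proof
        fix x assume "x \<in> A"
        then have "x \<in> (\<Union>i. U i)" by (rule subsetD[OF U(1)])
        then obtain i where "x \<in> U i" by (rule UN_E)
        then show "x \<in> (\<Union>i. V i)" using V(1)[of i] by (intro UN_I[of i]) auto
      qed
      have Vs: "range V \<subseteq> sets \<mu>" unfolding sets using V(2) by (rule image_subsetI)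
      have "emeasure \<mu> A \<le> emeasure \<mu> (\<Union>i. V i)"
        by (rule emeasure_mono[OF AV]) (rule sets.countable_UN[OF Vs])
      also have "\<dots> \<le> (\<Sum>i. emeasure \<mu> (V i))"
        by (rule emeasure_subadditive_countably[OF Vs])
      also have "\<dots> \<le> (\<Sum>i. ennreal (K + 1) * ennreal (diameter (U i) powr s))"
      proof (intro suminf_le)
        fix i
        have D: "0 \<le> diameter (U i)" "diameter (U i) \<le> 1" using diameter_ge_0[OF U(2)] U(3)[of i] \<delta> by simp_all
        \<comment> \<open>Diameters are at most 1, so lowering the exponent from \<open>d\<close> to
          \<open>s\<close> can only increase the power.\<close>
        have "diameter (U i) powr d \<le> diameter (U i) powr s"
          using D \<open>\<not> d \<le> s\<close> by (intro powr_mono') auto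
        then have "K * diameter (U i) powr d \<le> (K + 1) * diameter (U i) powr s"
          using K by (intro mult_mono) auto
        then show "emeasure \<mu> (V i) \<le> ennreal (K + 1) * ennreal (diameter (U i) powr s)"
          using V(3)[of i] K by (subst ennreal_mult[symmetric]) (auto intro: order_trans ennreal_leI simp del: ennreal_plus)
      qed auto
      also have "\<dots> = ennreal (K + 1) * (\<Sum>i. ennreal (diameter (U i) powr s))" by simp
      also have "\<dots> \<le> ennreal (K + 1) * ennreal (e / (K + 1))"
        using U(4) by (intro mult_left_mono) auto
      also have "\<dots> = ennreal e" using K e by (subst ennreal_mult[symmetric]) (simp_all del: ennreal_plus)
      finally show ?thesis by simp
    qed
    then have "emeasure \<mu> A \<le> 0" by - (rule ennreal_le_epsilon, blast)
    then show False using A by simp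
  qed
qed

section \<open>Frostman bound and dimension\<close>

lemma Tmap_measurable [measurable]: "Tmap \<beta> lam \<in> borel_measurable borel"
proof -
  have "Tmap \<beta> lam \<in> borel \<Otimes>\<^sub>M borel \<rightarrow>\<^sub>M borel \<Otimes>\<^sub>M borel"
    unfolding Tmap_def[abs_def] by measurable
  then show ?thesis by (simp add: borel_prod)
qed

lemma Tmap_funpow_measurable [measurable]: "(Tmap \<beta> lam ^^ k) \<in> borel_measurable borel"
  by (induction k) (auto simp: o_def)

lemma Qsq_sets [measurable]: "Qsq \<in> sets borel"
  unfolding Qsq_def by (intro borel_Times) auto

lemma strip_emeasure:
  assumes "Z \<in> sets borel"
  shows "emeasure lborel ({0..<1::real} \<times> (Z :: real set)) = emeasure lborel Z"
  using assms by (simp add: lborel_prod[symmetric] lborel.emeasure_pair_measure_Times)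

lemma emeasure_Qsq: "emeasure lborel Qsq = 1"
  unfolding Qsq_def by (subst strip_emeasure) auto

section \<open>From preimages under the baker map to bounds on the SRB measure\<close>

locale baker_map = beta_expansion +
  fixes lam :: real
  assumes lam_pos: "0 < lam" and lam_lt_1: "lam < 1"
begin

abbreviation T where "T \<equiv> Tmap \<beta> lam"

definition push_integral :: "(real \<times> real \<Rightarrow> real) \<Rightarrow> nat \<Rightarrow> real" where
  "push_integral g k = set_lebesgue_integral lborel Qsq (\<lambda>p. g ((T ^^ k) p))"

lemma nu_avg_eq_cesaro: "nu_avg_integral \<beta> lam n g = cesaro (push_integral g) n"
  by (simp add: nu_avg_integral_def cesaro_def push_integral_def)

lemma T_Qsq: "p \<in> Qsq \<Longrightarrow> T p \<in> Qsq"
proof (cases p)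
  case (Pair x y)
  assume "p \<in> Qsq"
  then have x: "0 \<le> x" "x < 1" and y: "y \<in> {0..<1}" by (auto simp: Pair Qsq_def)
  have "lam * x < lam" "0 \<le> lam * x" using x lam_pos by auto
  then have "fst (T p) \<in> {0..<1}" using lam_lt_1 by (auto simp: Tmap_def Pair)
  moreover have "snd (T p) = f y" by (simp add: Tmap_def Pair bmap_def)
  ultimately show ?thesis using f_range[OF y] by (simp add: Qsq_def mem_Times_iff)
qed

lemma T_funpow_Qsq: "p \<in> Qsq \<Longrightarrow> (T ^^ k) p \<in> Qsq"
  by (induction k) (auto simp: T_Qsq)

lemma push_integrable:
  fixes g :: "real \<times> real \<Rightarrow> real"
  assumes "continuous_on Qsq g" "\<And>p. p \<in> Qsq \<Longrightarrow> \<bar>g p\<bar> \<le> M"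
  shows "integrable lborel (\<lambda>p. indicator Qsq p * g ((T ^^ k) p))"
proof -
  have [measurable]: "(\<lambda>p. indicator Qsq p *\<^sub>R g p) \<in> borel_measurable borel"
    by (rule borel_measurable_continuous_on_indicator[OF _ assms(1)]) simp
  \<comment> \<open>\<open>g\<close> may fail to be measurable outside the square; the second
    indicator can be inserted because the square is forward invariant.\<close>
  have eq: "(\<lambda>p. indicator Qsq p * g ((T ^^ k) p)) = (\<lambda>p. indicator Qsq p * (indicator Qsq ((T ^^ k) p) *\<^sub>R g ((T ^^ k) p)))"
  proof
    show "indicator Qsq p * g ((T ^^ k) p) = indicator Qsq p * (indicator Qsq ((T ^^ k) p) *\<^sub>R g ((T ^^ k) p))" for p
      using T_funpow_Qsq[of p k] by (cases "p \<in> Qsq") simp_all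
  qed
  show ?thesis unfolding eq
  proof (rule integrableI_bounded_set[where A=Qsq and B=M])
    show "AE p in lborel. p \<in> Qsq \<longrightarrow> norm (indicator Qsq p * (indicator Qsq ((T ^^ k) p) *\<^sub>R g ((T ^^ k) p))) \<le> M"
      using T_funpow_Qsq assms(2) by (intro AE_I2) simp
    show "(\<lambda>p. indicator Qsq p * (indicator Qsq ((T ^^ k) p) *\<^sub>R g ((T ^^ k) p))) \<in> borel_measurable lborel"
      by measurable
  qed (use emeasure_Qsq in auto)
qed

lemma push_integral_bound:
  assumes "continuous_on Qsq g" "\<And>p. p \<in> Qsq \<Longrightarrow> \<bar>g p\<bar> \<le> M"
  shows "\<bar>push_integral g k\<bar> \<le> M"
proof -
  have "\<bar>push_integral g k\<bar> \<le> (\<integral>p. indicator Qsq p * M \<partial>lborel)"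
    unfolding push_integral_def set_lebesgue_integral_def real_scaleR_def
  proof (rule integral_abs_bound_integral[OF push_integrable[OF assms]])
    show "integrable lborel (\<lambda>p. indicator Qsq p * M)"
      using emeasure_Qsq by (intro integrable_mult_left integrable_real_indicator) auto
    show "\<bar>indicator Qsq p * g ((T ^^ k) p)\<bar> \<le> indicator Qsq p * M" for p
      using T_funpow_Qsq[of p k] assms(2) by (cases "p \<in> Qsq") auto
  qed
  also have "\<dots> = M" using emeasure_Qsq by (simp add: measure_def)
  finally show ?thesis .
qed

lemma is_SRB_tendsto:
  assumes "is_SRB \<beta> lam \<mu>" "continuous_on Qsq g" "bounded (g ` Qsq)"
  shows "cesaro (push_integral g) \<longlonglongrightarrow> (\<integral>p. indicator Qsq p * g p \<partial>\<mu>)"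
proof -
  have "\<forall>g. continuous_on Qsq g \<and> bounded (g ` Qsq) \<longrightarrow>
      (\<lambda>n. nu_avg_integral \<beta> lam n g) \<longlonglongrightarrow> set_lebesgue_integral \<mu> Qsq g"
    using assms(1) unfolding is_SRB_def by (elim conjE)
  from this[rule_format, OF conjI[OF assms(2,3)]] show ?thesis
    unfolding nu_avg_eq_cesaro set_lebesgue_integral_def real_scaleR_def .
qed

text \<open>\<open>is_SRB\<close> asks only for a finite measure; testing against the constant 1
  fixes its mass.\<close>

lemma is_SRB_emeasure_Qsq:
  assumes "is_SRB \<beta> lam \<mu>"
  shows "emeasure \<mu> Qsq = 1"
proof -
  interpret finite_measure \<mu> using assms by (simp add: is_SRB_def)
  have [measurable_cong]: "sets \<mu> = sets borel" using assms by (simp add: is_SRB_def)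
  have "bounded ((\<lambda>_. 1 :: real) ` Qsq)" by (rule bounded_subset[of "{1}"]) auto
  then have "cesaro (push_integral (\<lambda>_. 1)) \<longlonglongrightarrow> (\<integral>p. indicator Qsq p * 1 \<partial>\<mu>)"
    by (rule is_SRB_tendsto[OF assms continuous_on_const])
  moreover have "push_integral (\<lambda>_. 1) = (\<lambda>_. 1)"
    using emeasure_Qsq by (simp add: fun_eq_iff push_integral_def set_lebesgue_integral_def measure_def)
  then have "cesaro (push_integral (\<lambda>_. 1)) \<longlonglongrightarrow> 1"
    by (simp add: cesaro_tendsto)
  ultimately have "(\<integral>p. indicator Qsq p * 1 \<partial>\<mu>) = (1::real)" by (rule LIMSEQ_unique)
  then have "measure \<mu> Qsq = 1" by simp
  then show ?thesis by (simp add: emeasure_eq_measure)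
qed

text \<open>The portmanteau inequality for open sets. A bound from time \<open>k0\<close> on is
  enough, because limits of averages forget initial terms.\<close>

lemma is_SRB_open_le:
  assumes \<mu>: "is_SRB \<beta> lam \<mu>" and G: "open G"
    and le: "\<And>k. k \<ge> k0 \<Longrightarrow> measure lborel (Qsq \<inter> (T ^^ k) -` G) \<le> K"
  shows "emeasure \<mu> G \<le> ennreal K"
proof -
  interpret finite_measure \<mu> using \<mu> by (simp add: is_SRB_def)
  have sets [measurable_cong]: "sets \<mu> = sets borel" using \<mu> by (simp add: is_SRB_def)
  have [measurable]: "G \<in> sets borel" using G by simp
  \<comment> \<open>Continuous functions increasing to the indicator of \<open>G\<close>. The whole
    space is treated apart, since \<open>infdist\<close> to the empty set is 0.\<close>
  define \<phi> where "\<phi> = (\<lambda>i p. if G = UNIV then 1 else min 1 (real i * infdist p (- G)))"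
  have cont: "continuous_on UNIV (\<phi> i)" for i
    unfolding \<phi>_def by (cases "G = UNIV") (auto intro!: continuous_intros)
  have [measurable]: "\<phi> i \<in> borel_measurable borel" for i
    by (rule borel_measurable_continuous_onI[OF cont])
  have range: "0 \<le> \<phi> i p" "\<phi> i p \<le> indicator G p" for i p
    by (auto simp: \<phi>_def indicator_def infdist_nonneg)
  have ab: "\<bar>\<phi> i p\<bar> \<le> 1" for i p using range[of i p] by (cases "p \<in> G") auto
  have lim: "(\<lambda>i. \<phi> i p) \<longlonglongrightarrow> indicator G p" for p
  proof (cases "p \<in> G \<and> G \<noteq> UNIV")
    case True
    then have "0 < infdist p (- G)"
      using G by (intro infdist_pos_not_in_closed) auto
    then obtain n :: nat where n: "1 < real n * infdist p (- G)" using reals_Archimedean3 by blast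
    have "\<phi> i p = 1" if "i \<ge> n" for i
    proof -
      have "real n * infdist p (- G) \<le> real i * infdist p (- G)" using that infdist_nonneg by (intro mult_right_mono) auto
      then show ?thesis using n True by (simp add: \<phi>_def)
    qed
    then have "eventually (\<lambda>i. \<phi> i p = indicator G p) sequentially"
      using True by (auto simp: eventually_sequentially)
    then show ?thesis by (rule tendsto_eventually)
  next
    case False
    then have "\<phi> i p = indicator G p" for i by (auto simp: \<phi>_def)
    then show ?thesis by simp
  qed
  have "(\<integral>p. indicator Qsq p * \<phi> i p \<partial>\<mu>) \<le> K" for i
  proof -
    have c: "continuous_on Qsq (\<phi> i)" using cont continuous_on_subset by blast
    have "bounded (\<phi> i ` Qsq)" using ab by (intro boundedI[of _ 1]) auto
    then have "cesaro (push_integral (\<phi> i)) \<longlonglongrightarrow> (\<integral>p. indicator Qsq p * \<phi> i p \<partial>\<mu>)"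
      by (rule is_SRB_tendsto[OF \<mu> c])
    then have lim: "cesaro (\<lambda>k. push_integral (\<phi> i) (k + k0)) \<longlonglongrightarrow> (\<integral>p. indicator Qsq p * \<phi> i p \<partial>\<mu>)"
      by (subst cesaro_shift_tendsto[where B=1]) (use push_integral_bound[OF c] ab in auto)
    have "push_integral (\<phi> i) (k + k0) \<le> K" for k
    proof -
      have "push_integral (\<phi> i) (k + k0) \<le> (\<integral>p. indicator (Qsq \<inter> (T ^^ (k + k0)) -` G) p \<partial>lborel)"
        unfolding push_integral_def set_lebesgue_integral_def real_scaleR_def
      proof (rule integral_mono)
        have "emeasure lborel (Qsq \<inter> (T ^^ (k + k0)) -` G) \<le> emeasure lborel Qsq" by (intro emeasure_mono) auto
        then show "integrable lborel (\<lambda>p. indicat_real (Qsq \<inter> (T ^^ (k + k0)) -` G) p)"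
          using emeasure_Qsq by (intro integrable_real_indicator) (auto intro: le_less_trans)
        show "integrable lborel (\<lambda>p. indicator Qsq p * \<phi> i ((T ^^ (k + k0)) p))"
          by (rule push_integrable[OF c]) (use ab in auto)
        show "indicator Qsq p * \<phi> i ((T ^^ (k + k0)) p) \<le> indicator (Qsq \<inter> (T ^^ (k + k0)) -` G) p" for p
          using range[of i "(T ^^ (k + k0)) p"] by (auto simp: indicator_def split: if_splits)
      qed
      also have "\<dots> \<le> K" using le[of "k + k0"] by simp
      finally show ?thesis .
    qed
    then have "cesaro (\<lambda>k. push_integral (\<phi> i) (k + k0)) n \<le> K" if "n \<ge> 1" for n
      using cesaro_mono[of n "\<lambda>k. push_integral (\<phi> i) (k + k0)" "\<lambda>_. K"] that by (simp add: cesaro_const)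
    then show ?thesis by (intro LIMSEQ_le_const2[OF lim]) auto
  qed
  moreover have "(\<lambda>i. \<integral>p. indicator Qsq p * \<phi> i p \<partial>\<mu>) \<longlonglongrightarrow> (\<integral>p. indicator Qsq p * indicator G p \<partial>\<mu>)"
  proof (rule integral_dominated_convergence[where w="\<lambda>_. 1"])
    show "AE p in \<mu>. (\<lambda>i. indicator Qsq p * \<phi> i p) \<longlonglongrightarrow> indicator Qsq p * indicator G p"
      by (intro AE_I2 tendsto_mult tendsto_const lim)
    show "AE p in \<mu>. norm (indicator Qsq p * \<phi> i p) \<le> 1" for i
      using ab by (auto simp: indicator_def)
  qed auto
  ultimately have "(\<integral>p. indicator Qsq p * indicator G p \<partial>\<mu>) \<le> K"
    by (intro LIMSEQ_le_const2) auto
  then have "measure \<mu> (Qsq \<inter> G) \<le> K" by (simp add: indicator_inter_arith[symmetric])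
  then have "emeasure \<mu> (Qsq \<inter> G) \<le> ennreal K" by (simp add: emeasure_eq_measure ennreal_leI)
  moreover have "emeasure \<mu> G \<le> emeasure \<mu> ((Qsq \<inter> G) \<union> (- Qsq))" by (intro emeasure_mono) auto
  moreover have "\<dots> \<le> emeasure \<mu> (Qsq \<inter> G) + emeasure \<mu> (- Qsq)" by (intro emeasure_subadditive) auto
  moreover have "emeasure \<mu> (- Qsq) = 0" using \<mu> by (simp add: is_SRB_def)
  ultimately show ?thesis by (metis add.right_neutral order_trans)
qed

lemma preimage_strip_measure_le:
  assumes Z: "Z \<in> sets borel" "Z \<subseteq> {0..<1}"
    and sub: "Qsq \<inter> (T ^^ m) -` G \<subseteq> {p. (f ^^ k) (snd p) \<in> Z}" and G: "G \<in> sets borel"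
  shows "measure lborel (Qsq \<inter> (T ^^ m) -` G) \<le> growth_const * measure lborel Z"
proof -
  note [measurable] = Z(1) G
  let ?Y = "{0..<1} \<inter> (f ^^ k) -` Z"
  have "emeasure lborel (Qsq \<inter> (T ^^ m) -` G) \<le> emeasure lborel ({0..<1::real} \<times> ?Y)"
    using sub by (intro emeasure_mono) (auto simp: Qsq_def intro!: borel_Times)
  also have "\<dots> = emeasure lborel ?Y" by (rule strip_emeasure) measurable
  finally have "measure lborel (Qsq \<inter> (T ^^ m) -` G) \<le> measure lborel ?Y"
    unfolding measure_def
  proof (rule enn2real_mono)
    have "emeasure lborel ?Y \<le> emeasure lborel {0..<1::real}" by (intro emeasure_mono) auto
    then show "emeasure lborel ?Y < top" by (rule le_less_trans) auto
  qed
  then show ?thesis using preimage_measure_le[OF Z, of k] by simp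
qed

text \<open>Two points sent to the box have x-coordinates less than 2 * \<rho> apart, and their
  initial x contribute at most lam^k \<le> \<rho>, so their codes are closer than the gap in
  \<open>xcoord_separation\<close> and the last \<open>n\<close> digits agree. With these digits
  fixed, the point at time \<open>k - n\<close> is an affine function of the point at time
  \<open>k\<close>, which confines it to an interval of length 2 * r / \<beta>^n.\<close>

lemma box_preimage_le:
  assumes \<gamma>: "\<gamma> \<in> S_set" "\<beta> \<le> \<gamma>" "lam < 1 / \<gamma>"
    and \<rho>: "\<rho> \<le> (1 - lam) * (1 - lam * \<gamma>) * lam ^ n / 4" "0 < \<rho>" and k: "n \<le> k" "lam ^ k \<le> \<rho>" and r: "0 \<le> r"
  shows "measure lborel (Qsq \<inter> (T ^^ k) -` ({x0 - \<rho><..<x0 + \<rho>} \<times> {y0 - r<..<y0 + r})) \<le> growth_const * (2 * r / \<beta> ^ n)"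
    (is "measure lborel (Qsq \<inter> _ -` ?G) \<le> _")
proof (cases "Qsq \<inter> (T ^^ k) -` ?G = {}")
  case True
  show ?thesis unfolding True using r growth_const_gt_1 beta_gt_1 by simp
next
  case False
  \<comment> \<open>The value of the \<open>n\<close> digits at times \<open>k - n\<close> to
    \<open>k - 1\<close>; all points of the preimage share it.\<close>
  define S where "S = (\<lambda>y. \<Sum>l<n. real (bdig \<beta> ((f ^^ l) ((f ^^ (k - n)) y))) / \<beta> ^ Suc l)"
  obtain p' where "p' \<in> Qsq \<inter> (T ^^ k) -` ?G" using False unfolding ex_in_conv[symmetric] by (elim exE)
  moreover obtain x' y' where "p' = (x', y')" by (cases p')
  ultimately have p': "(x', y') \<in> Qsq" "(T ^^ k) (x', y') \<in> ?G" by (simp_all only: Int_iff vimage_eq)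
  have same: "S y = S y'" if p: "(x, y) \<in> Qsq" "(T ^^ k) (x, y) \<in> ?G" for x y
  proof -
    have x: "0 \<le> x" "x < 1" "0 \<le> x'" "x' < 1" and y: "y \<in> {0..<1}" "y' \<in> {0..<1}"
      using p p' by (auto simp: Qsq_def)
    have "0 \<le> lam ^ k * x" "lam ^ k * x \<le> lam ^ k * 1" "0 \<le> lam ^ k * x'" "lam ^ k * x' \<le> lam ^ k * 1"
      using x lam_pos by (auto intro!: mult_left_mono)
    then have "\<bar>xcoord \<beta> lam k y - xcoord \<beta> lam k y'\<bar> < 4 * \<rho>"
      using p(2) p'(2) k(2) by (auto simp: Tmap_funpow)
    also have "\<dots> \<le> (1 - lam) * (1 - lam * \<gamma>) * lam ^ n" using \<rho> by simp
    finally have lt: "\<bar>xcoord \<beta> lam k y - xcoord \<beta> lam k y'\<bar> < (1 - lam) * (1 - lam * \<gamma>) * lam ^ n" .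
    have eq: "bdig \<beta> ((f ^^ (k - 1 - i)) y) = bdig \<beta> ((f ^^ (k - 1 - i)) y')" if "i < n" for i
      using xcoord_separation[OF y \<gamma>(1,2) lam_pos \<gamma>(3) that, of k] lt k that by fastforce
    have "bdig \<beta> ((f ^^ l) ((f ^^ (k - n)) y)) = bdig \<beta> ((f ^^ l) ((f ^^ (k - n)) y'))" if "l < n" for l
    proof -
      have "k - 1 - (n - 1 - l) = l + (k - n)" using that k by simp
      then show ?thesis using eq[of "n - 1 - l"] that by (simp add: funpow_add)
    qed
    then show ?thesis unfolding S_def by (intro sum.cong refl) simp
  qed
  let ?Z = "{0..<1} \<inter> {S y' + (y0 - r) / \<beta> ^ n<..<S y' + (y0 + r) / \<beta> ^ n}"
  have "measure lborel (Qsq \<inter> (T ^^ k) -` ?G) \<le> growth_const * measure lborel ?Z"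
  proof (rule preimage_strip_measure_le)
    show "Qsq \<inter> (T ^^ k) -` ?G \<subseteq> {p. (f ^^ (k - n)) (snd p) \<in> ?Z}"
    proof
      fix p assume p_in: "p \<in> Qsq \<inter> (T ^^ k) -` ?G"
      obtain x y where xy: "p = (x, y)" by (cases p)
      have p: "(x, y) \<in> Qsq" "(T ^^ k) (x, y) \<in> ?G"
        using p_in unfolding xy by (simp_all only: Int_iff vimage_eq)
      let ?z = "(f ^^ (k - n)) y"
      have "(f ^^ n) ?z = (f ^^ (n + (k - n))) y" by (simp only: funpow_add comp_apply)
      then have "(f ^^ n) ?z = (f ^^ k) y" using k(1) by simp
      then have "?z = S y' + (f ^^ k) y / \<beta> ^ n"
        using expansion_partial_sum[of ?z n] same[OF p] by (simp add: S_def)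
      moreover have "(f ^^ k) y \<in> {y0 - r<..<y0 + r}" using p(2) by (simp add: Tmap_funpow)
      then have "(y0 - r) / \<beta> ^ n < (f ^^ k) y / \<beta> ^ n" "(f ^^ k) y / \<beta> ^ n < (y0 + r) / \<beta> ^ n"
        using beta_gt_1 by (simp_all add: divide_strict_right_mono)
      moreover have "?z \<in> {0..<1}" using p(1) by (intro f_funpow_range) (auto simp: Qsq_def)
      ultimately show "p \<in> {p. (f ^^ (k - n)) (snd p) \<in> ?Z}" by (simp add: xy)
    qed
  qed (auto intro!: borel_Times)
  also have "measure lborel ?Z \<le> measure lborel {S y' + (y0 - r) / \<beta> ^ n<..<S y' + (y0 + r) / \<beta> ^ n}"
    by (intro measure_mono_fmeasurable) (auto simp: fmeasurable_def emeasure_bounded_finite[unfolded infinity_ennreal_def])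
  also have "\<dots> = 2 * r / \<beta> ^ n"
    using r beta_gt_1 by (simp add: divide_right_mono diff_divide_distrib[symmetric])
  finally show ?thesis using growth_const_gt_1 by (simp add: mult_left_mono)
qed

lemma SRB_box_le:
  assumes \<mu>: "is_SRB \<beta> lam \<mu>" and \<gamma>: "\<gamma> \<in> S_set" "\<beta> \<le> \<gamma>" "lam < 1 / \<gamma>"
    and \<rho>: "\<rho> = (1 - lam) * (1 - lam * \<gamma>) * lam ^ n / 4"
  shows "emeasure \<mu> ({x0 - \<rho><..<x0 + \<rho>} \<times> {y0 - \<rho><..<y0 + \<rho>}) \<le> ennreal (growth_const * (2 * \<rho> / \<beta> ^ n))"
proof -
  have "1 < \<gamma>" using \<gamma> by (auto simp: S_set_def)
  then have "lam * \<gamma> < 1" using \<gamma>(3) by (simp add: pos_less_divide_eq)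
  then have "0 < \<rho>" using lam_pos lam_lt_1 unfolding \<rho> by (intro divide_pos_pos mult_pos_pos) auto
  \<comment> \<open>From this time on the influence lam^k of the initial x is below \<rho>.\<close>
  then obtain k1 where k1: "lam ^ k1 < \<rho>" using real_arch_pow_inv[of \<rho> lam] lam_lt_1 by auto
  show ?thesis
  proof (rule is_SRB_open_le[OF \<mu>, where ?k0.0 = "n + k1"])
    fix k assume k: "n + k1 \<le> k"
    have "lam ^ k \<le> lam ^ k1" using k lam_pos lam_lt_1 by (intro power_decreasing) auto
    then show "measure lborel (Qsq \<inter> (T ^^ k) -` ({x0 - \<rho><..<x0 + \<rho>} \<times> {y0 - \<rho><..<y0 + \<rho>})) \<le> growth_const * (2 * \<rho> / \<beta> ^ n)"
      using k k1 \<open>0 < \<rho>\<close> \<rho> by (intro box_preimage_le[OF \<gamma>]) auto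
  qed (auto intro: open_Times)
qed

section \<open>Lower bound for the dimension\<close>

definition dim_val :: real where
  "dim_val = 1 + ln \<beta> / ln (1 / lam)"

lemma dim_val_ge_1: "1 \<le> dim_val"
  using beta_gt_1 lam_pos lam_lt_1 by (simp add: dim_val_def)

text \<open>This equation characterises the exponent: a mass of order (lam / \<beta>)^n on a box of
  side lam^n is the power \<open>dim_val\<close> of the side.\<close>

lemma lam_powr_dim_val: "lam powr dim_val = lam / \<beta>"
proof -
  have "ln lam < 0" using lam_pos lam_lt_1 by simp
  then have "ln \<beta> / ln (1 / lam) * ln lam = - ln \<beta>"
    using lam_pos by (simp add: ln_div)
  then have "lam powr (ln \<beta> / ln (1 / lam)) = 1 / \<beta>"
    using lam_pos beta_gt_1 by (simp add: powr_def exp_minus inverse_eq_divide)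
  then show ?thesis using lam_pos by (simp add: dim_val_def powr_add)
qed

lemma lam_power_powr: "(lam ^ n) powr s = (lam powr s) ^ n"
  using lam_pos by (simp add: powr_realpow[symmetric] powr_powr mult.commute powr_gt_zero)

text \<open>If c * lam^(n+1) \<le> diameter U < c * lam^n, then \<open>U\<close> lies in the box of
  index \<open>n\<close>, of mass at most a constant times (lam / \<beta>)^n. The denominator of the
  constant is the price of writing this as a power of c * lam^(n+1).\<close>

lemma SRB_frostman:
  assumes \<mu>: "is_SRB \<beta> lam \<mu>" and \<gamma>: "\<gamma> \<in> S_set" "\<beta> \<le> \<gamma>" "lam < 1 / \<gamma>"
    and c: "c = (1 - lam) * (1 - lam * \<gamma>) / 4"
    and U: "bounded U" "diameter U \<le> c / 2"
  shows "\<exists>V. U \<subseteq> V \<and> V \<in> sets borel \<and>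
    emeasure \<mu> V \<le> ennreal (growth_const * 2 * c / (c powr dim_val * (lam / \<beta>)) * diameter U powr dim_val)"
proof (cases "U = {}")
  case True
  then show ?thesis by (intro exI[of _ "{}"]) simp
next
  case False
  then obtain p where p: "p \<in> U" by auto
  define D where "D = diameter U"
  define \<rho> where "\<rho> = (\<lambda>n. c * lam ^ n)"
  have "1 < \<gamma>" using \<gamma> by (auto simp: S_set_def)
  then have "lam * \<gamma> < 1" using \<gamma>(3) by (simp add: pos_less_divide_eq)
  then have c0: "0 < c" using lam_pos lam_lt_1 unfolding c by (intro divide_pos_pos mult_pos_pos) auto
  have D: "0 \<le> D" "D < c" using diameter_ge_0[OF U(1)] U(2) c0 by (simp_all add: D_def)
  define B where "B = (\<lambda>n. {fst p - \<rho> n<..<fst p + \<rho> n} \<times> {snd p - \<rho> n<..<snd p + \<rho> n})"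
  have B: "emeasure \<mu> (B n) \<le> ennreal (growth_const * (2 * \<rho> n / \<beta> ^ n))" for n
    unfolding B_def by (rule SRB_box_le[OF \<mu> \<gamma>]) (simp add: \<rho>_def c)
  have sub: "U \<subseteq> B n" if "D < \<rho> n" for n
  proof
    fix q assume "q \<in> U"
    then have d: "dist q p \<le> D" unfolding D_def using p U(1) by (intro diameter_bounded_bound)
    have "dist (fst q) (fst p) \<le> dist q p" "dist (snd q) (snd p) \<le> dist q p"
      by (rule dist_fst_le, rule dist_snd_le)
    then have "\<bar>fst q - fst p\<bar> < \<rho> n" "\<bar>snd q - snd p\<bar> < \<rho> n"
      using d that unfolding dist_real_def by linarith+
    then show "q \<in> B n" unfolding B_def mem_Times_iff by auto
  qed
  have Bs: "B n \<in> sets borel" for n unfolding B_def by (intro borel_open open_Times) auto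
  show ?thesis
  \<comment> \<open>For diameter 0 the claimed bound is 0, so single points must be null; boxes
    shrinking to \<open>p\<close> give this.\<close>
  proof (cases "D = 0")
    case True
    have "{p} \<subseteq> B n" for n
      using c0 lam_pos by (auto simp: B_def \<rho>_def mem_Times_iff)
    then have "emeasure \<mu> {p} \<le> ennreal (growth_const * (2 * \<rho> n / \<beta> ^ n))" for n
      using B[of n] Bs[of n] emeasure_mono[of "{p}" "B n" \<mu>] \<mu> by (auto simp: is_SRB_def intro: order_trans)
    moreover have "(\<lambda>n. ennreal (growth_const * (2 * \<rho> n / \<beta> ^ n))) \<longlonglongrightarrow> ennreal 0"
    proof (rule tendsto_ennrealI)
      have "(\<lambda>n. growth_const * 2 * c * (lam / \<beta>) ^ n) \<longlonglongrightarrow> growth_const * 2 * c * 0"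
        using lam_pos lam_lt_1 beta_gt_1 by (intro tendsto_mult tendsto_const LIMSEQ_power_zero) auto
      then show "(\<lambda>n. growth_const * (2 * \<rho> n / \<beta> ^ n)) \<longlonglongrightarrow> 0"
        by (simp add: \<rho>_def power_divide mult_ac)
    qed
    ultimately have "emeasure \<mu> {p} \<le> ennreal 0"
      by (intro LIMSEQ_le_const) auto
    moreover have "U \<subseteq> {p}"
    proof
      fix q assume "q \<in> U"
      then have "dist q p \<le> D" unfolding D_def using p U(1) by (intro diameter_bounded_bound)
      then show "q \<in> {p}" using True by simp
    qed
    ultimately show ?thesis by (intro exI[of _ "{p}"]) (auto simp: True D_def[symmetric])
  next
    case False
    then have D0: "0 < D" using D by simp
    define N where "N = (LEAST n. \<rho> n \<le> D)"
    obtain n0 where "lam ^ n0 < D / c" using real_arch_pow_inv[of "D / c" lam] lam_lt_1 D0 c0 by auto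
    then have ex: "\<rho> n0 \<le> D" using c0 by (simp add: \<rho>_def field_simps)
    have N: "\<rho> N \<le> D" unfolding N_def by (rule LeastI[of "\<lambda>n. \<rho> n \<le> D", OF ex])
    \<comment> \<open>Since D < c = \<rho> 0, the scale just before \<open>N\<close> exists; it
      supplies the box that contains \<open>U\<close>.\<close>
    have "N \<noteq> 0" using N D by (auto simp: \<rho>_def intro: ccontr)
    then obtain n where n: "N = Suc n" by (cases N) auto
    have lt: "D < \<rho> n" using not_less_Least[of n "\<lambda>n. \<rho> n \<le> D"] n unfolding N_def by simp
    have "growth_const * (2 * \<rho> n / \<beta> ^ n) = growth_const * 2 * c * (lam / \<beta>) ^ n"
      by (simp add: \<rho>_def power_divide)
    also have "\<dots> = growth_const * 2 * c / (c powr dim_val * (lam / \<beta>)) * (c * lam ^ Suc n) powr dim_val"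
    proof -
      have "(c * lam ^ Suc n) powr dim_val = c powr dim_val * (lam / \<beta>) ^ Suc n"
        unfolding lam_powr_dim_val[symmetric] lam_power_powr[symmetric]
        using c0 lam_pos by (subst powr_mult) auto
      then show ?thesis using c0 lam_pos beta_gt_1 by simp
    qed
    also have "\<dots> \<le> growth_const * 2 * c / (c powr dim_val * (lam / \<beta>)) * D powr dim_val"
      using N n c0 lam_pos beta_gt_1 growth_const_gt_1 dim_val_ge_1
      by (intro mult_left_mono powr_mono2) (auto simp: \<rho>_def)
    finally have "emeasure \<mu> (B n) \<le> ennreal (growth_const * 2 * c / (c powr dim_val * (lam / \<beta>)) * D powr dim_val)"
      using B[of n] by (meson ennreal_leI order_trans)
    then show ?thesis using sub[OF lt] Bs[of n] unfolding D_def by (intro exI[of _ "B n"]) simp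
  qed
qed

lemma SRB_dim_ge:
  assumes \<mu>: "is_SRB \<beta> lam \<mu>" and \<gamma>: "\<gamma> \<in> S_set" "\<beta> \<le> \<gamma>" "lam < 1 / \<gamma>"
    and A: "A \<in> sets borel" "emeasure \<mu> (space \<mu> - A) = 0"
  shows "dim_val \<le> hausdorff_dim A"
proof -
  define c where "c = (1 - lam) * (1 - lam * \<gamma>) / 4"
  have "1 < \<gamma>" using \<gamma> by (auto simp: S_set_def)
  then have l: "lam * \<gamma> < 1" "0 < lam * \<gamma>" using \<gamma>(3) lam_pos by (simp_all add: pos_less_divide_eq)
  have c0: "0 < c" using l lam_pos lam_lt_1 unfolding c_def by (intro divide_pos_pos mult_pos_pos) auto
  have "(1 - lam) * (1 - lam * \<gamma>) \<le> 1 * 1" using l lam_pos lam_lt_1 by (intro mult_mono) auto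
  then have c1: "c \<le> 1" by (simp add: c_def)
  have sets: "sets \<mu> = sets borel" using \<mu> by (simp add: is_SRB_def)
  have "emeasure \<mu> Qsq \<le> emeasure \<mu> (A \<union> (space \<mu> - A))"
    using A(1) by (intro emeasure_mono) (auto simp: sets sets_eq_imp_space_eq[OF sets])
  also have "\<dots> \<le> emeasure \<mu> A + emeasure \<mu> (space \<mu> - A)"
    using A(1) by (intro emeasure_subadditive) (auto simp: sets sets_eq_imp_space_eq[OF sets])
  finally have "1 \<le> emeasure \<mu> A" using is_SRB_emeasure_Qsq[OF \<mu>] A(2) by simp
  then have pos: "0 < emeasure \<mu> A" by (rule less_le_trans[rotated]) simp
  show ?thesis
  proof (rule mass_distribution_principle[OF sets A(1) pos SRB_frostman[OF \<mu> \<gamma> c_def], where \<delta> = "c / 2"])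
    show "0 \<le> growth_const * 2 * c / (c powr dim_val * (lam / \<beta>))"
      using c0 growth_const_gt_1 lam_pos beta_gt_1 by (intro divide_nonneg_nonneg mult_nonneg_nonneg) auto
  qed (use c0 c1 dim_val_ge_1 in auto)
qed

section \<open>Upper bound for the dimension\<close>

lemma finite_xcoord: "finite (xcoord \<beta> lam n ` S)"
proof (induction n)
  case (Suc n)
  have "xcoord \<beta> lam (Suc n) ` S \<subseteq> (\<lambda>(v, b). lam * v + (1 - lam) * b) ` (xcoord \<beta> lam n ` S \<times> {0, 1})"
  proof (rule image_subsetI)
    fix y assume "y \<in> S"
    then show "xcoord \<beta> lam (Suc n) y \<in> (\<lambda>(v, b). lam * v + (1 - lam) * b) ` (xcoord \<beta> lam n ` S \<times> {0, 1})"
      by (intro image_eqI[of _ _ "(xcoord \<beta> lam n y, real (bdig \<beta> ((f ^^ n) y)))"])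
         (simp_all add: xcoord_Suc bdig_def)
  qed
  from finite_subset[OF this] Suc show ?case by simp
qed (auto intro: finite_subset[of _ "{0}"])

text \<open>For c \<le> 1 / \<beta> the words from [0, c) begin with 0 and continue from [0, \<beta>
  * c). Otherwise they begin with 0 and continue from [0, 1), or begin with 1 and continue from [0,
  \<beta> * c - 1). A leading 1 only translates the code, so the counts divided by \<beta>^k obey
  the recursion of \<open>expansion_growth\<close>.\<close>

lemma card_xcoord: "real (card (xcoord \<beta> lam n ` {0..<1})) \<le> growth_const * \<beta> ^ n"
proof -
  let ?N = "\<lambda>k c. card (xcoord \<beta> lam k ` {0..<c})"
  have "(\<lambda>k c. real (?N k c) / \<beta> ^ k) n 1 \<le> 1 * (\<beta> / (\<beta> - 1) + 1)"
  proof (rule expansion_growth_bound[OF beta_gt_1 beta_lt_2])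
    fix c :: real
    have "?N 0 c \<le> card {0 :: real}" by (intro card_mono) auto
    then show "real (?N 0 c) / \<beta> ^ 0 \<le> 1" by simp
  next
    fix k and c :: real assume c: "c \<le> 1 / \<beta>"
    have "xcoord \<beta> lam (Suc k) ` {0..<c} \<subseteq> xcoord \<beta> lam k ` {0..<\<beta> * c}"
    proof
      fix v assume "v \<in> xcoord \<beta> lam (Suc k) ` {0..<c}"
      then obtain y where y: "0 \<le> y" "y < c" "v = xcoord \<beta> lam (Suc k) y" by auto
      have "y < 1 / \<beta>" using y c by linarith
      then have "v = xcoord \<beta> lam k (\<beta> * y)" using y(3) by (simp add: xcoord_Suc_right bdig_def bmap_def)
      then show "v \<in> xcoord \<beta> lam k ` {0..<\<beta> * c}" using y beta_gt_1 by (intro image_eqI) auto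
    qed
    then have "?N (Suc k) c \<le> ?N k (\<beta> * c)" by (intro card_mono finite_xcoord)
    then show "real (?N (Suc k) c) / \<beta> ^ Suc k \<le> real (?N k (\<beta> * c)) / \<beta> ^ k / \<beta>"
      using beta_gt_1 by (simp add: divide_right_mono mult.commute)
  next
    fix k and c :: real assume c: "1 / \<beta> < c" "c \<le> 1"
    have "xcoord \<beta> lam (Suc k) ` {0..<c} \<subseteq> xcoord \<beta> lam k ` {0..<1} \<union>
        (\<lambda>v. v + (1 - lam) * lam ^ k) ` (xcoord \<beta> lam k ` {0..<\<beta> * c - 1})"
    proof
      fix v assume "v \<in> xcoord \<beta> lam (Suc k) ` {0..<c}"
      then obtain y where y: "0 \<le> y" "y < c" "v = xcoord \<beta> lam (Suc k) y" by auto
      show "v \<in> xcoord \<beta> lam k ` {0..<1} \<union>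
        (\<lambda>v. v + (1 - lam) * lam ^ k) ` (xcoord \<beta> lam k ` {0..<\<beta> * c - 1})"
      proof (cases "y < 1 / \<beta>")
        case True
        then have "v = xcoord \<beta> lam k (\<beta> * y)" using y(3) by (simp add: xcoord_Suc_right bdig_def bmap_def)
        moreover have "\<beta> * y \<in> {0..<1}" using y True beta_gt_1 by (auto simp: field_simps)
        ultimately show ?thesis by blast
      next
        case False
        then have "v = xcoord \<beta> lam k (\<beta> * y - 1) + (1 - lam) * lam ^ k" using y(3) by (simp add: xcoord_Suc_right bdig_def bmap_def)
        moreover have "\<beta> * y - 1 \<in> {0..<\<beta> * c - 1}" using y False beta_gt_1 by (auto simp: field_simps)
        ultimately show ?thesis by blast
      qed
    qed
    then have "?N (Suc k) c \<le> card (xcoord \<beta> lam k ` {0..<1} \<union>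
        (\<lambda>v. v + (1 - lam) * lam ^ k) ` (xcoord \<beta> lam k ` {0..<\<beta> * c - 1}))"
      by (intro card_mono finite_UnI finite_imageI[OF finite_xcoord] finite_xcoord)
    also have "\<dots> \<le> ?N k 1 + card ((\<lambda>v. v + (1 - lam) * lam ^ k) ` (xcoord \<beta> lam k ` {0..<\<beta> * c - 1}))"
      by (rule card_Un_le)
    also have "\<dots> \<le> ?N k 1 + ?N k (\<beta> * c - 1)"
      by (intro add_left_mono card_image_le finite_xcoord)
    finally have "real (?N (Suc k) c) \<le> real (?N k 1) + real (?N k (\<beta> * c - 1))" by linarith
    then have "real (?N (Suc k) c) / \<beta> ^ Suc k \<le> (real (?N k 1) + real (?N k (\<beta> * c - 1))) / \<beta> ^ Suc k"
      using beta_gt_1 by (intro divide_right_mono) auto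
    also have "\<dots> = (real (?N k 1) / \<beta> ^ k + real (?N k (\<beta> * c - 1)) / \<beta> ^ k) / \<beta>"
      by (simp add: add_divide_distrib mult.commute)
    finally show "real (?N (Suc k) c) / \<beta> ^ Suc k \<le> (real (?N k 1) / \<beta> ^ k + real (?N k (\<beta> * c - 1)) / \<beta> ^ k) / \<beta>" .
  qed simp
  then show ?thesis using beta_gt_1 by (simp add: growth_const_def pos_divide_le_eq)
qed

text \<open>The strips of width lam^n over the codes of length \<open>n\<close> contain the images
  of the square under all iterates from the \<open>n\<close>-th on. There are finitely many, so each
  layer is closed and \<open>is_SRB_open_le\<close> applies to its complement.\<close>

definition attractor :: "(real \<times> real) set" where
  "attractor = Qsq \<inter> (\<Inter>n. \<Union>v\<in>xcoord \<beta> lam n ` {0..<1}. {v..v + lam ^ n} \<times> UNIV)"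

lemma attractor_layer_closed: "closed (\<Union>v\<in>xcoord \<beta> lam n ` {0..<1}. {v..v + lam ^ n} \<times> (UNIV :: real set))"
  by (intro closed_UN finite_xcoord ballI closed_Times closed_UNIV closed_atLeastAtMost)

lemma attractor_sets: "attractor \<in> sets borel"
  unfolding attractor_def
  by (intro sets.Int Qsq_sets sets.countable_INT'' borel_closed attractor_layer_closed closed_UNIV countableI_type)

text \<open>From time \<open>n\<close> on no point of the square is sent to the complement of the
  \<open>n\<close>-th layer, so this open set admits the bound 0.\<close>

lemma SRB_attractor:
  assumes \<mu>: "is_SRB \<beta> lam \<mu>"
  shows "emeasure \<mu> (space \<mu> - attractor) = 0"
proof -
  have sets: "sets \<mu> = sets borel" using \<mu> by (simp add: is_SRB_def)
  define G where "G = (\<lambda>n. - (\<Union>v\<in>xcoord \<beta> lam n ` {0..<1}. {v..v + lam ^ n} \<times> (UNIV :: real set)))"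
  have G: "open (G n)" for n unfolding G_def using attractor_layer_closed by (intro open_Compl)
  have "emeasure \<mu> (G n) \<le> ennreal 0" for n
  proof (rule is_SRB_open_le[OF \<mu> G, where ?k0.0 = n])
    fix k assume k: "n \<le> k"
    have "(T ^^ k) p \<notin> G n" if "p \<in> Qsq" for p
    proof -
      have "(T ^^ k) p = (T ^^ n) ((T ^^ (k - n)) p)" using k by (metis comp_apply funpow_add le_add_diff_inverse)
      moreover obtain x y where xy: "(T ^^ (k - n)) p = (x, y)" by (cases "(T ^^ (k - n)) p")
      moreover have "(x, y) \<in> Qsq" using T_funpow_Qsq[OF that, of "k - n"] xy by simp
      then have "0 \<le> x" "x < 1" and y: "y \<in> {0..<1}" by (auto simp: Qsq_def)
      then have "0 \<le> lam ^ n * x" "lam ^ n * x \<le> lam ^ n * 1" using lam_pos by (auto intro!: mult_left_mono)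
      then have "lam ^ n * x + xcoord \<beta> lam n y \<in> {xcoord \<beta> lam n y..xcoord \<beta> lam n y + lam ^ n}" by simp
      ultimately show ?thesis using y unfolding G_def by (force simp: Tmap_funpow)
    qed
    then have "Qsq \<inter> (T ^^ k) -` G n = {}" unfolding disjoint_iff vimage_eq by blast
    then show "measure lborel (Qsq \<inter> (T ^^ k) -` G n) \<le> 0" by simp
  qed
  then have "emeasure \<mu> (\<Union>n. G n) = 0"
    using G by (intro emeasure_UN_eq_0) (auto simp: sets)
  moreover have "emeasure \<mu> (- Qsq) = 0" using \<mu> by (simp add: is_SRB_def)
  moreover have "space \<mu> - attractor = - Qsq \<union> (\<Union>n. G n)"
    unfolding attractor_def G_def sets_eq_imp_space_eq[OF sets] by auto
  moreover have "emeasure \<mu> (- Qsq \<union> (\<Union>n. G n)) \<le> emeasure \<mu> (- Qsq) + emeasure \<mu> (\<Union>n. G n)"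
    using G by (intro emeasure_subadditive) (auto simp: sets)
  ultimately show ?thesis by simp
qed

lemma attractor_dim_le: "hausdorff_dim attractor \<le> dim_val"
proof (rule hausdorff_dim_le)
  show "0 \<le> dim_val" using dim_val_ge_1 by simp
next
  fix s assume s: "dim_val < s"
  then have s1: "1 < s" using dim_val_ge_1 by simp
  \<comment> \<open>The ratio of the covering sums: about \<beta>^n codes times lam^(-n) heights,
    with squares of side lam^n. It is below 1 exactly when \<open>s\<close> exceeds
    \<open>dim_val\<close>.\<close>
  define q where "q = \<beta> * (lam powr s) / lam"
  have "lam powr s < lam powr dim_val" using s lam_pos lam_lt_1 by (intro powr_less_mono') auto
  then have q: "0 < q" "q < 1" using lam_pos beta_gt_1 by (simp_all add: q_def lam_powr_dim_val field_simps)
  show "hausdorff_measure s attractor = 0"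
  proof (rule hausdorff_measure_0I_finite)
    show "0 < s" using s1 by simp
    fix \<delta> e :: real assume d: "0 < \<delta>" "0 < e"
    \<comment> \<open>The factor 2 bounds the number of heights by 2 / lam^n, and
      \<open>2 powr s\<close> comes from the diameter bound 2 * lam^n.\<close>
    define K where "K = 2 * growth_const * 2 powr s"
    have K: "0 < K" using growth_const_gt_1 by (simp add: K_def)
    obtain n1 where n1: "lam ^ n1 < \<delta> / 2" using real_arch_pow_inv[of "\<delta> / 2" lam] lam_lt_1 d by auto
    obtain n2 where n2: "q ^ n2 < e / K" using real_arch_pow_inv[of "e / K" q] q d K by auto
    define n where "n = max n1 n2"
    define r where "r = lam ^ n"
    have r0: "0 < r" "r \<le> 1" using lam_pos lam_lt_1 by (auto simp: r_def intro: power_le_one)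
    have "r \<le> lam ^ n1" unfolding r_def using lam_pos lam_lt_1 by (intro power_decreasing) (auto simp: n_def)
    then have r1: "2 * r \<le> \<delta>" using n1 by simp
    have "q ^ n \<le> q ^ n2" using q by (intro power_decreasing) (auto simp: n_def)
    then have "K * q ^ n \<le> K * q ^ n2" using K by (intro mult_left_mono) auto
    also have "\<dots> \<le> e" using n2 K by (simp add: pos_less_divide_eq mult.commute)
    finally have qn: "K * q ^ n \<le> e" .
    define N where "N = nat \<lceil>1 / r\<rceil>"
    have N: "1 \<le> real N * r" "real N \<le> 2 / r"
    proof -
      have "1 / r \<le> real N" unfolding N_def by linarith
      then show "1 \<le> real N * r" using r0 by (simp add: field_simps)
      have "1 \<le> 1 / r" using r0 by simp
      then have "real N \<le> 1 / r + 1" unfolding N_def by linarith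
      also have "\<dots> \<le> 2 / r" using \<open>1 \<le> 1 / r\<close> by simp
      finally show "real N \<le> 2 / r" .
    qed
    let ?W = "xcoord \<beta> lam n ` {0..<1}"
    define Q where "Q = (\<lambda>(v, j). {v..v + r} \<times> {0 + real j * r..0 + real j * r + r})"
    have dQ: "diameter (Q p) \<le> 2 * r" "bounded (Q p)" for p
      using diameter_square[of r] bounded_square r0 by (cases p, simp add: Q_def)+
    define F where "F = Q ` (?W \<times> {..<N})"
    have 1: "finite F" unfolding F_def by (intro finite_imageI finite_cartesian_product finite_xcoord) simp
    have 2: "attractor \<subseteq> \<Union>F"
    proof
      fix p assume p: "p \<in> attractor"
      obtain x y where xy: "p = (x, y)" by (cases p)
      have "p \<in> Qsq" "p \<in> (\<Union>v\<in>?W. {v..v + lam ^ n} \<times> UNIV)" using p unfolding attractor_def by auto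
      then have "y \<in> {0..<1}" and "\<exists>v\<in>?W. x \<in> {v..v + r}" unfolding xy by (auto simp: Qsq_def r_def)
      then obtain v where v: "v \<in> ?W" "x \<in> {v..v + r}" by (elim bexE)
      have "\<exists>j<N. y \<in> {0 + real j * r..0 + real j * r + r}"
        using \<open>y \<in> {0..<1}\<close> N(1) r0 by (intro interval_cover) auto
      then obtain j where j: "j < N" "y \<in> {0 + real j * r..0 + real j * r + r}" by (elim exE conjE)
      have "Q (v, j) \<in> F" unfolding F_def using v(1) j(1) by (intro imageI) simp
      moreover have "p \<in> Q (v, j)" using v(2) j(2) by (simp add: Q_def xy)
      ultimately show "p \<in> \<Union>F" by (rule UnionI)
    qed
    have 3: "\<forall>V\<in>F. bounded V \<and> diameter V \<le> \<delta>"
      unfolding F_def using dQ(2) order_trans[OF dQ(1) r1] by simp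
    have "(\<Sum>V\<in>F. diameter V powr s) \<le> of_nat (card F) * ((2 * r) powr s)"
      using dQ(1) diameter_ge_0[OF dQ(2)] s1 by (intro sum_bounded_above powr_mono2) (auto simp: F_def simp del: split_paired_All)
    also have "\<dots> \<le> (growth_const * \<beta> ^ n * (2 / r)) * ((2 * r) powr s)"
    proof (intro mult_right_mono)
      have "card F \<le> card (?W \<times> {..<N})" unfolding F_def by (intro card_image_le finite_cartesian_product finite_xcoord) simp
      then have "real (card F) \<le> real (card ?W) * real N" by (simp add: card_cartesian_product flip: of_nat_mult)
      also have "\<dots> \<le> (growth_const * \<beta> ^ n) * (2 / r)"
        using card_xcoord N(2) growth_const_gt_1 beta_gt_1 by (intro mult_mono) auto
      finally show "real (card F) \<le> growth_const * \<beta> ^ n * (2 / r)" .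
    qed simp
    also have "(2 * r) powr s = 2 powr s * (lam powr s) ^ n"
      using r0 unfolding r_def lam_power_powr[symmetric] by (subst powr_mult) auto
    also have "growth_const * \<beta> ^ n * (2 / r) * (2 powr s * (lam powr s) ^ n) = K * q ^ n"
      by (simp add: K_def q_def r_def power_mult_distrib power_divide)
    finally have 4: "(\<Sum>V\<in>F. diameter V powr s) \<le> e" using qn by linarith
    show "\<exists>F. finite F \<and> attractor \<subseteq> \<Union>F \<and> (\<forall>V\<in>F. bounded V \<and> diameter V \<le> \<delta>) \<and>
        (\<Sum>V\<in>F. diameter V powr s) \<le> e"
      by (intro exI[of _ F] conjI 1 2 3 4)
  qed
qed

lemma SRB_dimension:
  assumes \<mu>: "is_SRB \<beta> lam \<mu>" and \<gamma>: "\<gamma> \<in> S_set" "\<beta> \<le> \<gamma>" "lam < 1 / \<gamma>"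
  shows "measure_hausdorff_dim \<mu> = dim_val"
proof (rule antisym)
  let ?D = "hausdorff_dim ` {A. A \<in> sets borel \<and> emeasure \<mu> (space \<mu> - A) = 0}"
  have ge: "dim_val \<le> d" if "d \<in> ?D" for d
    using that SRB_dim_ge[OF \<mu> \<gamma>] by blast
  have mem: "hausdorff_dim attractor \<in> ?D"
    using attractor_sets SRB_attractor[OF \<mu>] by blast
  show "dim_val \<le> measure_hausdorff_dim \<mu>"
    unfolding measure_hausdorff_dim_def using mem ge by (intro cInf_greatest) blast+
  have "Inf ?D \<le> hausdorff_dim attractor"
    by (rule cInf_lower[OF mem bdd_belowI[of _ dim_val]]) (rule ge)
  then show "measure_hausdorff_dim \<mu> \<le> dim_val"
    unfolding measure_hausdorff_dim_def using attractor_dim_le by linarith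
qed

end

section \<open>Backward orbits of the Parry measure\<close>

text \<open>The comparison sequence is close only after a delay \<open>m\<close>, and its averages
  converge only near \<open>L\<close>. In the application \<open>a\<close> holds integrals of a test
  function under the baker map, \<open>b\<close> orbit integrals of a function of y alone.\<close>

lemma cesaro_approx:
  assumes B: "\<And>k. \<bar>a k\<bar> \<le> B"
    and approx: "\<And>e. 0 < e \<Longrightarrow> \<exists>m b L'. (\<forall>k. \<bar>a (k + m) - b k\<bar> \<le> e) \<and> cesaro b \<longlonglongrightarrow> L' \<and> \<bar>L - L'\<bar> \<le> e"
  shows "cesaro a \<longlonglongrightarrow> L"
proof (rule LIMSEQ_I)
  fix e :: real assume e: "0 < e"
  then have e4: "0 < e / 4" by simp
  from approx[OF this] obtain m b L' where m: "\<forall>k. \<bar>a (k + m) - b k\<bar> \<le> e / 4"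
    and b: "cesaro b \<longlonglongrightarrow> L'" and L: "\<bar>L - L'\<bar> \<le> e / 4" by (elim exE conjE)
  obtain n1 where n1: "\<And>n. n \<ge> n1 \<Longrightarrow> norm (cesaro b n - L') < e / 4"
    using LIMSEQ_D[OF b e4] by auto
  obtain n2 where n2: "\<And>n. n \<ge> n2 \<Longrightarrow> norm (2 * real m * B / real n - 0) < e / 4"
    using LIMSEQ_D[OF over_n_tendsto_0[of "2 * real m * B"] e4] by auto
  show "\<exists>n0. \<forall>n\<ge>n0. norm (cesaro a n - L) < e"
  proof (intro exI allI impI)
    fix n assume n: "max n1 (max n2 1) \<le> n"
    let ?c = "cesaro (\<lambda>k. a (k + m)) n"
    have "?c \<le> cesaro (\<lambda>k. b k + e / 4) n" "cesaro b n \<le> cesaro (\<lambda>k. a (k + m) + e / 4) n"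
      using m by (intro cesaro_mono; simp add: abs_le_iff; smt (verit))+
    then have "?c \<le> cesaro b n + e / 4" "cesaro b n \<le> ?c + e / 4"
      using n by (simp_all add: cesaro_add cesaro_const)
    then have "\<bar>?c - cesaro b n\<bar> \<le> e / 4" by linarith
    moreover have "\<bar>?c - cesaro a n\<bar> < e / 4"
    proof -
      have "norm (2 * real m * B / real n - 0) < e / 4" using n by (intro n2) simp
      then show ?thesis using cesaro_shift[of a B m n, OF B] unfolding real_norm_def by linarith
    qed
    moreover have "\<bar>cesaro b n - L'\<bar> < e / 4" using n1[of n] n by simp
    ultimately show "norm (cesaro a n - L) < e" using L unfolding real_norm_def by linarith
  qed
qed

context beta_expansion
begin

text \<open>Points with the same first \<open>r\<close> digits differ only in the remainder, which
  is at most \<beta>^(-r).\<close>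

lemma ones_cylinder_le:
  "measure lborel {z \<in> {0..<1}. \<forall>l<r. bdig \<beta> ((f ^^ l) z) = 1} \<le> 1 / \<beta> ^ r"
proof -
  define S where "S = (\<Sum>k<r. 1 / \<beta> ^ Suc k)"
  have "{z \<in> {0..<1}. \<forall>l<r. bdig \<beta> ((f ^^ l) z) = 1} \<subseteq> {S..S + 1 / \<beta> ^ r}"
  proof
    fix z assume z: "z \<in> {z \<in> {0..<1}. \<forall>l<r. bdig \<beta> ((f ^^ l) z) = 1}"
    then have "(\<Sum>k<r. real (bdig \<beta> ((f ^^ k) z)) / \<beta> ^ Suc k) = S"
      unfolding S_def by (intro sum.cong refl) simp
    then have e: "z = S + (f ^^ r) z / \<beta> ^ r" using expansion_partial_sum[of z r] by simp
    have "(f ^^ r) z \<in> {0..<1}" using z by (intro f_funpow_range) simp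
    then have "0 \<le> (f ^^ r) z / \<beta> ^ r" "(f ^^ r) z / \<beta> ^ r \<le> 1 / \<beta> ^ r"
      using beta_gt_1 by (auto intro!: divide_right_mono)
    then show "z \<in> {S..S + 1 / \<beta> ^ r}" using e by simp
  qed
  then have "measure lborel {z \<in> {0..<1}. \<forall>l<r. bdig \<beta> ((f ^^ l) z) = 1} \<le> measure lborel {S..S + 1 / \<beta> ^ r}"
    by (intro measure_mono_fmeasurable) (auto simp: fmeasurable_def emeasure_lborel_Icc_eq)
  then show ?thesis using beta_gt_1 by simp
qed

text \<open>Coordinate \<open>j\<close> is the point \<open>j\<close> steps in the past. For finite
  \<open>J\<close> it is realised by a Parry point at the depth of the oldest index, mapped forward;
  \<open>insert 0\<close> keeps \<open>Max\<close> meaningful for empty \<open>J\<close>.\<close>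

definition past_dist :: "nat set \<Rightarrow> (nat \<Rightarrow> real) measure" where
  "past_dist J = distr parry (PiM J (\<lambda>_. borel)) (\<lambda>y. \<lambda>j\<in>J. (f ^^ (Max (insert 0 J) - j)) y)"

lemma past_dist_measurable [measurable]:
  "(\<lambda>y. \<lambda>j\<in>J. (f ^^ (n - j)) y) \<in> parry \<rightarrow>\<^sub>M PiM J (\<lambda>_. borel)"
  by (intro measurable_restrict) simp

text \<open>By invariance of the Parry measure the backward orbit may start at any greater depth;
  this is the consistency that the projective limit requires.\<close>

lemma past_dist_eq:
  assumes J: "finite J" "\<And>j. j \<in> J \<Longrightarrow> j \<le> n"
  shows "past_dist J = distr parry (PiM J (\<lambda>_. borel)) (\<lambda>y. \<lambda>j\<in>J. (f ^^ (n - j)) y)"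
proof -
  let ?m = "Max (insert 0 J)"
  have m: "?m \<le> n" using J by (simp add: Max_le_iff)
  have "n - j = ?m - j + (n - ?m)" if "j \<in> J" for j using m J(1) that Max_ge[of "insert 0 J" j] by simp
  then have "(\<lambda>y. \<lambda>j\<in>J. (f ^^ (n - j)) y) = (\<lambda>y. \<lambda>j\<in>J. (f ^^ (?m - j)) y) \<circ> (f ^^ (n - ?m))"
    by (intro ext) (simp add: restrict_def funpow_add)
  then have "distr parry (PiM J (\<lambda>_. borel)) (\<lambda>y. \<lambda>j\<in>J. (f ^^ (n - j)) y) =
      distr parry (PiM J (\<lambda>_. borel)) ((\<lambda>y. \<lambda>j\<in>J. (f ^^ (?m - j)) y) \<circ> (f ^^ (n - ?m)))"
    by (simp only:)
  also have "\<dots> = distr (distr parry borel (f ^^ (n - ?m))) (PiM J (\<lambda>_. borel)) (\<lambda>y. \<lambda>j\<in>J. (f ^^ (?m - j)) y)"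
    by (rule distr_distr[symmetric]) (auto intro!: measurable_restrict)
  also have "\<dots> = past_dist J" unfolding parry_invariant_funpow past_dist_def ..
  finally show ?thesis ..
qed

text \<open>As \<open>f\<close> is not injective, a past has to be chosen at random; the limit is
  the natural extension of the Parry measure.\<close>

sublocale past: polish_projective UNIV past_dist
proof (rule polish_projective.intro, rule projective_family.intro)
  show "past_dist J = distr (past_dist H) (PiM J (\<lambda>_. borel)) (\<lambda>f. restrict f J)"
    if "J \<subseteq> H" "finite H" "H \<subseteq> UNIV" for J H
  proof -
    let ?n = "Max (insert 0 H)"
    have le: "j \<le> ?n" if "j \<in> H" for j using that \<open>finite H\<close> by simp
    have "distr (past_dist H) (PiM J (\<lambda>_. borel)) (\<lambda>f. restrict f J) =
        distr parry (PiM J (\<lambda>_. borel)) ((\<lambda>f. restrict f J) \<circ> (\<lambda>y. \<lambda>j\<in>H. (f ^^ (?n - j)) y))"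
      unfolding past_dist_def
      by (rule distr_distr) (auto intro!: measurable_restrict_subset that)
    also have "\<dots> = distr parry (PiM J (\<lambda>_. borel)) (\<lambda>y. \<lambda>j\<in>J. (f ^^ (?n - j)) y)"
      using that(1) by (intro distr_cong refl) (auto simp: fun_eq_iff restrict_def)
    also have "\<dots> = past_dist J"
      using that le by (intro past_dist_eq[symmetric]) (auto intro: finite_subset)
    finally show ?thesis ..
  qed
  show "prob_space (past_dist J)" if "finite J" "J \<subseteq> UNIV" for J
    unfolding past_dist_def by (rule prob_space.prob_space_distr[OF prob_space_parry]) simp
qed

lemma past_restrict:
  assumes "finite J"
  shows "distr past.lim (PiM J (\<lambda>_. borel)) (\<lambda>\<omega>. restrict \<omega> J) = past_dist J"
proof (rule measure_eqI)
  fix X assume "X \<in> sets (distr past.lim (PiM J (\<lambda>_. borel)) (\<lambda>\<omega>. restrict \<omega> J))"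
  then have X: "X \<in> sets (PiM J (\<lambda>_. borel))" by simp
  have m: "(\<lambda>\<omega>. restrict \<omega> J) \<in> past.lim \<rightarrow>\<^sub>M PiM J (\<lambda>_. borel)"
    using measurable_restrict_subset[of J UNIV "\<lambda>_. borel"] by (simp add: measurable_cong_sets[OF past.sets_lim refl])
  have "emeasure (distr past.lim (PiM J (\<lambda>_. borel)) (\<lambda>\<omega>. restrict \<omega> J)) X = emeasure past.lim (prod_emb UNIV (\<lambda>_. borel) J X)"
    by (subst emeasure_distr[OF m X]) (simp add: prod_emb_def space_PiM)
  also have "\<dots> = emeasure (past_dist J) X"
    by (rule past.emeasure_lim_emb) (use assms X in auto)
  finally show "emeasure (distr past.lim (PiM J (\<lambda>_. borel)) (\<lambda>\<omega>. restrict \<omega> J)) X = emeasure (past_dist J) X" .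
qed (simp add: past_dist_def)

lemma past_restrict_measurable: "(\<lambda>\<omega>. restrict \<omega> J) \<in> past.lim \<rightarrow>\<^sub>M PiM J (\<lambda>_. borel)"
  using measurable_restrict_subset[of J UNIV "\<lambda>_. borel"] by (simp add: measurable_cong_sets[OF past.sets_lim refl])

lemma past_coord_measurable [measurable]: "(\<lambda>\<omega>. \<omega> j) \<in> borel_measurable past.lim"
  using measurable_component_singleton[of j UNIV "\<lambda>_. borel"] by (simp add: measurable_cong_sets[OF past.sets_lim refl])

lemma past_coord_distr: "distr past.lim borel (\<lambda>\<omega>. \<omega> j) = parry"
proof -
  have "distr past.lim borel (\<lambda>\<omega>. \<omega> j) = distr past.lim borel ((\<lambda>h. h j) \<circ> (\<lambda>\<omega>. restrict \<omega> {j}))"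
    by (simp add: o_def)
  also have "\<dots> = distr (distr past.lim (PiM {j} (\<lambda>_. borel)) (\<lambda>\<omega>. restrict \<omega> {j})) borel (\<lambda>h. h j)"
    by (rule distr_distr[symmetric]) (auto intro: past_restrict_measurable measurable_component_singleton)
  also have "\<dots> = distr (past_dist {j}) borel (\<lambda>h. h j)"
    by (subst past_restrict) simp_all
  also have "\<dots> = distr parry borel ((\<lambda>h. h j) \<circ> (\<lambda>y. \<lambda>i\<in>{j}. (f ^^ (j - i)) y))"
    by (subst past_dist_eq[of "{j}" j]) (auto intro!: distr_distr measurable_component_singleton)
  also have "\<dots> = distr parry borel (f ^^ 0)"
    by (intro distr_cong refl) simp
  also have "\<dots> = parry" by (rule parry_invariant_funpow)
  finally show ?thesis .
qed

lemma past_step: "AE \<omega> in past.lim. \<omega> j = f (\<omega> (Suc j))"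
proof -
  let ?J = "{j, Suc j}"
  have 1: "(\<lambda>h. h j) \<in> borel_measurable (PiM ?J (\<lambda>_. borel))"
    and "(\<lambda>h. h (Suc j)) \<in> borel_measurable (PiM ?J (\<lambda>_. borel))"
    by (rule measurable_component_singleton; simp)+
  from measurable_compose[OF this(2) bmap_measurable]
  have "(\<lambda>h. f (h (Suc j))) \<in> borel_measurable (PiM ?J (\<lambda>_. borel))" .
  with 1 have m: "Measurable.pred (PiM ?J (\<lambda>_. borel)) (\<lambda>h. h j = f (h (Suc j)))"
    unfolding pred_def by (rule borel_measurable_eq)
  have "AE h in past_dist ?J. h j = f (h (Suc j))"
    by (subst past_dist_eq[of ?J "Suc j"], simp, force, subst AE_distr_iff) (use m in auto)
  then have "AE h in distr past.lim (PiM ?J (\<lambda>_. borel)) (\<lambda>\<omega>. restrict \<omega> ?J). h j = f (h (Suc j))"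
    by (subst past_restrict) simp_all
  then show ?thesis
    by (subst (asm) AE_distr_iff[OF past_restrict_measurable]) (use m in auto)
qed

lemma past_range: "AE \<omega> in past.lim. \<omega> j \<in> {0..<1}"
proof -
  have "AE y in distr past.lim borel (\<lambda>\<omega>. \<omega> j). y \<in> {0..<1}"
    unfolding past_coord_distr by (rule AE_parry)
  then show ?thesis by (subst (asm) AE_distr_iff) auto
qed

lemma past_all: "AE \<omega> in past.lim. \<forall>j. \<omega> j = f (\<omega> (Suc j)) \<and> \<omega> j \<in> {0..<1}"
  using past_step past_range by (simp add: AE_all_countable AE_conj_iff)

lemma past_funpow:
  assumes "\<forall>j. \<omega> j = f (\<omega> (Suc j)) \<and> \<omega> j \<in> {0..<1}"
  shows "(f ^^ k) (\<omega> (j + k)) = \<omega> j"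
proof (induction k)
  case (Suc k)
  have "(f ^^ Suc k) (\<omega> (j + Suc k)) = (f ^^ k) (f (\<omega> (Suc (j + k))))"
    by (simp add: funpow_Suc_right del: funpow.simps)
  then show ?case using Suc assms by metis
qed simp

text \<open>If the digits at depths m + 1 to m + r are 1, the point at depth m + r begins with
  \<open>r\<close> ones, which has probability at most a constant times \<beta>^(-r). This keeps the
  x-coordinate read off from the past below 1.\<close>

lemma past_not_all_ones: "AE \<omega> in past.lim. \<not> (\<forall>i. bdig \<beta> (\<omega> (m + i)) = 1)"
proof -
  let ?A = "{\<omega> \<in> space past.lim. \<forall>i. bdig \<beta> (\<omega> (m + i)) = 1}"
  have A: "?A \<in> sets past.lim" by measurable
  have "past.P.prob ?A \<le> growth_const * (1 / \<beta>) ^ r" for r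
  proof -
    let ?Z = "{z \<in> {0..<1}. \<forall>l<r. bdig \<beta> ((f ^^ l) z) = 1}"
    have Z: "?Z \<in> sets borel" by measurable
    have "past.P.prob ?A \<le> past.P.prob {\<omega> \<in> space past.lim. \<omega> (m + r) \<in> ?Z}"
    proof (rule past.P.finite_measure_mono_AE)
      show "AE \<omega> in past.lim. \<omega> \<in> ?A \<longrightarrow> \<omega> \<in> {\<omega> \<in> space past.lim. \<omega> (m + r) \<in> ?Z}"
        using past_all
      proof eventually_elim
        case (elim \<omega>)
        have "bdig \<beta> ((f ^^ l) (\<omega> (m + r))) = 1" if "l < r" "\<omega> \<in> ?A" for l
        proof -
          have "m + (r - l) + l = m + r" using that(1) by simp
          then have "(f ^^ l) (\<omega> (m + r)) = \<omega> (m + (r - l))"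
            using past_funpow[OF elim, of l "m + (r - l)"] by (simp only:)
          then show ?thesis using that(2) by (simp only: mem_Collect_eq)
        qed
        moreover have "\<omega> (m + r) \<in> {0..<1}" using elim by blast
        ultimately show ?case by blast
      qed
      show "{\<omega> \<in> space past.lim. \<omega> (m + r) \<in> ?Z} \<in> sets past.lim" using Z by measurable
    qed
    also have "\<dots> = measure (distr past.lim borel (\<lambda>\<omega>. \<omega> (m + r))) ?Z"
      by (subst measure_distr[OF past_coord_measurable Z]) (rule arg_cong[where f = past.P.prob], blast)
    also have "\<dots> \<le> growth_const * measure lborel ?Z"
      unfolding past_coord_distr by (rule parry_le[OF Z]) auto
    also have "\<dots> \<le> growth_const * (1 / \<beta> ^ r)" using ones_cylinder_le growth_const_gt_1 by (intro mult_left_mono) auto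
    finally show ?thesis by (simp add: power_one_over)
  qed
  then have le: "\<exists>N. \<forall>r\<ge>N. past.P.prob ?A \<le> growth_const * (1 / \<beta>) ^ r" by blast
  have "(\<lambda>r. growth_const * (1 / \<beta>) ^ r) \<longlonglongrightarrow> growth_const * 0"
    using beta_gt_1 by (intro tendsto_mult tendsto_const LIMSEQ_power_zero) auto
  from LIMSEQ_le_const[OF this le] have "past.P.prob ?A = 0" using measure_nonneg[of past.lim ?A] by linarith
  then have "emeasure past.lim ?A = 0" by (simp only: past.P.emeasure_eq_measure ennreal_0)
  show ?thesis
    by (rule AE_I[OF _ \<open>emeasure past.lim ?A = 0\<close> A]) blast
qed

end

section \<open>Existence of the SRB measure\<close>

context baker_map
begin

text \<open>The word of ones has code 1 - lam^m, and a digit 0 at depth \<open>i\<close> costs (1 -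
  lam) * lam^i. The term lam^m leaves room for the contribution of the initial x.\<close>

lemma xcoord_le:
  assumes "i < m" "bdig \<beta> ((f ^^ (m - 1 - i)) y) = 0"
  shows "xcoord \<beta> lam m y \<le> 1 - lam ^ m - (1 - lam) * lam ^ i"
proof -
  let ?b = "\<lambda>j. real (bdig \<beta> ((f ^^ (m - 1 - j)) y))"
  have "(\<Sum>j<m. lam ^ j * ?b j) \<le> (\<Sum>j<m. lam ^ j - (if j = i then lam ^ i else 0))"
    using assms lam_pos by (intro sum_mono) (auto simp: bdig_def)
  also have "\<dots> = (\<Sum>j<m. lam ^ j) - lam ^ i" using assms(1) by (simp add: sum_subtractf)
  finally have "xcoord \<beta> lam m y \<le> (1 - lam) * ((\<Sum>j<m. lam ^ j) - lam ^ i)"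
    unfolding xcoord_def using lam_lt_1 by (intro mult_left_mono) auto
  also have "\<dots> = 1 - lam ^ m - (1 - lam) * lam ^ i"
    using one_diff_power_eq[of lam m] by (simp add: right_diff_distrib)
  finally show ?thesis .
qed

lemma xcoord_nonneg: "0 \<le> xcoord \<beta> lam m y"
  unfolding xcoord_def using lam_pos lam_lt_1 by (intro mult_nonneg_nonneg sum_nonneg) auto

text \<open>The exceptional set consists of the \<open>y\<close> whose last \<open>r\<close> digits before time \<open>m\<close> are all 1 or whose
  image is close to 1; off it the points stay in a compact part of the square, where \<open>g\<close> is
  uniformly continuous.\<close>
lemma forget_initial_x:
  fixes g :: "real \<times> real \<Rightarrow> real"
  assumes g: "continuous_on Qsq g" and e: "0 < e" and \<kappa>: "0 < \<kappa>"
  shows "\<exists>m E. E \<in> sets borel \<and> E \<subseteq> {0..<1} \<and> measure lborel E \<le> \<kappa> \<and>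
    (\<forall>x y. (x, y) \<in> Qsq \<and> y \<notin> E \<longrightarrow> \<bar>g ((T ^^ m) (x, y)) - g ((T ^^ m) (0, y))\<bar> \<le> e)"
proof -
  \<comment> \<open>Half of \<kappa> is allotted to each piece of the exceptional set; \<eta> \<le>
    1 / 2 keeps the strip below 1 inside the unit interval.\<close>
  define \<eta> where "\<eta> = min (\<kappa> / (2 * growth_const)) (1 / 2)"
  have \<eta>: "0 < \<eta>" "\<eta> \<le> 1 / 2" "growth_const * \<eta> \<le> \<kappa> / 2"
    using \<kappa> growth_const_gt_1 by (auto simp: \<eta>_def min_def field_simps)
  obtain r where r: "(1 / \<beta>) ^ r < \<eta>" using real_arch_pow_inv[of \<eta> "1 / \<beta>"] \<eta> beta_gt_1 by auto
  define R where "R = {0..1 - (1 - lam) * lam ^ r} \<times> {0..1 - \<eta>}"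
  have "0 < (1 - lam) * lam ^ r" using lam_pos lam_lt_1 by simp
  then have "R \<subseteq> Qsq" using \<eta> by (auto simp: R_def Qsq_def)
  then have "uniformly_continuous_on R g"
    using g continuous_on_subset by (intro compact_uniformly_continuous) (auto simp: R_def intro: compact_Times)
  then obtain d where d: "0 < d" "\<And>p q. p \<in> R \<Longrightarrow> q \<in> R \<Longrightarrow> dist q p < d \<Longrightarrow> dist (g q) (g p) < e"
    using e unfolding uniformly_continuous_on_def by metis
  obtain m1 where m1: "lam ^ m1 < d" using real_arch_pow_inv[of d lam] d lam_lt_1 by auto
  \<comment> \<open>\<open>m1 \<le> m\<close> makes the initial x negligible, and
    \<open>r \<le> m\<close> leaves room for \<open>r\<close> digits before time
    \<open>m\<close>.\<close>
  define m where "m = max m1 r"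
  have "lam ^ m \<le> lam ^ m1" using lam_pos lam_lt_1 by (intro power_decreasing) (auto simp: m_def)
  then have md: "lam ^ m < d" using m1 by simp
  have mr: "r \<le> m" by (simp add: m_def)
  let ?Z = "{z \<in> {0..<1}. \<forall>l<r. bdig \<beta> ((f ^^ l) z) = 1}"
  define E where "E = ({0..<1} \<inter> (f ^^ m) -` {1 - \<eta><..<1}) \<union> ({0..<1} \<inter> (f ^^ (m - r)) -` ?Z)"
  have Z: "?Z \<in> sets borel" by measurable
  have E: "E \<in> sets borel" "E \<subseteq> {0..<1}" using Z by (auto simp: E_def intro!: measurable_sets_borel)
  have "measure lborel E \<le> measure lborel ({0..<1} \<inter> (f ^^ m) -` {1 - \<eta><..<1}) + measure lborel ({0..<1} \<inter> (f ^^ (m - r)) -` ?Z)"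
    unfolding E_def using Z by (intro measure_Un_le) (auto intro!: measurable_sets_borel)
  also have "\<dots> \<le> growth_const * measure lborel {1 - \<eta><..<1} + growth_const * measure lborel ?Z"
    using \<eta> Z by (intro add_mono preimage_measure_le) auto
  also have "\<dots> \<le> growth_const * \<eta> + growth_const * \<eta>"
  proof (intro add_mono mult_left_mono)
    show "measure lborel ?Z \<le> \<eta>" using ones_cylinder_le[of r] r by (simp add: power_one_over)
  qed (use \<eta> growth_const_gt_1 in auto)
  also have "\<dots> \<le> \<kappa>" using \<eta>(3) by linarith
  finally have "measure lborel E \<le> \<kappa>" .
  moreover have "\<bar>g ((T ^^ m) (x, y)) - g ((T ^^ m) (0, y))\<bar> \<le> e" if xy: "(x, y) \<in> Qsq" "y \<notin> E" for x y
  proof -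
    have x: "0 \<le> x" "x < 1" and y: "y \<in> {0..<1}" using xy by (auto simp: Qsq_def)
    have fm: "(f ^^ m) y \<in> {0..<1}" "(f ^^ (m - r)) y \<in> {0..<1}" by (rule f_funpow_range[OF y])+
    then have 1: "(f ^^ m) y \<le> 1 - \<eta>" using xy(2) y by (auto simp: E_def)
    have "\<not> (\<forall>l<r. bdig \<beta> ((f ^^ l) ((f ^^ (m - r)) y)) = 1)" using xy(2) y fm(2) by (simp add: E_def)
    then obtain l where l: "l < r" "bdig \<beta> ((f ^^ l) ((f ^^ (m - r)) y)) \<noteq> 1" by blast
    define i where "i = r - 1 - l"
    have "m - 1 - i = l + (m - r)" using l mr by (simp add: i_def)
    then have "bdig \<beta> ((f ^^ (m - 1 - i)) y) = 0"
      using l(2) by (simp add: funpow_add bdig_def split: if_splits)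
    moreover have i: "i < m" "i \<le> r" using l mr by (simp_all add: i_def)
    ultimately have "xcoord \<beta> lam m y \<le> 1 - lam ^ m - (1 - lam) * lam ^ i" by (intro xcoord_le)
    moreover have "(1 - lam) * lam ^ r \<le> (1 - lam) * lam ^ i"
      using i lam_pos lam_lt_1 by (intro mult_left_mono power_decreasing) auto
    ultimately have X: "xcoord \<beta> lam m y \<le> 1 - lam ^ m - (1 - lam) * lam ^ r" by linarith
    have lx: "0 \<le> lam ^ m * x" "lam ^ m * x \<le> lam ^ m * 1" using x lam_pos by (auto intro!: mult_left_mono)
    have "(T ^^ m) (x, y) \<in> R" "(T ^^ m) (0, y) \<in> R"
      using X lx xcoord_nonneg[of m y] 1 fm(1) by (auto simp: Tmap_funpow R_def)
    moreover have "dist ((T ^^ m) (x, y)) ((T ^^ m) (0, y)) < d"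
      using lx md by (simp add: Tmap_funpow dist_Pair_Pair dist_real_def)
    ultimately have "dist (g ((T ^^ m) (x, y))) (g ((T ^^ m) (0, y))) < e" by (intro d(2))
    then show ?thesis by (simp add: dist_real_def)
  qed
  ultimately show ?thesis using E by blast
qed

text \<open>A test function is controlled only on the square; this version is Borel measurable on
  the plane.\<close>

definition extend_by_zero :: "(real \<times> real \<Rightarrow> real) \<Rightarrow> real \<times> real \<Rightarrow> real" where
  "extend_by_zero g p = indicator Qsq p * g p"

text \<open>The test function after \<open>m\<close> steps from the edge x = 0: a function of y
  alone, to which \<open>cesaro_parry\<close> applies.\<close>

definition fiber :: "(real \<times> real \<Rightarrow> real) \<Rightarrow> nat \<Rightarrow> real \<Rightarrow> real" where
  "fiber g m y = indicator {0..<1} y * extend_by_zero g ((T ^^ m) (0, y))"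

lemma extend_by_zero_measurable:
  assumes "continuous_on Qsq g"
  shows "extend_by_zero g \<in> borel_measurable borel"
  using borel_measurable_continuous_on_indicator[OF _ assms] unfolding extend_by_zero_def[abs_def] by simp

lemma fiber_measurable:
  assumes "continuous_on Qsq g"
  shows "fiber g m \<in> borel_measurable borel"
proof -
  note [measurable] = extend_by_zero_measurable[OF assms]
  have [measurable]: "(\<lambda>y. (T ^^ m) (0, y)) \<in> borel_measurable borel"
    unfolding Tmap_funpow borel_prod[symmetric] by measurable
  show ?thesis unfolding fiber_def[abs_def] by measurable
qed

lemma extend_by_zero_bound:
  assumes "\<And>p. p \<in> Qsq \<Longrightarrow> \<bar>g p\<bar> \<le> M" "0 \<le> M"
  shows "\<bar>extend_by_zero g p\<bar> \<le> M" "\<bar>fiber g m y\<bar> \<le> M"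
  using assms by (auto simp: extend_by_zero_def fiber_def indicator_def)

text \<open>One \<open>m\<close> must serve many measures at once: the images of Lebesgue measure
  under all iterates, and the law of the past at depth \<open>m\<close>. Their common feature is the
  bound on the second marginal, which makes the exceptional set of \<open>forget_initial_x\<close>
  small for each of them.\<close>

lemma forget_initial_x_integral:
  fixes g :: "real \<times> real \<Rightarrow> real"
  assumes g: "continuous_on Qsq g" "\<And>p. p \<in> Qsq \<Longrightarrow> \<bar>g p\<bar> \<le> M" and e: "0 < e"
  shows "\<exists>m. \<forall>N. prob_space N \<and> sets N = sets borel \<and> (AE p in N. p \<in> Qsq) \<and>
      (\<forall>Z\<in>sets borel. Z \<subseteq> {0..<1} \<longrightarrow> measure N (UNIV \<times> Z) \<le> growth_const * measure lborel Z) \<longrightarrow>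
      \<bar>(\<integral>p. extend_by_zero g ((T ^^ m) p) \<partial>N) - (\<integral>p. fiber g m (snd p) \<partial>N)\<bar> \<le> e"
proof -
  have M: "0 \<le> M" using g(2)[of "(0, 0)"] by (simp add: Qsq_def)
  have bd: "\<bar>extend_by_zero g p\<bar> \<le> M" "\<bar>fiber g m y\<bar> \<le> M" for p m y
    by (rule extend_by_zero_bound; use g(2) M in blast)+
  note [measurable] = extend_by_zero_measurable[OF g(1)] fiber_measurable[OF g(1)]
  \<comment> \<open>On the exceptional set the integrands differ by at most 2 * M; the added 1 makes
    \<open>D\<close> positive even for M = 0.\<close>
  define D where "D = (2 * M + 1) * growth_const"
  have D0: "0 < D" unfolding D_def using M growth_const_gt_1 by (intro mult_pos_pos) auto
  define \<kappa> where "\<kappa> = e / 2 / D"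
  have \<kappa>0: "0 < \<kappa>" using e D0 by (simp add: \<kappa>_def)
  have "2 * M * (growth_const * \<kappa>) \<le> (2 * M + 1) * (growth_const * \<kappa>)"
    using \<kappa>0 growth_const_gt_1 by (intro mult_right_mono) auto
  also have "\<dots> = D * \<kappa>" by (simp add: D_def)
  also have "\<dots> = e / 2" using D0 by (simp add: \<kappa>_def)
  finally have \<kappa>: "2 * M * (growth_const * \<kappa>) \<le> e / 2" .
  have "0 < e / 2" using e by simp
  from forget_initial_x[OF g(1) this \<kappa>0] obtain m E where E: "E \<in> sets borel" "E \<subseteq> {0..<1}" "measure lborel E \<le> \<kappa>"
    and close: "\<And>x y. (x, y) \<in> Qsq \<Longrightarrow> y \<notin> E \<Longrightarrow> \<bar>g ((T ^^ m) (x, y)) - g ((T ^^ m) (0, y))\<bar> \<le> e / 2"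
    by (elim exE conjE) blast
  show ?thesis
  proof (intro exI[of _ m] allI impI, elim conjE)
    fix N :: "(real \<times> real) measure"
    assume N: "prob_space N" and sets [measurable_cong]: "sets N = sets borel" and AE_Q: "AE p in N. p \<in> Qsq"
      and marg: "\<forall>Z\<in>sets borel. Z \<subseteq> {0..<1} \<longrightarrow> measure N (UNIV \<times> Z) \<le> growth_const * measure lborel Z"
    interpret prob_space N by (rule N)
    have [measurable]: "snd \<in> borel_measurable (borel :: (real \<times> real) measure)"
      by (simp add: borel_prod[symmetric])
    have UE [measurable]: "(UNIV :: real set) \<times> E \<in> sets borel" using E(1) by (intro borel_Times) auto
    have int1: "integrable N (\<lambda>p. extend_by_zero g ((T ^^ m) p))"
      by (rule integrable_const_bound[of _ M]) (auto simp: bd)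
    have int2: "integrable N (\<lambda>p. fiber g m (snd p))"
      by (rule integrable_const_bound[of _ M]) (auto simp: bd)
    have ind: "integrable N (indicat_real (UNIV \<times> E))"
      by (intro integrable_real_indicator) (auto simp: emeasure_eq_measure sets)
    then have int3: "integrable N (\<lambda>p. e / 2 + 2 * M * indicator (UNIV \<times> E) p)" by simp
    have "\<bar>(\<integral>p. extend_by_zero g ((T ^^ m) p) \<partial>N) - (\<integral>p. fiber g m (snd p) \<partial>N)\<bar> =
        \<bar>\<integral>p. extend_by_zero g ((T ^^ m) p) - fiber g m (snd p) \<partial>N\<bar>"
      using int1 int2 by simp
    also have "\<dots> \<le> (\<integral>p. \<bar>extend_by_zero g ((T ^^ m) p) - fiber g m (snd p)\<bar> \<partial>N)"
      by (rule integral_abs_bound)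
    also have "\<dots> \<le> (\<integral>p. e / 2 + 2 * M * indicator (UNIV \<times> E) p \<partial>N)"
    proof (rule integral_mono_AE)
      show "integrable N (\<lambda>p. \<bar>extend_by_zero g ((T ^^ m) p) - fiber g m (snd p)\<bar>)" using int1 int2 by simp
      show "AE p in N. \<bar>extend_by_zero g ((T ^^ m) p) - fiber g m (snd p)\<bar> \<le> e / 2 + 2 * M * indicator (UNIV \<times> E) p"
        using AE_Q
      proof eventually_elim
        case (elim p)
        obtain x y where p: "p = (x, y)" by (cases p)
        show ?case
        proof (cases "y \<in> E")
          case True
          have "\<bar>extend_by_zero g ((T ^^ m) p) - fiber g m (snd p)\<bar> \<le> M + M"
            using bd(1)[of "(T ^^ m) p"] bd(2)[of m "snd p"] by linarith
          then show ?thesis using True e by (simp add: p)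
        next
          case False
          have q: "(x, y) \<in> Qsq" "(0, y) \<in> Qsq" "y \<in> {0..<1}" using elim by (auto simp: p Qsq_def)
          have "extend_by_zero g ((T ^^ m) p) = g ((T ^^ m) (x, y))" using T_funpow_Qsq[OF q(1), of m] by (simp add: p extend_by_zero_def)
          moreover have "fiber g m (snd p) = g ((T ^^ m) (0, y))"
            using T_funpow_Qsq[OF q(2), of m] q(3) by (simp add: p extend_by_zero_def fiber_def)
          ultimately show ?thesis using close[OF q(1) False] False by (simp add: p)
        qed
      qed
    qed (rule int3)
    also have "\<dots> = e / 2 + 2 * M * measure N (UNIV \<times> E)"
      using ind by (subst Bochner_Integration.integral_add) (auto simp: prob_space sets)
    also have "\<dots> \<le> e / 2 + 2 * M * (growth_const * \<kappa>)"
    proof (intro add_left_mono mult_left_mono)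
      have "measure N (UNIV \<times> E) \<le> growth_const * measure lborel E" using marg E by blast
      also have "\<dots> \<le> growth_const * \<kappa>" using E(3) growth_const_gt_1 by (intro mult_left_mono) auto
      finally show "measure N (UNIV \<times> E) \<le> growth_const * \<kappa>" .
    qed (use M in auto)
    also have "\<dots> \<le> e" using \<kappa> by simp
    finally show "\<bar>(\<integral>p. extend_by_zero g ((T ^^ m) p) \<partial>N) - (\<integral>p. fiber g m (snd p) \<partial>N)\<bar> \<le> e" .
  qed
qed

definition nu :: "(real \<times> real) measure" where
  "nu = density lborel (indicator Qsq)"

lemma sets_nu [simp, measurable_cong]: "sets nu = sets borel" and space_nu [simp]: "space nu = UNIV"
  by (simp_all add: nu_def)

lemma emeasure_nu: "A \<in> sets borel \<Longrightarrow> emeasure nu A = emeasure lborel (Qsq \<inter> A)"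
  unfolding nu_def by (subst emeasure_density) (auto simp: nn_integral_set_ennreal indicator_inter_arith[symmetric] simp flip: nn_integral_indicator)

lemma prob_space_nu: "prob_space nu"
  by standard (simp add: emeasure_nu emeasure_Qsq)

lemma AE_nu: "AE p in nu. p \<in> Qsq"
  unfolding nu_def by (subst AE_density) (auto simp: indicator_def)

lemma integral_nu:
  assumes "h \<in> borel_measurable borel"
  shows "(\<integral>p. h p \<partial>nu) = (\<integral>p. indicator Qsq p * (h p :: real) \<partial>lborel)"
proof -
  have "nu = density lborel (\<lambda>p. ennreal (indicator Qsq p))"
    unfolding nu_def by (intro density_cong) (auto simp: indicator_def)
  then show ?thesis by (subst \<open>nu = _\<close>, subst integral_density) (use assms in auto)
qed

lemma distr_nu_snd: "distr nu borel snd = density lborel (indicator {0..<1})"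
proof (rule measure_eqI)
  have m: "snd \<in> borel_measurable (borel :: (real \<times> real) measure)"
    by (simp add: borel_prod[symmetric])
  then have m': "snd \<in> nu \<rightarrow>\<^sub>M borel" by (simp add: measurable_cong_sets[OF sets_nu refl])
  fix A :: "real set" assume "A \<in> sets (distr nu borel snd)"
  then have A: "A \<in> sets borel" by simp
  have "emeasure (distr nu borel snd) A = emeasure lborel (Qsq \<inter> snd -` A)"
    using measurable_sets[OF m A] by (subst emeasure_distr[OF m' A]) (simp add: emeasure_nu)
  also have "Qsq \<inter> snd -` A = {0..<1} \<times> ({0..<1} \<inter> A)" by (auto simp: Qsq_def)
  also have "emeasure lborel \<dots> = emeasure lborel ({0..<1} \<inter> A)" using A by (intro strip_emeasure) auto
  also have "\<dots> = emeasure (density lborel (indicator {0..<1})) A"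
    using A by (subst emeasure_density) (auto simp: indicator_inter_arith[symmetric] simp flip: nn_integral_indicator)
  finally show "emeasure (distr nu borel snd) A = emeasure (density lborel (indicator {0..<1})) A" .
qed simp

lemma integral_nu_snd:
  assumes [measurable]: "q \<in> borel_measurable borel"
  shows "(\<integral>p. q (snd p) \<partial>nu) = (\<integral>y. indicator {0..<1} y * (q y :: real) \<partial>lborel)"
proof -
  have m: "snd \<in> nu \<rightarrow>\<^sub>M borel"
    by (simp add: measurable_cong_sets[OF sets_nu refl] borel_prod[symmetric])
  have "(\<integral>p. q (snd p) \<partial>nu) = (\<integral>y. q y \<partial>distr nu borel snd)"
    using m by (subst integral_distr) auto
  also have "density lborel (indicator {0..<1}) = density lborel (\<lambda>y. ennreal (indicator {0..<1::real} y))"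
    by (intro density_cong) (auto simp: indicator_def)
  then have "(\<integral>y. q y \<partial>distr nu borel snd) = (\<integral>y. indicator {0..<1} y * q y \<partial>lborel)"
    by (simp add: distr_nu_snd integral_density)
  finally show ?thesis .
qed

definition past_x :: "nat \<Rightarrow> (nat \<Rightarrow> real) \<Rightarrow> real" where
  "past_x m \<omega> = (1 - lam) * (\<Sum>i. lam ^ i * real (bdig \<beta> (\<omega> (Suc m + i))))"

text \<open>The depth \<open>m\<close> is a parameter so that integrals against
  \<open>past_law 0\<close> can be written with \<open>m\<close> steps of the map, which carry the
  point at depth \<open>m\<close> to the point at depth 0.\<close>

definition past_law :: "nat \<Rightarrow> (real \<times> real) measure" where
  "past_law m = distr past.lim borel (\<lambda>\<omega>. (past_x m \<omega>, \<omega> m))"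

lemma past_x_summable: "summable (\<lambda>i. lam ^ i * real (bdig \<beta> (\<omega> (k + i))))"
  by (rule summable_comparison_test'[OF summable_geometric[of lam]])
     (use lam_pos lam_lt_1 in \<open>auto simp: bdig_def\<close>)

lemma past_x_measurable [measurable]: "past_x m \<in> borel_measurable past.lim"
proof -
  have b: "(\<lambda>y. real (bdig \<beta> y)) \<in> borel_measurable borel"
    by (rule measurable_compose[OF bdig_measurable]) simp
  have c: "(\<lambda>\<omega>. real (bdig \<beta> (\<omega> k))) \<in> borel_measurable past.lim" for k
    by (rule measurable_compose[OF past_coord_measurable b])
  show ?thesis unfolding past_x_def[abs_def]
    by (intro borel_measurable_times borel_measurable_const borel_measurable_suminf c)
qed

lemma past_pair_measurable [measurable]: "(\<lambda>\<omega>. (past_x m \<omega>, \<omega> m)) \<in> borel_measurable past.lim"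
  unfolding borel_prod[symmetric] by measurable

lemma past_x_Suc: "past_x m \<omega> = lam * past_x (Suc m) \<omega> + (1 - lam) * real (bdig \<beta> (\<omega> (Suc m)))"
proof -
  have "(\<Sum>i. lam ^ i * real (bdig \<beta> (\<omega> (Suc m + i)))) =
      real (bdig \<beta> (\<omega> (Suc m))) + (\<Sum>i. lam * (lam ^ i * real (bdig \<beta> (\<omega> (Suc (Suc m) + i)))))"
    using suminf_split_head[OF past_x_summable[of \<omega> "Suc m"]] by (simp add: mult.assoc)
  also have "(\<Sum>i. lam * (lam ^ i * real (bdig \<beta> (\<omega> (Suc (Suc m) + i))))) =
      lam * (\<Sum>i. lam ^ i * real (bdig \<beta> (\<omega> (Suc (Suc m) + i))))"
    by (rule suminf_mult[OF past_x_summable])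
  finally show ?thesis by (simp add: past_x_def algebra_simps)
qed

lemma past_x_nonneg: "0 \<le> past_x m \<omega>"
  unfolding past_x_def using lam_pos lam_lt_1
  by (intro mult_nonneg_nonneg suminf_nonneg past_x_summable) auto

lemma past_x_le_1: "past_x m \<omega> \<le> 1"
proof -
  have "(\<Sum>i. lam ^ i * real (bdig \<beta> (\<omega> (Suc m + i)))) \<le> (\<Sum>i. lam ^ i)"
    using lam_pos lam_lt_1 by (intro suminf_le past_x_summable summable_geometric) (auto simp: bdig_def)
  also have "\<dots> = 1 / (1 - lam)" using lam_pos lam_lt_1 by (intro suminf_geometric) auto
  finally show ?thesis using lam_lt_1 by (simp add: past_x_def field_simps)
qed

text \<open>Induction on the place of a digit other than 1: there the contraction leaves at most
  lam, and a strict bound persists through the more recent digits.\<close>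

lemma past_x_less_1:
  assumes "\<not> (\<forall>i. bdig \<beta> (\<omega> (Suc m + i)) = 1)"
  shows "past_x m \<omega> < 1"
proof -
  obtain i where "bdig \<beta> (\<omega> (Suc m + i)) \<noteq> 1" using assms by blast
  then show ?thesis
  proof (induction i arbitrary: m)
    case 0
    then have "past_x m \<omega> = lam * past_x (Suc m) \<omega>"
      using past_x_Suc[of m \<omega>] by (simp add: bdig_def split: if_splits)
    also have "\<dots> \<le> lam * 1" using past_x_le_1 lam_pos by (intro mult_left_mono) auto
    finally show ?case using lam_lt_1 by simp
  next
    case (Suc i)
    have "past_x (Suc m) \<omega> < 1" using Suc.prems by (intro Suc.IH) simp
    then have "lam * past_x (Suc m) \<omega> < lam" using lam_pos by simp
    moreover have "(1 - lam) * real (bdig \<beta> (\<omega> (Suc m))) \<le> 1 - lam"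
      using lam_lt_1 by (simp add: bdig_def)
    ultimately show ?case using past_x_Suc[of m \<omega>] by linarith
  qed
qed

lemma past_pair_Qsq: "AE \<omega> in past.lim. (past_x m \<omega>, \<omega> m) \<in> Qsq"
  using past_not_all_ones[of "Suc m"] past_range[of m]
proof eventually_elim
  case (elim \<omega>)
  then show ?case using past_x_less_1[OF elim(1)] past_x_nonneg[of m \<omega>] by (simp add: Qsq_def)
qed

lemma T_funpow_past:
  assumes "\<forall>j. \<omega> j = f (\<omega> (Suc j)) \<and> \<omega> j \<in> {0..<1}"
  shows "(T ^^ m) (past_x m \<omega>, \<omega> m) = (past_x 0 \<omega>, \<omega> 0)"
proof (induction m)
  case (Suc m)
  have "T (past_x (Suc m) \<omega>, \<omega> (Suc m)) = (past_x m \<omega>, f (\<omega> (Suc m)))"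
    using past_x_Suc[of m \<omega>] by (simp add: Tmap_def bmap_def bdig_def algebra_simps split: if_splits)
  also have "\<dots> = (past_x m \<omega>, \<omega> m)" using assms by metis
  finally show ?case using Suc by (simp add: funpow_Suc_right del: funpow.simps)
qed simp

lemma sets_past_law [simp, measurable_cong]: "sets (past_law m) = sets borel"
  by (simp add: past_law_def)

lemma prob_space_past_law: "prob_space (past_law m)"
  unfolding past_law_def by (rule past.P.prob_space_distr) measurable

lemma AE_past_law: "AE p in past_law m. p \<in> Qsq"
  unfolding past_law_def by (subst AE_distr_iff) (use past_pair_Qsq in auto)

lemma past_law_marginal:
  assumes "Z \<in> sets borel" "Z \<subseteq> {0..<1}"
  shows "measure (past_law m) (UNIV \<times> Z) \<le> growth_const * measure lborel Z"
proof -
  have "measure (past_law m) (UNIV \<times> Z) = measure past.lim ((\<lambda>\<omega>. \<omega> m) -` Z \<inter> space past.lim)"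
    unfolding past_law_def using assms(1)
    by (subst measure_distr) (auto intro!: borel_Times arg_cong[of _ _ "measure past.lim"])
  also have "\<dots> = measure (distr past.lim borel (\<lambda>\<omega>. \<omega> m)) Z"
    using assms(1) by (subst measure_distr) auto
  finally show ?thesis using parry_le[OF assms] by (simp add: past_coord_distr)
qed

lemma past_law_0_integral:
  assumes [measurable]: "h \<in> borel_measurable borel"
  shows "(\<integral>p. h p \<partial>past_law 0) = (\<integral>p. (h ((T ^^ m) p) :: real) \<partial>past_law m)"
proof -
  have "(\<integral>p. h p \<partial>past_law 0) = (\<integral>\<omega>. h (past_x 0 \<omega>, \<omega> 0) \<partial>past.lim)"
    unfolding past_law_def by (rule integral_distr) auto
  also have "\<dots> = (\<integral>\<omega>. h ((T ^^ m) (past_x m \<omega>, \<omega> m)) \<partial>past.lim)"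
  proof (rule integral_cong_AE)
    show "AE \<omega> in past.lim. h (past_x 0 \<omega>, \<omega> 0) = h ((T ^^ m) (past_x m \<omega>, \<omega> m))"
      using past_all
    proof eventually_elim
      case (elim \<omega>)
      show ?case unfolding T_funpow_past[OF elim] ..
    qed
    show "(\<lambda>\<omega>. h (past_x 0 \<omega>, \<omega> 0)) \<in> borel_measurable past.lim"
      using measurable_compose[OF past_pair_measurable assms] .
    have "(\<lambda>p. h ((T ^^ m) p)) \<in> borel_measurable borel" by measurable
    from measurable_compose[OF past_pair_measurable this]
    show "(\<lambda>\<omega>. h ((T ^^ m) (past_x m \<omega>, \<omega> m))) \<in> borel_measurable past.lim" .
  qed
  also have "\<dots> = (\<integral>p. h ((T ^^ m) p) \<partial>past_law m)"
    unfolding past_law_def by (rule integral_distr[symmetric]) auto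
  finally show ?thesis .
qed

lemma past_law_integral_snd:
  assumes [measurable]: "q \<in> borel_measurable borel"
  shows "(\<integral>p. (q (snd p) :: real) \<partial>past_law m) = (\<integral>y. q y \<partial>parry)"
proof -
  have m: "(\<lambda>p. q (snd p)) \<in> borel_measurable (borel :: (real \<times> real) measure)"
    unfolding borel_prod[symmetric] by measurable
  have "(\<integral>p. q (snd p) \<partial>past_law m) = (\<integral>\<omega>. q (\<omega> m) \<partial>past.lim)"
    unfolding past_law_def using m by (subst integral_distr) auto
  also have "\<dots> = (\<integral>y. q y \<partial>distr past.lim borel (\<lambda>\<omega>. \<omega> m))"
    by (rule integral_distr[symmetric]) auto
  finally show ?thesis by (simp add: past_coord_distr)
qed

lemma push_law_marginal:
  assumes Z: "Z \<in> sets borel" "Z \<subseteq> {0..<1}"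
  shows "measure (distr nu borel (T ^^ k)) (UNIV \<times> Z) \<le> growth_const * measure lborel Z"
proof -
  have m: "T ^^ k \<in> nu \<rightarrow>\<^sub>M borel" by simp
  have UZ: "UNIV \<times> Z \<in> sets (borel :: (real \<times> real) measure)" using Z by (intro borel_Times) auto
  have m': "(T ^^ k) -` (UNIV \<times> Z) \<in> sets borel"
    using measurable_sets[OF Tmap_funpow_measurable UZ] by simp
  have "emeasure (distr nu borel (T ^^ k)) (UNIV \<times> Z) = emeasure lborel (Qsq \<inter> (T ^^ k) -` (UNIV \<times> Z))"
    using m' by (simp add: emeasure_distr[OF m UZ] emeasure_nu)
  then have "measure (distr nu borel (T ^^ k)) (UNIV \<times> Z) = measure lborel (Qsq \<inter> (T ^^ k) -` (UNIV \<times> Z))"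
    by (simp only: measure_def)
  also have "\<dots> \<le> growth_const * measure lborel Z"
    by (rule preimage_strip_measure_le[OF Z _ UZ, of _ k]) (auto simp: Tmap_funpow)
  finally show ?thesis .
qed

text \<open>Replacing the test function after \<open>m\<close> steps by its \<open>fiber\<close>
  costs at most \<open>e\<close>, both for Lebesgue measure pushed \<open>k\<close> steps and for
  the past law at depth \<open>m\<close>. Between the two stand the orbit integrals of
  \<open>fiber\<close>, whose averages converge to its Parry integral.\<close>

lemma SRB_exists: "is_SRB \<beta> lam (past_law 0)"
  unfolding is_SRB_def
proof (intro conjI allI impI)
  interpret L: prob_space "past_law 0" by (rule prob_space_past_law)
  show "finite_measure (past_law 0)" by (rule L.finite_measure)
  show "emeasure (past_law 0) (- Qsq) = 0"
    using AE_past_law[of 0] by (subst (asm) AE_iff_measurable[of "- Qsq"]) (auto simp: sets_eq_imp_space_eq[OF sets_past_law])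
  fix g :: "real \<times> real \<Rightarrow> real" assume "continuous_on Qsq g \<and> bounded (g ` Qsq)"
  then have g: "continuous_on Qsq g" and "bounded (g ` Qsq)" by auto
  then obtain M where M: "\<And>p. p \<in> Qsq \<Longrightarrow> \<bar>g p\<bar> \<le> M" by (auto simp: bounded_iff)
  have M0: "0 \<le> M" using M[of "(0, 0)"] by (simp add: Qsq_def)
  note [measurable] = extend_by_zero_measurable[OF g] fiber_measurable[OF g]
  have "cesaro (push_integral g) \<longlonglongrightarrow> (\<integral>p. extend_by_zero g p \<partial>past_law 0)"
  proof (rule cesaro_approx)
    show "\<bar>push_integral g k\<bar> \<le> M" for k by (rule push_integral_bound[OF g M])
    fix e :: real assume e: "0 < e"
    have "\<exists>m. \<forall>N. prob_space N \<and> sets N = sets borel \<and> (AE p in N. p \<in> Qsq) \<and>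
        (\<forall>Z\<in>sets borel. Z \<subseteq> {0..<1} \<longrightarrow> measure N (UNIV \<times> Z) \<le> growth_const * measure lborel Z) \<longrightarrow>
        \<bar>(\<integral>p. extend_by_zero g ((T ^^ m) p) \<partial>N) - (\<integral>p. fiber g m (snd p) \<partial>N)\<bar> \<le> e"
      by (rule forget_initial_x_integral[OF g _ e]) (rule M)
    then obtain m where m0: "\<forall>N. prob_space N \<and> sets N = sets borel \<and> (AE p in N. p \<in> Qsq) \<and>
        (\<forall>Z\<in>sets borel. Z \<subseteq> {0..<1} \<longrightarrow> measure N (UNIV \<times> Z) \<le> growth_const * measure lborel Z) \<longrightarrow>
        \<bar>(\<integral>p. extend_by_zero g ((T ^^ m) p) \<partial>N) - (\<integral>p. fiber g m (snd p) \<partial>N)\<bar> \<le> e"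
      by (elim exE)
    have m: "\<bar>(\<integral>p. extend_by_zero g ((T ^^ m) p) \<partial>N) - (\<integral>p. fiber g m (snd p) \<partial>N)\<bar> \<le> e"
      if "prob_space N" "sets N = sets borel" "AE p in N. p \<in> Qsq"
        "\<And>Z. Z \<in> sets borel \<Longrightarrow> Z \<subseteq> {0..<1} \<Longrightarrow> measure N (UNIV \<times> Z) \<le> growth_const * measure lborel Z" for N
      by (rule m0[THEN spec, THEN mp]) (intro conjI ballI impI that)
    have fib: "(\<lambda>y. fiber g m y) \<in> borel_measurable borel" by measurable
    have 1: "\<bar>push_integral g (k + m) - orbit_integral \<beta> (fiber g m) k 1\<bar> \<le> e" for k
    proof -
      let ?N = "distr nu borel (T ^^ k)"
      have Tk: "T ^^ k \<in> nu \<rightarrow>\<^sub>M borel" by simp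
      have "\<bar>(\<integral>p. extend_by_zero g ((T ^^ m) p) \<partial>?N) - (\<integral>p. fiber g m (snd p) \<partial>?N)\<bar> \<le> e"
      proof (rule m)
        show "prob_space ?N" by (rule prob_space.prob_space_distr[OF prob_space_nu Tk])
        show "AE p in ?N. p \<in> Qsq"
          using AE_nu T_funpow_Qsq by (subst AE_distr_iff[OF Tk]) (auto elim!: eventually_mono)
      qed (auto intro: push_law_marginal)
      moreover have "(\<integral>p. extend_by_zero g ((T ^^ m) p) \<partial>?N) = push_integral g (k + m)"
      proof -
        have h: "(\<lambda>p. extend_by_zero g ((T ^^ (k + m)) p)) \<in> borel_measurable borel" by measurable
        have "(\<integral>p. extend_by_zero g ((T ^^ m) p) \<partial>?N) = (\<integral>p. extend_by_zero g ((T ^^ m) ((T ^^ k) p)) \<partial>nu)"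
          by (rule integral_distr[OF Tk]) measurable
        also have "\<dots> = (\<integral>p. extend_by_zero g ((T ^^ (k + m)) p) \<partial>nu)"
          by (simp add: funpow_add add.commute[of k m])
        also have "\<dots> = (\<integral>p. indicator Qsq p * extend_by_zero g ((T ^^ (k + m)) p) \<partial>lborel)"
          by (rule integral_nu[OF h])
        also have "\<dots> = push_integral g (k + m)"
          unfolding push_integral_def set_lebesgue_integral_def real_scaleR_def
          using T_funpow_Qsq[of _ "k + m"]
          by (intro Bochner_Integration.integral_cong refl) (simp add: extend_by_zero_def indicator_def)
        finally show ?thesis .
      qed
      moreover have "(\<integral>p. fiber g m (snd p) \<partial>?N) = orbit_integral \<beta> (fiber g m) k 1"
      proof -
        have s: "(\<lambda>p. fiber g m (snd p)) \<in> borel_measurable (borel :: (real \<times> real) measure)"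
          unfolding borel_prod[symmetric] by measurable
        have h: "(\<lambda>y. fiber g m ((f ^^ k) y)) \<in> borel_measurable borel" by measurable
        have "(\<integral>p. fiber g m (snd p) \<partial>?N) = (\<integral>p. fiber g m (snd ((T ^^ k) p)) \<partial>nu)"
          by (rule integral_distr[OF Tk s])
        also have "\<dots> = (\<integral>p. fiber g m ((f ^^ k) (snd p)) \<partial>nu)"
          by (intro Bochner_Integration.integral_cong refl) (auto simp: Tmap_funpow)
        also have "\<dots> = orbit_integral \<beta> (fiber g m) k 1"
          unfolding orbit_integral_def by (rule integral_nu_snd[OF h])
        finally show ?thesis .
      qed
      ultimately show ?thesis by simp
    qed
    have 2: "cesaro (\<lambda>k. orbit_integral \<beta> (fiber g m) k 1) \<longlonglongrightarrow> (\<integral>y. fiber g m y \<partial>parry)"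
      by (rule cesaro_parry[OF fib, of M]) (rule extend_by_zero_bound(2)[OF M M0])
    have 3: "\<bar>(\<integral>p. extend_by_zero g p \<partial>past_law 0) - (\<integral>y. fiber g m y \<partial>parry)\<bar> \<le> e"
      using m[OF prob_space_past_law sets_past_law AE_past_law past_law_marginal, of m]
      unfolding past_law_integral_snd[OF fib] past_law_0_integral[OF extend_by_zero_measurable[OF g], of m] .
    show "\<exists>m b L'. (\<forall>k. \<bar>push_integral g (k + m) - b k\<bar> \<le> e) \<and> cesaro b \<longlonglongrightarrow> L' \<and>
        \<bar>(\<integral>p. extend_by_zero g p \<partial>past_law 0) - L'\<bar> \<le> e"
      by (intro exI[of _ m] exI[of _ "\<lambda>k. orbit_integral \<beta> (fiber g m) k 1"]
            exI[of _ "\<integral>y. fiber g m y \<partial>parry"] conjI allI 1 2 3)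
  qed
  then show "(\<lambda>n. nu_avg_integral \<beta> lam n g) \<longlonglongrightarrow> set_lebesgue_integral (past_law 0) Qsq g"
    unfolding nu_avg_eq_cesaro set_lebesgue_integral_def real_scaleR_def extend_by_zero_def .
qed simp

end

theorem theorem4p1:
  fixes \<beta> :: real
  assumes "1 < \<beta>" and "\<beta> < 2"
  defines "\<gamma> \<equiv> Inf {\<beta>' \<in> S_set. \<beta>' \<ge> \<beta>}"
  shows "AE lam in lborel. lam \<in> {0<..<1 / \<gamma>} \<longrightarrow>
           (\<exists>\<mu>. is_SRB \<beta> lam \<mu>) \<and>
           (\<forall>\<mu>. is_SRB \<beta> lam \<mu> \<longrightarrow>
              measure_hausdorff_dim \<mu> = 1 + ln \<beta> / ln (1 / lam))"
proof (rule AE_I2, rule impI)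
  fix lam :: real assume lam: "lam \<in> {0<..<1 / \<gamma>}"
  let ?S = "{\<beta>' \<in> S_set. \<beta>' \<ge> \<beta>}"
  have ne: "?S \<noteq> {}" using two_in_S_set assms(2) by (auto intro!: exI[of _ 2])
  have bdd: "bdd_below ?S" by (rule bdd_belowI[of _ \<beta>]) simp
  have "\<beta> \<le> \<gamma>" unfolding \<gamma>_def using ne by (intro cInf_greatest) auto
  then have "\<gamma> < 1 / lam" using lam assms(1) by (simp add: field_simps)
  \<comment> \<open>The infimum need not be attained in \<open>S_set\<close>; the strict inequality
    \<gamma> < 1 / lam leaves room for a member of \<open>S_set\<close>, so no exceptional lam
    arises.\<close>
  then obtain \<gamma>' where \<gamma>': "\<gamma>' \<in> S_set" "\<beta> \<le> \<gamma>'" "\<gamma>' < 1 / lam"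
    unfolding \<gamma>_def cInf_less_iff[OF ne bdd] by auto
  have "lam < 1 / \<gamma>'" using \<gamma>' lam assms(1) by (simp add: field_simps)
  moreover have "1 / \<gamma>' < 1" using \<gamma>' assms(1) by simp
  ultimately have "baker_map \<beta> lam" using lam assms by unfold_locales auto
  then interpret baker_map \<beta> lam .
  show "(\<exists>\<mu>. is_SRB \<beta> lam \<mu>) \<and> (\<forall>\<mu>. is_SRB \<beta> lam \<mu> \<longrightarrow> measure_hausdorff_dim \<mu> = 1 + ln \<beta> / ln (1 / lam))"
    using SRB_exists SRB_dimension[OF _ \<gamma>'(1,2) \<open>lam < 1 / \<gamma>'\<close>] unfolding dim_val_def by blast
qed

end
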